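(* Let $0\le\delta<\rho\le1$ and $\mu_1,\mu_2\in\mathbb{R}$. Let $\sigma_\hbar\in S^{\mu_1}_{\rho,\delta}(\hbar\mathbb{Z}^n\times\mathbb{T}^n)$ and $\tau_\hbar\in S^{\mu_2}_{\rho,\delta}(\hbar\mathbb{Z}^n\times\mathbb{T}^n)$. Then the composition $\mathrm{Op}_\hbar(\sigma_\hbar)\circ\mathrm{Op}_\hbar(\tau_\hbar)$ is a pseudo-differential operator with symbol $\varsigma_\hbar\in S^{\mu_1+\mu_2}_{\rho,\delta}(\hbar\mathbb{Z}^n\times\mathbb{T}^n)$, given by the asymptotic sum $$\varsigma_\hbar(k,\theta)\sim\sum_\alpha\frac1{\alpha!}D^{(\alpha)}_{\hbar,\theta}\sigma_\hbar(k,\theta)\,\Delta^\alpha_{\hbar,k}\tau_\hbar(k,\theta).$$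
   Context: Fix $n\ge1$ and $\hbar\in(0,1]$. $\hbar\mathbb{Z}^n=\{\hbar\bar k:\bar k\in\mathbb{Z}^n\}\subset\mathbb{R}^n$, $|k|$ is the Euclidean norm, $\mathbb{T}^n=\mathbb{R}^n/\mathbb{Z}^n$ with normalized Haar measure, $k\cdot\theta=\sum_jk_j\theta_j$, $\mathbb{N}_0=\{0,1,2,\dots\}$. Semi-classical Fourier transform: $\widehat f(\theta)=\sum_{k\in\hbar\mathbb{Z}^n}e^{-2\pi\frac{i}{\hbar}k\cdot\theta}f(k)$. $\mathcal{S}(\hbar\mathbb{Z}^n)$ is the space of $\varphi:\hbar\mathbb{Z}^n\to\mathbb{C}$ with $\sup_k(1+|k|)^N|\varphi(k)|<\infty$ for all $N$; operators are considered on $\mathcal{S}(\hbar\mathbb{Z}^n)$. Difference operators: with $v_j$ the $j$-th standard unit vector, $\Delta_{\hbar,j}g(k)=\frac{g(k+\hbar v_j)-g(k)}{\hbar}$ and $\Delta_\hbar^\alpha=\Delta_{\hbar,1}^{\alpha_1}\cdots\Delta_{\hbar,n}^{\alpha_n}$ (written $\Delta^\alpha_{\hbar,k}$ when acting in $k$). Toroidal operators: $D_{\hbar,\theta}^{(\beta)}=\hbar^{|\beta|}\prod_{j=1}^n\prod_{\ell=0}^{\beta_j-1}\big(\frac{1}{2\pi i}\frac{\partial}{\partial\theta_j}-\ell\big)$. Symbol class: $\sigma_\hbar:\hbar\mathbb{Z}^n\times\mathbb{T}^n\to\mathbb{C}$ belongs to $S^\mu_{\rho,\delta}(\hbar\mathbb{Z}^n\times\mathbb{T}^n)$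 if $\sigma_\hbar(k,\cdot)\in C^\infty(\mathbb{T}^n)$ for all $k$ and for all $\alpha,\beta\in\mathbb{N}_0^n$ there is $C_{\alpha,\beta}>0$ with $|D^{(\beta)}_{\hbar,\theta}\Delta^\alpha_{\hbar,k}\sigma_\hbar(k,\theta)|\le C_{\alpha,\beta}(1+|k|)^{\mu-\rho|\alpha|+\delta|\beta|}$ for all $(k,\theta)$. Quantization: $\mathrm{Op}_\hbar(\sigma_\hbar)f(k)=\int_{\mathbb{T}^n}e^{2\pi\frac{i}{\hbar}k\cdot\theta}\sigma_\hbar(k,\theta)\widehat f(\theta)\,d\theta$. The asymptotic sum means: for every $N\in\mathbb{N}$, $\varsigma_\hbar-\sum_{|\alpha|<N}\frac1{\alpha!}D^{(\alpha)}_{\hbar,\theta}\sigma_\hbar\,\Delta^\alpha_{\hbar,k}\tau_\hbar\in S^{\mu_1+\mu_2-N(\rho-\delta)}_{\rho,\delta}(\hbar\mathbb{Z}^n\times\mathbb{T}^n)$. *)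

theory Defs
  imports "HOL-Analysis.Analysis"
begin

text \<open>
  The coordinates \<open>1, \<dots>, n\<close> are the elements of a finite linearly ordered type \<open>'n\<close> (so that
  \<open>n = CARD('n) \<ge> 1\<close>); the order serves only to write ordered products of operators.
  Multi-indices are functions \<open>'n \<Rightarrow> nat\<close>.
\<close>

type_synonym 'n vfun = "(real, 'n) vec \<Rightarrow> complex"
type_synonym 'n symb = "(real, 'n) vec \<Rightarrow> (real, 'n) vec \<Rightarrow> complex"

definition mlen :: "('n::finite \<Rightarrow> nat) \<Rightarrow> nat" where
  "mlen \<alpha> = (\<Sum>j\<in>UNIV. \<alpha> j)"

definition mfact :: "('n::finite \<Rightarrow> nat) \<Rightarrow> nat" where
  "mfact \<alpha> = (\<Prod>j\<in>UNIV. fact (\<alpha> j))"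

definition int_vecs :: "(real ^ 'n) set" where
  "int_vecs = {m. \<forall>j. m $ j \<in> \<int>}"

text \<open>
  Functions on the lattice \<open>h\<int>\<^sup>n\<close> are represented by total functions on \<open>real ^ 'n\<close>; all notions
  below only use (or constrain) their values on \<open>hlattice h\<close>.
\<close>

definition hlattice :: "real \<Rightarrow> (real ^ 'n) set" where
  "hlattice h = (\<lambda>m. h *\<^sub>R m) ` int_vecs"

definition hdiff1 :: "real \<Rightarrow> 'n::finite \<Rightarrow> 'n vfun \<Rightarrow> 'n vfun" where
  "hdiff1 h j g k = (g (k + h *\<^sub>R axis j 1) - g k) / of_real h"

definition hdiff ::
  "real \<Rightarrow> ('n::{finite,linorder} \<Rightarrow> nat) \<Rightarrow> 'n vfun \<Rightarrow> 'n vfun" where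
  "hdiff h \<alpha> g = foldr (\<lambda>j. hdiff1 h j ^^ \<alpha> j) (sorted_list_of_set UNIV) g"

text \<open>
  Functions on the torus \<open>\<real>\<^sup>n/\<int>\<^sup>n\<close> are \<open>\<int>\<^sup>n\<close>-periodic functions on \<open>\<real>\<^sup>n\<close>, and the normalized Haar
  integral is the Lebesgue integral over the unit cube \<open>cbox 0 1\<close>.
\<close>

definition partial :: "'n::finite \<Rightarrow> 'n vfun \<Rightarrow> 'n vfun" where
  "partial j f \<theta> = vector_derivative (\<lambda>t. f (\<theta> + t *\<^sub>R axis j 1)) (at 0)"

primrec Cm :: "nat \<Rightarrow> 'n::finite vfun \<Rightarrow> bool" where
  "Cm 0 f \<longleftrightarrow> continuous_on UNIV f"
| "Cm (Suc m) f \<longleftrightarrow> f differentiable_on UNIV \<and> (\<forall>j. Cm m (partial j f))"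

definition smooth_torus :: "'n::finite vfun set" where
  "smooth_torus = {f. (\<forall>m. Cm m f) \<and> (\<forall>\<theta>. \<forall>m\<in>int_vecs. f (\<theta> + m) = f \<theta>)}"

text \<open>\<open>tfactor j l\<close> is the operator \<open>(1 / (2\<pi>i)) \<partial>/\<partial>\<theta>\<^sub>j - l\<close>.\<close>

definition tfactor :: "'n::finite \<Rightarrow> nat \<Rightarrow> 'n vfun \<Rightarrow> 'n vfun" where
  "tfactor j l f \<theta> = 1 / (2 * of_real pi * \<i>) * partial j f \<theta> - of_nat l * f \<theta>"

definition tderiv ::
  "real \<Rightarrow> ('n::{finite,linorder} \<Rightarrow> nat) \<Rightarrow> 'n vfun \<Rightarrow> 'n vfun" where
  "tderiv h \<beta> f \<theta> = of_real (h ^ mlen \<beta>) *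
     foldr (\<lambda>j. foldr (\<lambda>l. tfactor j l) [0..<\<beta> j]) (sorted_list_of_set UNIV) f \<theta>"

definition symbol_class ::
  "real \<Rightarrow> real \<Rightarrow> real \<Rightarrow> real \<Rightarrow> 'n::{finite,linorder} symb set" where
  "symbol_class h \<mu> \<rho> \<delta> =
     {\<sigma>. (\<forall>k\<in>hlattice h. \<sigma> k \<in> smooth_torus) \<and>
         (\<forall>\<alpha> \<beta>. \<exists>C>0. \<forall>k\<in>hlattice h. \<forall>\<theta>.
            cmod (tderiv h \<beta> (\<lambda>\<theta>'. hdiff h \<alpha> (\<lambda>k'. \<sigma> k' \<theta>') k) \<theta>)
              \<le> C * (1 + norm k) powr (\<mu> - \<rho> * real (mlen \<alpha>) + \<delta> * real (mlen \<beta>)))}"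

definition schwartz :: "real \<Rightarrow> 'n::finite vfun set" where
  "schwartz h = {f. \<forall>N::nat. bdd_above ((\<lambda>k. (1 + norm k) ^ N * cmod (f k)) ` hlattice h)}"

definition hfourier :: "real \<Rightarrow> 'n::finite vfun \<Rightarrow> 'n vfun" where
  "hfourier h f \<theta> =
     (\<Sum>\<^sub>\<infinity>k\<in>hlattice h. exp (- 2 * of_real pi * \<i> / of_real h * of_real (k \<bullet> \<theta>)) * f k)"

definition Oph ::
  "real \<Rightarrow> 'n::finite symb \<Rightarrow> 'n vfun \<Rightarrow> 'n vfun" where
  "Oph h \<sigma> f k =
     (LINT \<theta>:cbox 0 1|lborel.
        exp (2 * of_real pi * \<i> / of_real h * of_real (k \<bullet> \<theta>)) * \<sigma> k \<theta> * hfourier h f \<theta>)"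

text \<open>
  \<open>\<zeta> \<sim> \<Sum>\<^sub>\<alpha> (1/\<alpha>!) D\<^sup>(\<^sup>\<alpha>\<^sup>) \<sigma> \<Delta>\<^sup>\<alpha> \<tau>\<close>: every remainder after subtracting the terms with \<open>\<bar>\<alpha>\<bar> < N\<close>
  lies in the symbol class of order \<open>\<mu> - N (\<rho> - \<delta>)\<close>.
\<close>

definition asymp_composition ::
  "real \<Rightarrow> real \<Rightarrow> real \<Rightarrow> real \<Rightarrow>
   'n::{finite,linorder} symb \<Rightarrow> 'n symb \<Rightarrow> 'n symb \<Rightarrow> bool" where
  "asymp_composition h \<mu> \<rho> \<delta> \<zeta> \<sigma> \<tau> \<longleftrightarrow>
     (\<forall>N::nat. (\<lambda>k \<theta>. \<zeta> k \<theta> -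
          (\<Sum>\<alpha> | mlen \<alpha> < N. 1 / of_nat (mfact \<alpha>) *
              tderiv h \<alpha> (\<sigma> k) \<theta> * hdiff h \<alpha> (\<lambda>k'. \<tau> k' \<theta>) k))
        \<in> symbol_class h (\<mu> - real N * (\<rho> - \<delta>)) \<rho> \<delta>)"

text \<open>The sum above ranges over a finite set.\<close>

lemma finite_mlen_less: "finite {\<alpha> :: 'n::finite \<Rightarrow> nat. mlen \<alpha> < N}"
proof (rule finite_subset)
  show "{\<alpha> :: 'n \<Rightarrow> nat. mlen \<alpha> < N} \<subseteq> (UNIV :: 'n set) \<rightarrow>\<^sub>E {..<N}"
  proof (auto simp: PiE_UNIV_domain mlen_def)
    fix \<alpha> :: "'n \<Rightarrow> nat" and j assume "sum \<alpha> UNIV < N"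
    moreover have "\<alpha> j \<le> sum \<alpha> UNIV" by (rule member_le_sum) auto
    ultimately show "\<alpha> j < N" by linarith
  qed
qed (rule finite_PiE, auto)

end

theory Submission
  imports Defs
begin

text \<open>
  In Fourier coefficients \<open>a\<^sub>m(k)\<close> of \<open>\<sigma>(k, \<cdot>)\<close> the operator is \<open>(Op \<sigma> f)(k) = \<Sum>\<^sub>m a\<^sub>m(k) f(k + h m)\<close>, so
  the symbol of the composition is \<open>\<Sum>\<^sub>m a\<^sub>m(k) exp(2\<pi>i m\<cdot>\<theta>) \<tau>(k + h m, \<theta>)\<close>. Expanding \<open>\<tau>(k + h m, \<theta>)\<close> by
  Newton's interpolation formula in differences at \<open>k\<close> gives exactly the terms
  \<open>(1/\<alpha>!) D\<^sup>(\<^sup>\<alpha>\<^sup>) \<sigma> \<Delta>\<^sup>\<alpha> \<tau>\<close>, because \<open>D\<^sup>(\<^sup>\<alpha>\<^sup>)\<close> multiplies \<open>a\<^sub>m\<close> by a falling factorial of \<open>m\<close>. The terms have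
  the right order by Leibniz rules. Hence the remainder of order \<open>N\<close> may be replaced by that of any order
  \<open>M \<ge> N\<close>, and for this one a crude bound suffices: since \<open>h\<close> is fixed, differences are finite combinations
  of shifts, and it is enough that the Fourier coefficients decay faster than a given power of \<open>1 + \<bar>k\<bar>\<close>.
\<close>

section \<open>Rapidly decreasing Fourier series on the torus\<close>

text \<open>The obstacle is that sup bounds in \<theta> and decay of Fourier coefficients do not
  convert into each other for free: a power of \<open>bracket m\<close> costs \<delta> in the order,
  and returning from coefficients to a sup bound takes 2n further powers. The terms of the expansion
  need sharp bounds, so they stay on the function side and are multiplied there. The Newton
  remainder couples the frequency m with the base point \<kappa> + m and is no product of two
  symbols; it is estimated on the coefficient side. The loss is finite for each pair (\<alpha>,
  \<beta>), and every further order of expansion regains \<rho> - \<delta> > 0, so the order M is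
  chosen after \<alpha> and \<beta>. That gain is available only while \<kappa> + m stays comparable
  with \<kappa>; for larger m the decay in m has to pay, at a net gain of 1 - \<delta> > 0 per
  power. All convergence questions become questions about absolutely summable families over integer
  vectors. The way there is Fourier inversion for smooth functions, whose uniqueness part rests on
  polynomial approximation.\<close>

definition ivec :: "int ^ 'n \<Rightarrow> real ^ 'n" where
  "ivec m = (\<chi> j. real_of_int (m $ j))"

text \<open>The l1 weight drops by exactly one when a nonzero coordinate moves one step towards
  zero, which is what the lattice paths in \<open>bracket_induct\<close> run on. For fixed n it is
  comparable with one plus the Euclidean norm.\<close>

definition bracket :: "int ^ 'n::finite \<Rightarrow> real" where
  "bracket m = 1 + (\<Sum>j\<in>UNIV. \<bar>real_of_int (m $ j)\<bar>)"

definition torus_char :: "int ^ 'n::finite \<Rightarrow> real ^ 'n \<Rightarrow> complex" where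
  "torus_char m \<theta> = exp (2 * of_real pi * \<i> * of_real (ivec m \<bullet> \<theta>))"

lemma ivec_simps [simp]:
  "ivec (m + l) = ivec m + ivec l" "ivec (m - l) = ivec m - ivec l"
  "ivec (- m) = - ivec m" "ivec 0 = 0" "ivec (axis j a) = axis j (real_of_int a)"
  "ivec m $ j = real_of_int (m $ j)"
  by (simp_all add: ivec_def vec_eq_iff axis_def)

lemma inj_ivec: "inj ivec"
  by (auto simp: inj_def ivec_def vec_eq_iff)

lemma range_ivec: "range ivec = int_vecs"
proof -
  have "x \<in> range ivec" if "x \<in> int_vecs" for x :: "real ^ 'n"
  proof -
    have "ivec (\<chi> j. \<lfloor>x $ j\<rfloor>) = x"
      using that by (auto simp: int_vecs_def ivec_def vec_eq_iff Ints_def)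
    then show ?thesis by (metis rangeI)
  qed
  then show ?thesis by (auto simp: int_vecs_def ivec_def)
qed

lemma hlattice_eq: "hlattice h = range (\<lambda>\<kappa>. h *\<^sub>R ivec \<kappa>)"
  by (auto simp: hlattice_def range_ivec[symmetric])

lemma bracket_ge_1: "1 \<le> bracket m"
  by (simp add: bracket_def sum_nonneg)

lemma bracket_pos [simp]: "0 < bracket m"
  using bracket_ge_1[of m] by simp

lemma bracket_uminus [simp]: "bracket (- m) = bracket m"
  by (simp add: bracket_def)

lemma bracket_add_le: "bracket (m + l) \<le> bracket m + bracket l - 1"
proof -
  have "(\<Sum>j\<in>UNIV. \<bar>real_of_int ((m + l) $ j)\<bar>) \<le> (\<Sum>j\<in>UNIV. \<bar>real_of_int (m $ j)\<bar> + \<bar>real_of_int (l $ j)\<bar>)"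
    by (rule sum_mono) simp
  then show ?thesis by (simp add: bracket_def sum.distrib)
qed

lemma bracket_add_mult: "bracket (m + l) \<le> bracket m * bracket l"
proof -
  have "0 \<le> (bracket m - 1) * (bracket l - 1)"
    using bracket_ge_1[of m] bracket_ge_1[of l] by simp
  then show ?thesis using bracket_add_le[of m l] by (simp add: algebra_simps)
qed

lemma bracket_axis [simp]: "bracket (axis j 1) = 2"
proof -
  have "(\<Sum>i\<in>UNIV. \<bar>real_of_int ((axis j 1 :: int^'a) $ i)\<bar>) = (\<Sum>i\<in>UNIV. if i = j then 1 else 0)"
    by (rule sum.cong) (auto simp: axis_def)
  then show ?thesis by (simp add: bracket_def)
qed

lemma coord_le_bracket: "\<bar>real_of_int (m $ j)\<bar> \<le> bracket m"
proof -
  have "\<bar>real_of_int (m $ j)\<bar> \<le> (\<Sum>i\<in>UNIV. \<bar>real_of_int (m $ i)\<bar>)"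
    by (rule member_le_sum) auto
  then show ?thesis by (simp add: bracket_def)
qed

lemma norm_ivec_le: "1 + norm (ivec m) \<le> bracket m"
  using norm_le_l1_cart[of "ivec m"] by (simp add: bracket_def)

lemma bracket_le_norm_ivec: "bracket m \<le> 1 + real CARD('n) * norm (ivec (m :: int ^ 'n::finite))"
proof -
  have "(\<Sum>j\<in>UNIV. \<bar>ivec m $ j\<bar>) \<le> (\<Sum>j\<in>(UNIV::'n set). norm (ivec m))"
    by (rule sum_mono) (rule component_le_norm_cart)
  then show ?thesis by (simp add: bracket_def)
qed

lemma torus_char_add: "torus_char (m + l) \<theta> = torus_char m \<theta> * torus_char l \<theta>"
  by (simp add: torus_char_def inner_add_left algebra_simps flip: exp_add)

lemma torus_char_arg_add: "torus_char m (\<theta> + v) = torus_char m \<theta> * torus_char m v"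
  by (simp add: torus_char_def inner_add_right algebra_simps flip: exp_add)

lemma torus_char_0 [simp]: "torus_char 0 \<theta> = 1" "torus_char m 0 = 1"
  by (simp_all add: torus_char_def)

lemma norm_torus_char [simp]: "norm (torus_char m \<theta>) = 1"
proof -
  have "torus_char m \<theta> = cis (2 * pi * (ivec m \<bullet> \<theta>))"
    unfolding torus_char_def cis_conv_exp by (simp add: mult_ac)
  then show ?thesis by simp
qed

lemma torus_char_ivec [simp]: "torus_char m (ivec l) = 1"
proof -
  have "ivec m \<bullet> ivec l = of_int (\<Sum>j\<in>UNIV. m $ j * l $ j)"
    by (simp add: ivec_def inner_vec_def)
  then have "torus_char m (ivec l) = exp (2 * of_real pi * \<i> * of_int (\<Sum>j\<in>UNIV. m $ j * l $ j))"
    by (simp add: torus_char_def)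
  also have "\<dots> = 1"
    unfolding exp_eq_1 by (auto intro!: exI[of _ "\<Sum>j\<in>UNIV. m $ j * l $ j"])
  finally show ?thesis .
qed

lemma torus_char_uminus: "torus_char (- m) \<theta> = cnj (torus_char m \<theta>)"
  by (simp add: torus_char_def exp_cnj)

lemma torus_char_uminus_mult [simp]: "torus_char (- m) \<theta> * torus_char m \<theta> = 1" "torus_char m \<theta> * torus_char (- m) \<theta> = 1"
  using torus_char_add[of "-m" m \<theta>] torus_char_add[of m "-m" \<theta>] by simp_all

text \<open>The power 2n dominates the product over j of the squares of 1 + |m_j|, and the sum of
  this product over a product set factorises into n one-dimensional sums.\<close>

lemma summable_on_bracket_powr:
  "(\<lambda>m :: int ^ 'n::finite. inverse (bracket m ^ (2 * CARD('n)))) summable_on UNIV"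
proof (rule nonneg_bdd_above_summable_on)
  let ?g = "\<lambda>t::int. inverse ((1 + \<bar>real_of_int t\<bar>)^2)"
  have s0: "summable (\<lambda>n::nat. inverse ((1 + real n)^2))"
    using inverse_power_summable[of 2, where 'a=real] summable_Suc_iff[of "\<lambda>n. inverse ((real n)^2)"]
    by simp
  then have s1: "(\<lambda>n::nat. inverse ((1 + real n)^2)) summable_on UNIV"
    by (intro summable_nonneg_imp_summable_on) auto
  have "?g summable_on range int"
    by (subst summable_on_reindex) (use s1 in \<open>auto simp: o_def\<close>)
  moreover have "?g summable_on range (\<lambda>n. - int n)"
    by (subst summable_on_reindex) (use s1 in \<open>auto simp: o_def inj_def\<close>)
  ultimately have "?g summable_on (range int \<union> range (\<lambda>n. - int n))"
    by (rule summable_on_union)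
  moreover have "range int \<union> range (\<lambda>n. - int n) = UNIV"
  proof -
    have "x \<in> range int \<or> x \<in> range (\<lambda>n. - int n)" for x
      by (cases x rule: int_cases2) auto
    then show ?thesis by blast
  qed
  ultimately have g: "?g summable_on UNIV" by simp
  define G where "G = infsum ?g UNIV"
  have G: "sum ?g T \<le> G" if "finite T" for T
    unfolding G_def by (rule finite_sum_le_infsum[OF g that]) auto
  show "bdd_above (sum (\<lambda>m :: int ^ 'n. inverse (bracket m ^ (2 * CARD('n)))) ` {F. F \<subseteq> UNIV \<and> finite F})"
  proof (rule bdd_aboveI2)
    fix F :: "(int ^ 'n) set" assume "F \<in> {F. F \<subseteq> UNIV \<and> finite F}"
    then have F: "finite F" by simp
    \<comment> \<open>One finite set of integers holding every coordinate of every element of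
      \<open>F\<close>, so that \<open>F\<close> embeds into the functions with values in
      \<open>T\<close> and \<open>prod_sum_PiE\<close> applies.\<close>
    define T where "T = (\<Union>j. (\<lambda>m. m $ j) ` F)"
    have T: "finite T" using F by (auto simp: T_def)
    have "sum (\<lambda>m. inverse (bracket m ^ (2 * CARD('n)))) F \<le> sum (\<lambda>m. \<Prod>j\<in>UNIV. ?g (m $ j)) F"
    proof (rule sum_mono)
      fix m :: "int ^ 'n"
      have "(\<Prod>j\<in>(UNIV::'n set). (1 + \<bar>real_of_int (m $ j)\<bar>)^2) \<le> (\<Prod>j\<in>(UNIV::'n set). bracket m ^ 2)"
      proof (intro prod_mono conjI power_mono)
        fix j :: 'n
        have "\<bar>real_of_int (m $ j)\<bar> \<le> (\<Sum>i\<in>UNIV. \<bar>real_of_int (m $ i)\<bar>)"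
          by (rule member_le_sum) auto
        then show "1 + \<bar>real_of_int (m $ j)\<bar> \<le> bracket m" by (simp add: bracket_def)
      qed auto
      also have "\<dots> = bracket m ^ (2 * CARD('n))" by (simp add: power_mult)
      finally have "inverse (bracket m ^ (2 * CARD('n))) \<le> inverse (\<Prod>j\<in>(UNIV::'n set). (1 + \<bar>real_of_int (m $ j)\<bar>)^2)"
        by (intro le_imp_inverse_le prod_pos) auto
      also have "\<dots> = (\<Prod>j\<in>UNIV. ?g (m $ j))"
        by (simp add: prod_inversef[symmetric] o_def)
      finally show "inverse (bracket m ^ (2 * CARD('n))) \<le> (\<Prod>j\<in>UNIV. ?g (m $ j))" .
    qed
    also have "\<dots> = sum (\<lambda>f. \<Prod>j\<in>UNIV. ?g (f j)) ((\<lambda>m. ($) m) ` F)"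
      by (subst sum.reindex) (auto simp: inj_on_def vec_eq_iff)
    also have "\<dots> \<le> sum (\<lambda>f. \<Prod>j\<in>UNIV. ?g (f j)) (PiE (UNIV :: 'n set) (\<lambda>_. T))"
      by (rule sum_mono2) (auto simp: T_def intro!: finite_PiE T[unfolded T_def] prod_nonneg)
    also have "\<dots> = (\<Prod>j\<in>(UNIV::'n set). sum ?g T)"
      by (rule prod_sum_PiE[symmetric]) (auto simp: T)
    also have "\<dots> \<le> G ^ CARD('n)"
      using G[OF T] by (simp add: power_mono sum_nonneg)
    finally show "sum (\<lambda>m. inverse (bracket m ^ (2 * CARD('n)))) F \<le> G ^ CARD('n)" .
  qed
qed (auto intro: less_imp_le)

section \<open>Decay and absolute summability of coefficient families\<close>

definition abs_summable :: "('a \<Rightarrow> complex) \<Rightarrow> bool" where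
  "abs_summable c \<longleftrightarrow> (\<lambda>m. norm (c m)) summable_on UNIV"

definition rapid :: "(int ^ 'n::finite \<Rightarrow> complex) \<Rightarrow> bool" where
  "rapid c \<longleftrightarrow> (\<forall>q::nat. \<exists>C. \<forall>m. norm (c m) * bracket m ^ q \<le> C)"

definition fourier_series :: "(int ^ 'n::finite \<Rightarrow> complex) \<Rightarrow> real ^ 'n \<Rightarrow> complex" where
  "fourier_series c \<theta> = (\<Sum>\<^sub>\<infinity>m. c m * torus_char m \<theta>)"

definition bracket_sum :: "'n::finite itself \<Rightarrow> real" where
  "bracket_sum _ = (\<Sum>\<^sub>\<infinity>m::int ^ 'n. inverse (bracket m ^ (2 * CARD('n))))"

lemma abs_summable_comparison:
  assumes "g summable_on UNIV" "\<And>m. norm (c m) \<le> g m"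
  shows "abs_summable c"
  unfolding abs_summable_def
  by (rule summable_on_comparison_test[OF assms(1)]) (use assms(2) in auto)

lemma abs_summable_cmult: "abs_summable c \<Longrightarrow> abs_summable (\<lambda>m. a * c m)"
  unfolding abs_summable_def norm_mult by (rule summable_on_cmult_right)

lemma abs_summable_imp_summable: "abs_summable c \<Longrightarrow> c summable_on UNIV"
  unfolding abs_summable_def by (rule abs_summable_summable)

text \<open>The passage from pointwise decay to an l1 bound. The result is linear in
  \<open>C\<close>, so a power of \<open>bracket \<kappa>\<close> hidden in \<open>C\<close>
  survives the summation; this is how bounds uniform in \<kappa> arise.\<close>

lemma abs_summable_bracket:
  fixes c :: "int ^ 'n::finite \<Rightarrow> complex"
  assumes "\<And>m. norm (c m) * bracket m ^ (2 * CARD('n)) \<le> C"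
  shows "abs_summable c" and "infsum (\<lambda>m. norm (c m)) UNIV \<le> C * bracket_sum TYPE('n)"
proof -
  have le: "norm (c m) \<le> C * inverse (bracket m ^ (2 * CARD('n)))" for m
    using assms[of m] by (simp add: field_simps)
  have s: "(\<lambda>m::int ^ 'n. C * inverse (bracket m ^ (2 * CARD('n)))) summable_on UNIV"
    by (intro summable_on_cmult_right summable_on_bracket_powr)
  show a: "abs_summable c" by (rule abs_summable_comparison[OF s le])
  have "infsum (\<lambda>m. norm (c m)) UNIV \<le> (\<Sum>\<^sub>\<infinity>m::int ^ 'n. C * inverse (bracket m ^ (2 * CARD('n))))"
    by (rule infsum_mono) (use a s le in \<open>auto simp: abs_summable_def\<close>)
  then show "infsum (\<lambda>m. norm (c m)) UNIV \<le> C * bracket_sum TYPE('n)"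
    by (simp add: bracket_sum_def infsum_cmult_right')
qed

lemma rapid_abs_summable: "rapid c \<Longrightarrow> abs_summable c"
  unfolding rapid_def using abs_summable_bracket(1) by metis

lemma rapid_add: "rapid c \<Longrightarrow> rapid d \<Longrightarrow> rapid (\<lambda>m. c m + d m)"
  unfolding rapid_def
proof
  fix q assume c: "\<forall>q. \<exists>C. \<forall>m. norm (c m) * bracket m ^ q \<le> C" and d: "\<forall>q. \<exists>C. \<forall>m. norm (d m) * bracket m ^ q \<le> C"
  obtain C D where C: "\<And>m. norm (c m) * bracket m ^ q \<le> C" and D: "\<And>m. norm (d m) * bracket m ^ q \<le> D"
    using c d by metis
  have "norm (c m + d m) * bracket m ^ q \<le> C + D" for m
  proof -
    have "norm (c m + d m) * bracket m ^ q \<le> (norm (c m) + norm (d m)) * bracket m ^ q"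
      by (intro mult_right_mono norm_triangle_ineq) (simp add: less_imp_le)
    then show ?thesis using C[of m] D[of m] by (simp add: algebra_simps)
  qed
  then show "\<exists>C. \<forall>m. norm (c m + d m) * bracket m ^ q \<le> C" by blast
qed

lemma rapid_bounded_mult:
  assumes c: "rapid c" and a: "\<And>m. norm (a m) \<le> B * bracket m ^ p"
  shows "rapid (\<lambda>m. a m * c m)"
  unfolding rapid_def
proof
  fix q
  obtain C where C: "\<And>m. norm (c m) * bracket m ^ (p + q) \<le> C"
    using c unfolding rapid_def by metis
  have B: "0 \<le> B" using order_trans[OF norm_ge_zero a[of 0]] by (simp add: bracket_def)
  have "norm (a m * c m) * bracket m ^ q \<le> B * C" for m
  proof -
    have "norm (a m * c m) * bracket m ^ q \<le> (B * bracket m ^ p) * norm (c m) * bracket m ^ q"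
      unfolding norm_mult by (intro mult_right_mono a) (auto simp: less_imp_le)
    also have "\<dots> = B * (norm (c m) * bracket m ^ (p + q))" by (simp add: power_add)
    also have "\<dots> \<le> B * C" by (intro mult_left_mono C B)
    finally show ?thesis .
  qed
  then show "\<exists>C. \<forall>m. norm (a m * c m) * bracket m ^ q \<le> C" by blast
qed

lemma rapid_cmult: "rapid c \<Longrightarrow> rapid (\<lambda>m. a * c m)"
  by (rule rapid_bounded_mult[where B = "norm a" and p = 0]) auto

lemma rapid_0 [simp]: "rapid (\<lambda>m. 0)"
  by (auto simp: rapid_def)

lemma rapid_diff: "rapid c \<Longrightarrow> rapid d \<Longrightarrow> rapid (\<lambda>m. c m - d m)"
  using rapid_add[of c "\<lambda>m. (-1) * d m"] rapid_cmult[of d "-1"] by simp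

lemma rapid_sum: "(\<And>i. i \<in> I \<Longrightarrow> rapid (c i)) \<Longrightarrow> rapid (\<lambda>m. \<Sum>i\<in>I. c i m)"
  by (induction I rule: infinite_finite_induct) (auto intro: rapid_add)

lemma rapid_coord_mult: "rapid c \<Longrightarrow> rapid (\<lambda>m. of_int (m $ j) * c m)"
  by (rule rapid_bounded_mult[where B = 1 and p = 1]) (use coord_le_bracket in auto)

lemma fourier_series_summable: "abs_summable c \<Longrightarrow> (\<lambda>m. c m * torus_char m \<theta>) summable_on UNIV"
  by (rule abs_summable_imp_summable) (simp add: abs_summable_def norm_mult)

lemma fourier_series_has_sum: "abs_summable c \<Longrightarrow> ((\<lambda>m. c m * torus_char m \<theta>) has_sum fourier_series c \<theta>) UNIV"
  unfolding fourier_series_def by (rule has_sum_infsum[OF fourier_series_summable])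

lemma norm_fourier_series_le: "abs_summable c \<Longrightarrow> norm (fourier_series c \<theta>) \<le> infsum (\<lambda>m. norm (c m)) UNIV"
  using norm_infsum_bound[of "\<lambda>m. c m * torus_char m \<theta>" UNIV]
  by (simp add: fourier_series_def norm_mult abs_summable_def)

lemma fourier_series_add: "abs_summable c \<Longrightarrow> abs_summable d \<Longrightarrow> fourier_series (\<lambda>m. c m + d m) \<theta> = fourier_series c \<theta> + fourier_series d \<theta>"
  unfolding fourier_series_def by (subst infsum_add[symmetric]) (auto simp: fourier_series_summable algebra_simps)

lemma fourier_series_cmult: "fourier_series (\<lambda>m. a * c m) \<theta> = a * fourier_series c \<theta>"
  unfolding fourier_series_def by (simp add: mult.assoc infsum_cmult_right')

lemma fourier_series_0 [simp]: "fourier_series (\<lambda>m. 0) \<theta> = 0"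
  by (simp add: fourier_series_def)

lemma fourier_series_diff:
  assumes "abs_summable c" "abs_summable d"
  shows "fourier_series (\<lambda>m. c m - d m) \<theta> = fourier_series c \<theta> - fourier_series d \<theta>"
  using fourier_series_add[OF assms(1) abs_summable_cmult[OF assms(2), of "-1"], of \<theta>] fourier_series_cmult[of "-1" d \<theta>] by simp

lemma fourier_series_sum: "(\<And>i. i \<in> I \<Longrightarrow> rapid (c i)) \<Longrightarrow> fourier_series (\<lambda>m. \<Sum>i\<in>I. c i m) \<theta> = (\<Sum>i\<in>I. fourier_series (c i) \<theta>)"
proof (induction I rule: infinite_finite_induct)
  case (insert i I)
  then show ?case
    by (simp add: fourier_series_add rapid_abs_summable rapid_sum)
qed auto

lemma fourier_series_periodic: "fourier_series c (\<theta> + ivec l) = fourier_series c \<theta>"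
  by (simp add: fourier_series_def torus_char_arg_add)

section \<open>Termwise differentiation of Fourier series\<close>

lemma has_sum_finite_sum:
  fixes f :: "'i \<Rightarrow> 'a \<Rightarrow> 'b :: topological_comm_monoid_add"
  assumes "\<And>i. i \<in> I \<Longrightarrow> (f i has_sum s i) A"
  shows "((\<lambda>x. \<Sum>i\<in>I. f i x) has_sum (\<Sum>i\<in>I. s i)) A"
  using assms
proof (induction I rule: infinite_finite_induct)
  case (insert i I)
  then have "(f i has_sum s i) A" "((\<lambda>x. \<Sum>i\<in>I. f i x) has_sum (\<Sum>i\<in>I. s i)) A" by auto
  from has_sum_add[OF this] show ?case using insert.hyps by simp
qed simp_all

text \<open>The mean value inequality applied twice: to the exponential, and then to the exponential
  minus its linear term, whose derivative the first application bounds by |x| on the interval. A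
  quadratic error is what a weight \<open>bracket m ^ 2\<close> can sum.\<close>

lemma norm_cis_expand: "norm (exp (\<i> * of_real x) - 1 - \<i> * of_real x) \<le> x\<^sup>2"
  for x :: real
proof -
  have E: "((\<lambda>t. exp (\<i> * of_real t)) has_derivative (\<lambda>h. \<i> * of_real h * exp (\<i> * of_real t))) (at t within S)"
    for t :: real and S
  proof -
    have "((\<lambda>t. exp (\<i> * of_real t)) has_vector_derivative (\<i> * exp (\<i> * of_real t))) (at t within S)"
      by (rule has_vector_derivative_real_field) (auto intro!: derivative_eq_intros)
    then show ?thesis by (simp add: has_vector_derivative_def scaleR_conv_of_real mult_ac)
  qed
  have A: "norm (exp (\<i> * of_real t) - 1) \<le> \<bar>t\<bar>" for t :: real
  proof -
    have "norm (exp (\<i> * of_real t) - exp (\<i> * of_real 0)) \<le> 1 * norm (t - 0)"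
    proof (rule differentiable_bound[of UNIV "\<lambda>t. exp (\<i> * of_real t)" "\<lambda>t h. \<i> * of_real h * exp (\<i> * of_real t)"])
      fix t :: real
      show "((\<lambda>t. exp (\<i> * of_real t)) has_derivative (\<lambda>h. \<i> * of_real h * exp (\<i> * of_real t))) (at t within UNIV)"
        by (rule E)
      show "onorm (\<lambda>h. \<i> * of_real h * exp (\<i> * of_real t)) \<le> 1"
        by (rule onorm_le) (simp add: norm_mult)
    qed auto
    then show ?thesis by simp
  qed
  have "norm ((exp (\<i> * of_real x) - \<i> * of_real x) - (exp (\<i> * of_real 0) - \<i> * of_real 0)) \<le> \<bar>x\<bar> * norm (x - 0)"
  proof (rule differentiable_bound[of "{-\<bar>x\<bar>..\<bar>x\<bar>}" "\<lambda>t. exp (\<i> * of_real t) - \<i> * of_real t"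
           "\<lambda>t h. \<i> * of_real h * (exp (\<i> * of_real t) - 1)"])
    fix t :: real assume t: "t \<in> {-\<bar>x\<bar>..\<bar>x\<bar>}"
    show "((\<lambda>t. exp (\<i> * of_real t) - \<i> * of_real t) has_derivative
            (\<lambda>h. \<i> * of_real h * (exp (\<i> * of_real t) - 1))) (at t within {-\<bar>x\<bar>..\<bar>x\<bar>})"
      by (auto intro!: derivative_eq_intros E simp: algebra_simps)
    show "onorm (\<lambda>h. \<i> * of_real h * (exp (\<i> * of_real t) - 1)) \<le> \<bar>x\<bar>"
    proof (rule onorm_le)
      fix h :: real
      have "norm (exp (\<i> * of_real t) - 1) \<le> \<bar>x\<bar>"
        by (rule order_trans[OF A]) (use t in auto)
      then show "norm (\<i> * of_real h * (exp (\<i> * of_real t) - 1)) \<le> \<bar>x\<bar> * norm h"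
        by (simp add: norm_mult mult_mono mult.commute[of "\<bar>x\<bar>"])
    qed
  qed auto
  then show ?thesis by (simp add: power2_eq_square algebra_simps)
qed

text \<open>Each character is linearised separately, with an error quadratic in \<open>v\<close> and
  a constant proportional to \<open>bracket m ^ 2\<close>. Rapid decay makes these constants
  summable, which gives the total derivative at once.\<close>

lemma fourier_series_has_derivative:
  assumes "rapid c"
  shows "(fourier_series c has_derivative
           (\<lambda>v. \<Sum>j\<in>UNIV. of_real (v $ j) * fourier_series (\<lambda>m. 2 * of_real pi * \<i> * of_int (m $ j) * c m) \<theta>)) (at \<theta>)"
    (is "(_ has_derivative ?L) _")
proof -
  let ?c = "\<lambda>j m. 2 * of_real pi * \<i> * of_int (m $ j) * c m"
  have rc: "rapid (?c j)" for j
    using rapid_cmult[OF rapid_coord_mult[OF assms], of "2 * of_real pi * \<i>" j] by (simp add: mult_ac)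
  define K where "K = infsum (\<lambda>m. norm (of_real (bracket m ^ 2) * c m)) UNIV"
  have rK: "rapid (\<lambda>m. of_real (bracket m ^ 2) * c m)"
    by (rule rapid_bounded_mult[OF assms, where B=1 and p=2]) (simp add: norm_power)
  have bound: "norm (fourier_series c (\<theta> + v) - fourier_series c \<theta> - ?L v) \<le> (2 * pi)^2 * K * norm v ^ 2" for v
  proof -
    let ?r = "\<lambda>m. c m * torus_char m \<theta> * (torus_char m v - 1 - \<i> * of_real (2 * pi * (ivec m \<bullet> v)))"
    have "((\<lambda>m. c m * torus_char m (\<theta> + v) - c m * torus_char m \<theta> - (\<Sum>j\<in>UNIV. of_real (v $ j) * (?c j m * torus_char m \<theta>))) has_sum
            (fourier_series c (\<theta> + v) - fourier_series c \<theta> - ?L v)) UNIV"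
    proof -
      have 1: "((\<lambda>m. c m * torus_char m (\<theta> + v) + - (c m * torus_char m \<theta>)) has_sum (fourier_series c (\<theta> + v) + - fourier_series c \<theta>)) UNIV"
        by (rule has_sum_add[OF fourier_series_has_sum has_sum_uminusI[OF fourier_series_has_sum]]) (rule rapid_abs_summable[OF assms])+
      have 2: "((\<lambda>m. \<Sum>j\<in>UNIV. of_real (v $ j) * (?c j m * torus_char m \<theta>)) has_sum ?L v) UNIV"
      proof (rule has_sum_finite_sum)
        show "((\<lambda>m. of_real (v $ j) * (?c j m * torus_char m \<theta>)) has_sum (of_real (v $ j) * fourier_series (?c j) \<theta>)) UNIV" for j
          by (rule has_sum_cmult_right[OF fourier_series_has_sum[OF rapid_abs_summable[OF rc]]])
      qed
      from has_sum_add[OF 1 has_sum_uminusI[OF 2]]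
      show ?thesis by simp
    qed
    moreover have "c m * torus_char m (\<theta> + v) - c m * torus_char m \<theta> - (\<Sum>j\<in>UNIV. of_real (v $ j) * (?c j m * torus_char m \<theta>)) = ?r m" for m
    proof -
      have "(\<Sum>j\<in>UNIV. of_real (v $ j) * (?c j m * torus_char m \<theta>)) = c m * torus_char m \<theta> * (\<i> * of_real (2 * pi * (ivec m \<bullet> v)))"
        by (simp add: inner_vec_def sum_distrib_left mult_ac)
      moreover have "a * (x * y) - a * x - a * x * T = a * x * (y - 1 - T)" for a x y T :: complex
        by (simp add: algebra_simps)
      ultimately show ?thesis unfolding torus_char_arg_add by metis
    qed
    ultimately have hs: "(?r has_sum (fourier_series c (\<theta> + v) - fourier_series c \<theta> - ?L v)) UNIV" by simp
    have le: "norm (?r m) \<le> (2 * pi)^2 * norm v ^ 2 * norm (of_real (bracket m ^ 2) * c m)" for m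
    proof -
      have e: "torus_char m v = exp (\<i> * of_real (2 * pi * (ivec m \<bullet> v)))"
        by (simp add: torus_char_def mult_ac)
      have "\<bar>ivec m \<bullet> v\<bar> \<le> bracket m * norm v"
      proof (rule order_trans[OF Cauchy_Schwarz_ineq2])
        show "norm (ivec m) * norm v \<le> bracket m * norm v"
          using norm_ivec_le[of m] by (intro mult_right_mono) auto
      qed
      then have "(ivec m \<bullet> v)^2 \<le> (bracket m * norm v)^2"
        by (metis abs_ge_zero power2_abs power_mono)
      then have "(2 * pi * (ivec m \<bullet> v))^2 \<le> (2 * pi)^2 * norm v ^ 2 * bracket m ^ 2"
        by (simp add: power_mult_distrib mult_ac)
      with norm_cis_expand[of "2 * pi * (ivec m \<bullet> v)"]
      have "norm (torus_char m v - 1 - \<i> * of_real (2 * pi * (ivec m \<bullet> v))) \<le> (2 * pi)^2 * norm v ^ 2 * bracket m ^ 2"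
        unfolding e by linarith
      then have "norm (?r m) \<le> norm (c m) * ((2 * pi)^2 * norm v ^ 2 * bracket m ^ 2)"
        unfolding norm_mult norm_torus_char mult_1_right by (intro mult_left_mono) auto
      then show ?thesis by (simp add: norm_mult mult_ac norm_power abs_of_pos)
    qed
    have "((\<lambda>m. norm (of_real (bracket m ^ 2) * c m)) has_sum K) UNIV"
      unfolding K_def using rapid_abs_summable[OF rK] by (simp add: abs_summable_def)
    then have "((\<lambda>m. (2 * pi)^2 * norm v ^ 2 * norm (of_real (bracket m ^ 2) * c m)) has_sum ((2 * pi)^2 * norm v ^ 2 * K)) UNIV"
      by (rule has_sum_cmult_right)
    then have "norm (fourier_series c (\<theta> + v) - fourier_series c \<theta> - ?L v) \<le> (2 * pi)^2 * norm v ^ 2 * K"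
      using norm_infsum_le[OF hs] le by blast
    then show ?thesis by (simp add: mult_ac)
  qed
  show ?thesis
  proof (rule has_derivativeI_sandwich[of 1 _ _ _ _ "\<lambda>y. (2 * pi)^2 * K * norm (y - \<theta>)"])
    show "bounded_linear ?L"
    proof (rule bounded_linear_sum)
      fix j
      have "bounded_linear (\<lambda>v :: real ^ 'a. of_real (v $ j) :: complex)"
        by (rule bounded_linear_compose[OF bounded_linear_of_real bounded_linear_vec_nth])
      then show "bounded_linear (\<lambda>v :: real ^ 'a. of_real (v $ j) * fourier_series (?c j) \<theta>)"
        by (rule bounded_linear_compose[OF bounded_linear_mult_left])
    qed
    have "((\<lambda>y. (2 * pi)^2 * K * norm (y - \<theta>)) \<longlongrightarrow> (2 * pi)^2 * K * norm (\<theta> - \<theta>)) (at \<theta>)"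
      by (intro tendsto_intros)
    then show "((\<lambda>y. (2 * pi)^2 * K * norm (y - \<theta>)) \<longlongrightarrow> 0) (at \<theta>)" by simp
    fix y assume "y \<noteq> \<theta>"
    then have n: "0 < norm (y - \<theta>)" by simp
    have e: "\<theta> + (y - \<theta>) = y" by simp
    have "norm (fourier_series c y - fourier_series c \<theta> - ?L (y - \<theta>)) \<le> (2 * pi)^2 * K * norm (y - \<theta>) * norm (y - \<theta>)"
      using bound[of "y - \<theta>"] unfolding e power2_eq_square[of "norm (y - \<theta>)"] by (simp only: mult.assoc)
    then show "norm (fourier_series c y - fourier_series c \<theta> - ?L (y - \<theta>)) / norm (y - \<theta>) \<le> (2 * pi)^2 * K * norm (y - \<theta>)"
      unfolding pos_divide_le_eq[OF n] .
  qed simp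
qed

lemma partial_fourier_series:
  assumes "rapid c"
  shows "partial j (fourier_series c) = fourier_series (\<lambda>m. 2 * of_real pi * \<i> * of_int (m $ j) * c m)"
proof
  fix \<theta>
  have "((\<lambda>t. fourier_series c (\<theta> + t *\<^sub>R axis j 1)) has_derivative
      (\<lambda>t. \<Sum>i\<in>UNIV. of_real ((t *\<^sub>R axis j 1) $ i) * fourier_series (\<lambda>m. 2 * of_real pi * \<i> * of_int (m $ i) * c m) (\<theta> + 0 *\<^sub>R axis j 1))) (at 0)"
    by (rule has_derivative_compose[where f = "\<lambda>t. \<theta> + t *\<^sub>R axis j 1" and g = "fourier_series c" and s = UNIV, OF _ fourier_series_has_derivative[OF assms]])
       (auto intro!: derivative_eq_intros)
  moreover have "(\<Sum>i\<in>UNIV. of_real ((t *\<^sub>R axis j 1) $ i) * fourier_series (\<lambda>m. 2 * of_real pi * \<i> * of_int (m $ i) * c m) (\<theta> + 0 *\<^sub>R axis j 1))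
      = t *\<^sub>R fourier_series (\<lambda>m. 2 * of_real pi * \<i> * of_int (m $ j) * c m) \<theta>" for t
  proof -
    have "(\<Sum>i\<in>UNIV. of_real ((t *\<^sub>R axis j 1) $ i) * fourier_series (\<lambda>m. 2 * of_real pi * \<i> * of_int (m $ i) * c m) (\<theta> + 0 *\<^sub>R axis j 1))
       = (\<Sum>i\<in>UNIV. if i = j then t *\<^sub>R fourier_series (\<lambda>m. 2 * of_real pi * \<i> * of_int (m $ j) * c m) \<theta> else 0)"
      by (rule sum.cong) (auto simp: axis_def scaleR_conv_of_real[where 'a = complex])
    then show ?thesis by simp
  qed
  ultimately show "partial j (fourier_series c) \<theta> = fourier_series (\<lambda>m. 2 * of_real pi * \<i> * of_int (m $ j) * c m) \<theta>"
    unfolding partial_def by (intro vector_derivative_at) (simp add: has_vector_derivative_def)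
qed

lemma Cm_fourier_series: "rapid c \<Longrightarrow> Cm m (fourier_series c)"
proof (induction m arbitrary: c)
  case 0
  then have "isCont (fourier_series c) \<theta>" for \<theta> using fourier_series_has_derivative has_derivative_continuous by blast
  then show ?case by (simp add: continuous_at_imp_continuous_on)
next
  case (Suc m)
  have "fourier_series c differentiable_on UNIV"
    unfolding differentiable_on_def differentiable_def using fourier_series_has_derivative[OF Suc.prems] by blast
  moreover have "rapid (\<lambda>m. 2 * of_real pi * \<i> * of_int (m $ j) * c m)" for j
    using rapid_cmult[OF rapid_coord_mult[OF Suc.prems], of "2 * of_real pi * \<i>" j] by (simp add: mult_ac)
  ultimately show ?case using Suc.IH by (simp add: partial_fourier_series[OF Suc.prems])
qed

lemma fourier_series_smooth: "rapid c \<Longrightarrow> fourier_series c \<in> smooth_torus"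
  by (auto simp: smooth_torus_def Cm_fourier_series range_ivec[symmetric] fourier_series_periodic)

lemma tfactor_fourier_series:
  assumes "rapid c"
  shows "tfactor j l (fourier_series c) = fourier_series (\<lambda>m. (of_int (m $ j) - of_nat l) * c m)"
proof
  fix \<theta>
  have 1: "(\<lambda>m. 2 * of_real pi * \<i> * of_int (m $ j) * c m) = (\<lambda>m. (2 * of_real pi * \<i>) * (of_int (m $ j) * c m))"
    by (simp add: mult_ac)
  have 2: "(\<lambda>m. (of_int (m $ j) - of_nat l) * c m) = (\<lambda>m. of_int (m $ j) * c m - of_nat l * c m)"
    by (simp add: algebra_simps)
  show "tfactor j l (fourier_series c) \<theta> = fourier_series (\<lambda>m. (of_int (m $ j) - of_nat l) * c m) \<theta>"
    unfolding tfactor_def partial_fourier_series[OF assms] 1 2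
    by (simp add: fourier_series_cmult fourier_series_diff rapid_abs_summable rapid_cmult rapid_coord_mult assms)
qed

text \<open>The eigenvalue of \<open>tderiv\<close> on the character of frequency \<open>m\<close>,
  apart from the factor \<open>h ^ mlen \<beta>\<close>. Being \<beta>! times a binomial
  coefficient, it matches the coefficients of Newton's formula.\<close>

definition mfalling :: "('n \<Rightarrow> nat) \<Rightarrow> int ^ 'n::finite \<Rightarrow> complex" where
  "mfalling \<beta> m = (\<Prod>j\<in>UNIV. \<Prod>l<\<beta> j. of_int (m $ j) - of_nat l)"

lemma rapid_tfactor: "rapid c \<Longrightarrow> rapid (\<lambda>m. (of_int (m $ j) - of_nat l) * c m)"
  using rapid_diff[OF rapid_coord_mult rapid_cmult] by (simp add: left_diff_distrib)

lemma foldr_tfactor_fourier_series: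
  assumes "rapid c"
  shows "foldr (\<lambda>l. tfactor j l) ls (fourier_series c) = fourier_series (\<lambda>m. (\<Prod>l\<leftarrow>ls. of_int (m $ j) - of_nat l) * c m)"
    and "rapid (\<lambda>m. (\<Prod>l\<leftarrow>ls. of_int (m $ j) - of_nat l) * c m)"
proof (induction ls)
  case (Cons l ls)
  { case 1 show ?case by (simp add: Cons tfactor_fourier_series mult.assoc) }
  { case 2 show ?case using rapid_tfactor[OF Cons(2)] by (simp add: mult.assoc) }
qed (use assms in auto)

lemma tderiv_fourier_series:
  assumes "rapid c"
  shows "tderiv h \<beta> (fourier_series c) \<theta> = of_real (h ^ mlen \<beta>) * fourier_series (\<lambda>m. mfalling \<beta> m * c m) \<theta>"
    and "rapid (\<lambda>m. mfalling \<beta> m * c m)"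
proof -
  let ?p = "\<lambda>m j. \<Prod>l<\<beta> j. of_int (m $ j) - of_nat l :: complex"
  have "foldr (\<lambda>j. foldr (\<lambda>l. tfactor j l) [0..<\<beta> j]) js (fourier_series c) = fourier_series (\<lambda>m. (\<Prod>j\<leftarrow>js. ?p m j) * c m)
      \<and> rapid (\<lambda>m. (\<Prod>j\<leftarrow>js. ?p m j) * c m)" for js
  proof (induction js)
    case (Cons j js)
    have e: "?p m j = (\<Prod>l\<leftarrow>[0..<\<beta> j]. of_int (m $ j) - of_nat l)" for m
      by (simp add: prod.list_conv_set_nth interv_sum_list_conv_sum_set_nat prod.distinct_set_conv_list[symmetric] lessThan_atLeast0)
    show ?case
      using foldr_tfactor_fourier_series[of _ j "[0..<\<beta> j]", OF Cons[THEN conjunct2]]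
      by (simp add: Cons e mult.assoc)
  qed (use assms in auto)
  from this[of "sorted_list_of_set UNIV"]
  show "tderiv h \<beta> (fourier_series c) \<theta> = of_real (h ^ mlen \<beta>) * fourier_series (\<lambda>m. mfalling \<beta> m * c m) \<theta>"
    and "rapid (\<lambda>m. mfalling \<beta> m * c m)"
    by (simp_all add: tderiv_def mfalling_def prod.distinct_set_conv_list[symmetric])
qed

section \<open>Fourier inversion for smooth functions on the torus\<close>

definition periodic :: "(real ^ 'n \<Rightarrow> 'a) \<Rightarrow> bool" where
  "periodic f \<longleftrightarrow> (\<forall>\<theta> l. f (\<theta> + ivec l) = f \<theta>)"

definition coef :: "(real ^ 'n::finite \<Rightarrow> complex) \<Rightarrow> int ^ 'n \<Rightarrow> complex" where
  "coef f m = integral (cbox 0 1) (\<lambda>\<theta>. f \<theta> * torus_char (- m) \<theta>)"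

section \<open>Integration over the unit cube and orthogonality of characters\<close>

lemma torus_char_has_derivative:
  "(torus_char m has_derivative (\<lambda>v. 2 * of_real pi * \<i> * of_real (ivec m \<bullet> v) * torus_char m \<theta>)) (at \<theta>)"
proof -
  have "((\<lambda>z. exp z) has_derivative (*) (exp (2 * of_real pi * \<i> * of_real (ivec m \<bullet> \<theta>)))) (at (2 * of_real pi * \<i> * of_real (ivec m \<bullet> \<theta>)))"
    using DERIV_exp unfolding has_field_derivative_def .
  moreover have "((\<lambda>\<theta>. 2 * of_real pi * \<i> * of_real (ivec m \<bullet> \<theta>)) has_derivative (\<lambda>v. 2 * of_real pi * \<i> * of_real (ivec m \<bullet> v))) (at \<theta>)"
    by (intro bounded_linear_imp_has_derivative bounded_linear_compose[OF bounded_linear_mult_right]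
          bounded_linear_compose[OF bounded_linear_of_real] bounded_linear_inner_right)
  ultimately have "((\<lambda>\<theta>. exp (2 * of_real pi * \<i> * of_real (ivec m \<bullet> \<theta>))) has_derivative
     (\<lambda>v. exp (2 * of_real pi * \<i> * of_real (ivec m \<bullet> \<theta>)) * (2 * of_real pi * \<i> * of_real (ivec m \<bullet> v)))) (at \<theta>)"
    by (rule has_derivative_compose[rotated])
  then show ?thesis unfolding torus_char_def by (simp add: mult_ac)
qed

lemma continuous_on_torus_char [continuous_intros]: "continuous_on S (torus_char m)"
  by (intro continuous_at_imp_continuous_on ballI has_derivative_continuous[OF torus_char_has_derivative])

lemma periodic_torus_char: "periodic (torus_char m)"
  by (simp add: periodic_def torus_char_arg_add)

lemma content_cube [simp]: "measure lborel (cbox 0 (1 :: real ^ 'n::finite)) = 1"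
  by (auto simp: content_cbox_if_cart set_eq_iff mem_box_cart intro!: exI[of _ 0])

lemma integrable_cube: "continuous_on UNIV f \<Longrightarrow> f integrable_on cbox a b"
  for f :: "real ^ 'n::finite \<Rightarrow> complex"
  by (rule integrable_continuous) (rule continuous_on_subset, auto)

lemma all_coord_iff:
  assumes "\<And>i. i \<noteq> j \<Longrightarrow> P i \<longleftrightarrow> Q i" "P j \<and> A \<longleftrightarrow> Q j"
  shows "(\<forall>i. P i) \<and> A \<longleftrightarrow> (\<forall>i. Q i)"
  using assms by metis

lemma integral_cube_split:
  fixes f :: "real ^ 'n::finite \<Rightarrow> complex"
  assumes f: "continuous_on UNIV f"
    and l: "cbox a b \<inter> {x. x $ j \<le> c} = cbox a b'" and r: "cbox a b \<inter> {x. x $ j \<ge> c} = cbox a' b"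
  shows "integral (cbox a b) f = integral (cbox a b') f + integral (cbox a' b) f"
proof (rule integral_unique[OF has_integral_split[where k = "axis j 1" and c = c]])
  have 1: "{x. x \<bullet> axis j 1 \<le> c} = {x :: real ^ 'n. x $ j \<le> c}" "{x. x \<bullet> axis j 1 \<ge> c} = {x :: real ^ 'n. x $ j \<ge> c}"
    by (auto simp: inner_axis)
  show "(f has_integral integral (cbox a b') f) (cbox a b \<inter> {x. x \<bullet> axis j 1 \<le> c})"
    unfolding 1 l by (rule integrable_integral[OF integrable_cube[OF f]])
  show "(f has_integral integral (cbox a' b) f) (cbox a b \<inter> {x. x \<bullet> axis j 1 \<ge> c})"
    unfolding 1 r by (rule integrable_integral[OF integrable_cube[OF f]])
  show "axis j (1::real) \<in> Basis" by (simp add: axis_in_Basis_iff)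
qed

text \<open>The shifted cube is cut at \<open>x $ j = 1\<close>; the part beyond is moved back by
  one period and glued to the rest. Shifts between 0 and 1 along an axis suffice both for the sign
  flip in \<open>integral_torus_char\<close> and for a one-sided derivative at 0.\<close>

lemma integral_cube_shift:
  fixes f :: "real ^ 'n::finite \<Rightarrow> complex"
  assumes f: "continuous_on UNIV f" and p: "periodic f" and s: "0 \<le> s" "s \<le> 1"
  shows "integral (cbox 0 1) (\<lambda>\<theta>. f (\<theta> + s *\<^sub>R axis j 1)) = integral (cbox 0 1) f"
proof -
  let ?e = "axis j (1::real) :: real ^ 'n"
  have "integral (cbox 0 1) (\<lambda>\<theta>. f (\<theta> + s *\<^sub>R ?e)) = integral (cbox (s *\<^sub>R ?e) (1 + s *\<^sub>R ?e)) f"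
    using integral_shift_cbox[of "s *\<^sub>R ?e" "s *\<^sub>R ?e" "1 + s *\<^sub>R ?e" f] by simp
  also have "\<dots> = integral (cbox (s *\<^sub>R ?e) 1) f + integral (cbox ?e (1 + s *\<^sub>R ?e)) f"
  proof (rule integral_cube_split[OF f, where j = j and c = 1])
    show "cbox (s *\<^sub>R ?e) (1 + s *\<^sub>R ?e) \<inter> {x. x $ j \<le> 1} = cbox (s *\<^sub>R ?e) 1"
    proof (intro set_eqI)
      fix x :: "real ^ 'n"
      have "(\<forall>i. s * axis j 1 $ i \<le> x $ i \<and> x $ i \<le> 1 + s * axis j 1 $ i) \<and> x $ j \<le> 1 \<longleftrightarrow> (\<forall>i. s * axis j 1 $ i \<le> x $ i \<and> x $ i \<le> 1)"
        by (rule all_coord_iff[where j = j]) (use s in \<open>auto simp: axis_def\<close>)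
      then show "x \<in> cbox (s *\<^sub>R ?e) (1 + s *\<^sub>R ?e) \<inter> {x. x $ j \<le> 1} \<longleftrightarrow> x \<in> cbox (s *\<^sub>R ?e) 1"
        by (simp add: mem_box_cart)
    qed
    show "cbox (s *\<^sub>R ?e) (1 + s *\<^sub>R ?e) \<inter> {x. 1 \<le> x $ j} = cbox ?e (1 + s *\<^sub>R ?e)"
    proof (intro set_eqI)
      fix x :: "real ^ 'n"
      have "(\<forall>i. s * axis j 1 $ i \<le> x $ i \<and> x $ i \<le> 1 + s * axis j 1 $ i) \<and> 1 \<le> x $ j \<longleftrightarrow> (\<forall>i. axis j 1 $ i \<le> x $ i \<and> x $ i \<le> 1 + s * axis j 1 $ i)"
        by (rule all_coord_iff[where j = j]) (use s in \<open>auto simp: axis_def\<close>)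
      then show "x \<in> cbox (s *\<^sub>R ?e) (1 + s *\<^sub>R ?e) \<inter> {x. 1 \<le> x $ j} \<longleftrightarrow> x \<in> cbox ?e (1 + s *\<^sub>R ?e)"
        by (simp add: mem_box_cart)
    qed
  qed
  also have "integral (cbox ?e (1 + s *\<^sub>R ?e)) f = integral (cbox 0 (1 - ?e + s *\<^sub>R ?e)) f"
  proof -
    have "f (x + ?e) = f x" for x
      using p[unfolded periodic_def, rule_format, of x "axis j 1"] by simp
    then show ?thesis
      using integral_shift_cbox[of ?e ?e "1 + s *\<^sub>R ?e" f] by (simp add: algebra_simps)
  qed
  also have "integral (cbox (s *\<^sub>R ?e) 1) f + integral (cbox 0 (1 - ?e + s *\<^sub>R ?e)) f = integral (cbox 0 1) f"
  proof (subst add.commute, rule integral_cube_split[OF f, where j = j and c = s, symmetric])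
    show "cbox 0 1 \<inter> {x. x $ j \<le> s} = cbox 0 (1 - ?e + s *\<^sub>R ?e)"
    proof (intro set_eqI)
      fix x :: "real ^ 'n"
      have "(\<forall>i. 0 \<le> x $ i \<and> x $ i \<le> 1) \<and> x $ j \<le> s \<longleftrightarrow> (\<forall>i. 0 \<le> x $ i \<and> x $ i \<le> 1 - axis j 1 $ i + s * axis j 1 $ i)"
        by (rule all_coord_iff[where j = j]) (use s in \<open>auto simp: axis_def\<close>)
      then show "x \<in> cbox 0 1 \<inter> {x. x $ j \<le> s} \<longleftrightarrow> x \<in> cbox 0 (1 - ?e + s *\<^sub>R ?e)"
        by (simp add: mem_box_cart)
    qed
    show "cbox 0 1 \<inter> {x. s \<le> x $ j} = cbox (s *\<^sub>R ?e) 1"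
    proof (intro set_eqI)
      fix x :: "real ^ 'n"
      have "(\<forall>i. 0 \<le> x $ i \<and> x $ i \<le> 1) \<and> s \<le> x $ j \<longleftrightarrow> (\<forall>i. s * axis j 1 $ i \<le> x $ i \<and> x $ i \<le> 1)"
        by (rule all_coord_iff[where j = j]) (use s in \<open>auto simp: axis_def\<close>)
      then show "x \<in> cbox 0 1 \<inter> {x. s \<le> x $ j} \<longleftrightarrow> x \<in> cbox (s *\<^sub>R ?e) 1"
        by (simp add: mem_box_cart)
    qed
  qed
  finally show ?thesis .
qed

lemma integral_torus_char: "integral (cbox 0 1) (torus_char m) = (if m = 0 then 1 else 0)"
proof (cases "m = 0")
  case True
  have "torus_char (0 :: int ^ 'a) = (\<lambda>\<theta>. 1)" by auto
  then show ?thesis using True by simp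
next
  case False
  then obtain j where j: "m $ j \<noteq> 0" by (auto simp: vec_eq_iff)
  \<comment> \<open>Half a period of the character in direction \<open>j\<close>: the translation
    multiplies it by -1, so its integral equals its own negative.\<close>
  define s where "s = 1 / (2 * \<bar>real_of_int (m $ j)\<bar>)"
  have "1 \<le> \<bar>real_of_int (m $ j)\<bar>" using j by linarith
  then have s: "0 \<le> s" "s \<le> 1" by (simp_all add: s_def)
  have "real_of_int (m $ j) * s = 1/2 \<or> real_of_int (m $ j) * s = -1/2"
    using j by (auto simp: s_def abs_if)
  then have "2 * of_real pi * \<i> * of_real (real_of_int (m $ j) * s) = \<i> * of_real pi \<or>
             2 * of_real pi * \<i> * of_real (real_of_int (m $ j) * s) = - (\<i> * of_real pi)"
    by (elim disjE) (simp_all only: , simp_all)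
  moreover have "exp (\<i> * of_real pi) = -1" "exp (- (\<i> * of_real pi)) = -1"
    by (simp_all add: exp_minus mult.commute[of \<i>])
  ultimately have "exp (2 * of_real pi * \<i> * of_real (real_of_int (m $ j) * s)) = -1"
    by metis
  then have "torus_char m (s *\<^sub>R axis j 1) = -1"
    unfolding torus_char_def by (simp add: inner_axis mult_ac)
  then have "integral (cbox 0 1) (\<lambda>\<theta>. torus_char m (\<theta> + s *\<^sub>R axis j 1)) = - integral (cbox 0 1) (torus_char m)"
    by (simp add: torus_char_arg_add)
  then show ?thesis
    using integral_cube_shift[OF continuous_on_torus_char periodic_torus_char s, of m j] False by simp
qed

text \<open>The integral of a translate of \<open>g\<close> along an axis is constant by
  \<open>integral_cube_shift\<close>, and differentiation under the integral sign yields the claim.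
  The derivative at 0 is taken within [0, 1], where the invariance is available, and is unique
  there.\<close>

lemma integral_directional_derivative_periodic:
  fixes g :: "real ^ 'n::finite \<Rightarrow> complex"
  assumes g: "\<And>\<theta>. (g has_derivative G \<theta>) (at \<theta>)" and p: "periodic g"
    and c: "continuous_on UNIV (\<lambda>\<theta>. G \<theta> (axis j 1))"
  shows "integral (cbox 0 1) (\<lambda>\<theta>. G \<theta> (axis j 1)) = 0"
proof -
  let ?e = "axis j (1::real) :: real ^ 'n"
  have cg: "continuous_on UNIV g"
    by (intro continuous_at_imp_continuous_on ballI has_derivative_continuous[OF g])
  have "((\<lambda>t. integral (cbox 0 1) (\<lambda>\<theta>. g (\<theta> + t *\<^sub>R ?e))) has_vector_derivative
          integral (cbox 0 1) (\<lambda>\<theta>. G (\<theta> + 0 *\<^sub>R ?e) ?e)) (at 0 within {0..1})"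
  proof (rule leibniz_rule_vector_derivative)
    fix t :: real and \<theta> :: "real ^ 'n"
    have "((\<lambda>t. g (\<theta> + t *\<^sub>R ?e)) has_derivative (\<lambda>r. G (\<theta> + t *\<^sub>R ?e) (r *\<^sub>R ?e))) (at t within {0..1})"
      by (rule has_derivative_compose[OF _ g]) (auto intro!: derivative_eq_intros)
    moreover have "G (\<theta> + t *\<^sub>R ?e) (r *\<^sub>R ?e) = r *\<^sub>R G (\<theta> + t *\<^sub>R ?e) ?e" for r
      using has_derivative_bounded_linear[OF g] by (simp add: linear_simps)
    ultimately show "((\<lambda>t. g (\<theta> + t *\<^sub>R ?e)) has_vector_derivative G (\<theta> + t *\<^sub>R ?e) ?e) (at t within {0..1})"
      by (simp add: has_vector_derivative_def)
  next
    fix t :: real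
    show "(\<lambda>\<theta>. g (\<theta> + t *\<^sub>R ?e)) integrable_on cbox 0 1"
      by (rule integrable_cube) (intro continuous_intros continuous_on_compose2[OF cg], auto)
  next
    show "continuous_on ({0..1} \<times> cbox 0 1) (\<lambda>(t, \<theta>). G (\<theta> + t *\<^sub>R ?e) ?e)"
      unfolding split_beta
      by (rule continuous_on_compose2[OF c]) (auto intro!: continuous_intros)
  qed auto
  then have 1: "((\<lambda>t. integral (cbox 0 1) (\<lambda>\<theta>. g (\<theta> + t *\<^sub>R ?e))) has_vector_derivative
          integral (cbox 0 1) (\<lambda>\<theta>. G \<theta> ?e)) (at 0 within cbox 0 1)"
    by simp
  have 2: "((\<lambda>t. integral (cbox 0 1) (\<lambda>\<theta>. g (\<theta> + t *\<^sub>R ?e))) has_vector_derivative 0) (at 0 within cbox 0 1)"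
    by (rule has_vector_derivative_transform[OF _ _ has_vector_derivative_const[of "integral (cbox 0 1) g"]])
       (auto simp: integral_cube_shift[OF cg p])
  show ?thesis
    by (rule vector_derivative_unique_within_closed_interval[OF _ _ 1 2]) auto
qed

section \<open>Fourier coefficients of smooth functions\<close>

lemma smooth_torusD:
  assumes "f \<in> smooth_torus"
  shows "(f has_derivative frechet_derivative f (at \<theta>)) (at \<theta>)" "continuous_on UNIV f" "periodic f"
    "partial j f \<theta> = frechet_derivative f (at \<theta>) (axis j 1)"
    "continuous_on UNIV (partial j f)" "partial j f \<in> smooth_torus"
proof -
  have Cm: "\<And>m. Cm m f" and per: "periodic f"
    using assms by (auto simp: smooth_torus_def periodic_def range_ivec[symmetric])
  have 1: "(f has_derivative frechet_derivative f (at \<theta>)) (at \<theta>)" for \<theta>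
    using Cm[of "Suc 0"] by (auto simp: differentiable_on_def frechet_derivative_works)
  from 1 show "(f has_derivative frechet_derivative f (at \<theta>)) (at \<theta>)" .
  show "continuous_on UNIV f" "continuous_on UNIV (partial j f)"
    using Cm[of "Suc 0"] Cm[of 0] by auto
  show "periodic f" by fact
  show "partial j f \<theta> = frechet_derivative f (at \<theta>) (axis j 1)"
  proof -
    have "((\<lambda>t. f (\<theta> + t *\<^sub>R axis j 1)) has_derivative (\<lambda>r. frechet_derivative f (at (\<theta> + 0 *\<^sub>R axis j 1)) (r *\<^sub>R axis j 1))) (at 0)"
      by (rule has_derivative_compose[OF _ 1]) (auto intro!: derivative_eq_intros)
    moreover have "frechet_derivative f (at \<theta>) (r *\<^sub>R axis j 1) = r *\<^sub>R frechet_derivative f (at \<theta>) (axis j 1)" for r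
      using has_derivative_bounded_linear[OF 1] by (simp add: linear_simps)
    ultimately show ?thesis
      unfolding partial_def by (intro vector_derivative_at) (simp add: has_vector_derivative_def)
  qed
  have "Cm m (partial j f)" for m using Cm[of "Suc m"] by simp
  moreover have "partial j f (\<theta> + ivec l) = partial j f \<theta>" for \<theta> l
  proof -
    have "f (\<theta> + ivec l + t *\<^sub>R axis j 1) = f (\<theta> + t *\<^sub>R axis j 1)" for t
      using per[unfolded periodic_def, rule_format, of "\<theta> + t *\<^sub>R axis j 1" l] by (simp add: add_ac)
    then show ?thesis by (simp add: partial_def)
  qed
  ultimately show "partial j f \<in> smooth_torus"
    by (auto simp: smooth_torus_def range_ivec[symmetric])
qed

text \<open>Integration by parts: \<open>f\<close> times the conjugate character is periodic, so the
  directional derivative of the product integrates to zero.\<close>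

lemma coef_partial:
  assumes f: "f \<in> smooth_torus"
  shows "coef (partial j f) m = 2 * of_real pi * \<i> * of_int (m $ j) * coef f m"
proof -
  note D = smooth_torusD[OF f]
  let ?G = "\<lambda>\<theta> v. f \<theta> * (2 * of_real pi * \<i> * of_real (ivec (-m) \<bullet> v) * torus_char (-m) \<theta>) + frechet_derivative f (at \<theta>) v * torus_char (-m) \<theta>"
  have G: "((\<lambda>\<theta>. f \<theta> * torus_char (-m) \<theta>) has_derivative ?G \<theta>) (at \<theta>)" for \<theta>
    by (rule has_derivative_mult[OF D(1) torus_char_has_derivative])
  have e: "?G \<theta> (axis j 1) = - (2 * of_real pi * \<i> * of_int (m $ j)) * (f \<theta> * torus_char (-m) \<theta>) + partial j f \<theta> * torus_char (-m) \<theta>" for \<theta>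
    by (simp add: inner_axis D(4) mult_ac)
  have i1: "(\<lambda>\<theta>. f \<theta> * torus_char (-m) \<theta>) integrable_on cbox 0 1"
    by (rule integrable_cube) (intro continuous_intros D)
  have i2: "(\<lambda>\<theta>. partial j f \<theta> * torus_char (-m) \<theta>) integrable_on cbox 0 1"
    by (rule integrable_cube) (intro continuous_intros D)
  have "integral (cbox 0 1) (\<lambda>\<theta>. ?G \<theta> (axis j 1)) = 0"
  proof (rule integral_directional_derivative_periodic[OF G])
    show "periodic (\<lambda>\<theta>. f \<theta> * torus_char (- m) \<theta>)"
      using D(3) by (simp add: periodic_def torus_char_arg_add)
    show "continuous_on UNIV (\<lambda>\<theta>. ?G \<theta> (axis j 1))"
      unfolding e by (intro continuous_intros D)
  qed
  then have "0 = integral (cbox 0 1) (\<lambda>\<theta>. - (2 * of_real pi * \<i> * of_int (m $ j)) * (f \<theta> * torus_char (-m) \<theta>) + partial j f \<theta> * torus_char (-m) \<theta>)"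
    unfolding e by simp
  also have "\<dots> = integral (cbox 0 1) (\<lambda>\<theta>. - (2 * of_real pi * \<i> * of_int (m $ j)) * (f \<theta> * torus_char (-m) \<theta>)) + integral (cbox 0 1) (\<lambda>\<theta>. partial j f \<theta> * torus_char (-m) \<theta>)"
    by (rule integral_add[OF integrable_on_mult_right[OF i1] i2])
  also have "\<dots> = - (2 * of_real pi * \<i> * of_int (m $ j)) * coef f m + coef (partial j f) m"
    unfolding coef_def integral_mult_right ..
  finally show ?thesis by (simp add: add_eq_0_iff2)
qed

lemma norm_coef_le:
  assumes "continuous_on UNIV f" "\<And>\<theta>. norm (f \<theta>) \<le> B"
  shows "norm (coef f m) \<le> B"
proof -
  have "((\<lambda>\<theta>. f \<theta> * torus_char (- m) \<theta>) has_integral coef f m) (cbox 0 1)"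
    unfolding coef_def by (rule integrable_integral[OF integrable_cube]) (intro continuous_intros assms)
  from has_integral_bound[OF _ this, of B] show ?thesis
    using assms(2) order_trans[OF norm_ge_zero assms(2)] by (simp add: norm_mult)
qed

lemma periodic_reduce_cube:
  obtains l where "\<theta> + ivec l \<in> cbox 0 (1 :: real ^ 'n::finite)"
proof
  show "\<theta> + ivec (\<chi> j. - \<lfloor>\<theta> $ j\<rfloor>) \<in> cbox 0 (1 :: real ^ 'n)"
    by (auto simp: mem_box_cart) linarith+
qed

lemma continuous_periodic_bounded:
  fixes f :: "real ^ 'n::finite \<Rightarrow> complex"
  assumes "continuous_on UNIV f" "periodic f"
  obtains B where "0 \<le> B" "\<And>\<theta>. norm (f \<theta>) \<le> B"
proof -
  have "compact (f ` cbox 0 1)"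
    by (rule compact_continuous_image[OF continuous_on_subset[OF assms(1)]]) auto
  then have "bounded (f ` cbox 0 1)" by (rule compact_imp_bounded)
  then obtain B where "\<forall>z\<in>f ` cbox 0 1. norm z \<le> B" unfolding bounded_iff by blast
  then have B: "\<And>\<theta>. \<theta> \<in> cbox 0 1 \<Longrightarrow> norm (f \<theta>) \<le> B" by blast
  have *: "norm (f \<theta>) \<le> B" for \<theta>
  proof -
    obtain l where "\<theta> + ivec l \<in> cbox 0 1" by (rule periodic_reduce_cube)
    from B[OF this] show ?thesis using assms(2) by (simp add: periodic_def)
  qed
  then show ?thesis using that[of B] order_trans[OF norm_ge_zero *] by blast
qed

text \<open>Induction on \<open>q\<close> with \<open>f\<close> varying: \<open>bracket m\<close> is
  one plus the sum of the |m_j|, and multiplying a coefficient by m_j amounts, up to a constant, to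
  passing to a partial derivative, which is smooth again.\<close>

lemma rapid_coef: "f \<in> smooth_torus \<Longrightarrow> rapid (coef f)"
  unfolding rapid_def
proof
  fix q :: nat
  show "f \<in> smooth_torus \<Longrightarrow> \<exists>C. \<forall>m. norm (coef f m) * bracket m ^ q \<le> C"
  proof (induction q arbitrary: f)
    case 0
    note D = smooth_torusD[OF 0]
    obtain B where "\<And>\<theta>. norm (f \<theta>) \<le> B"
      using continuous_periodic_bounded[OF D(2,3)] by metis
    then show ?case using norm_coef_le[OF D(2)] by auto
  next
    case (Suc q)
    obtain C where C: "\<And>m. norm (coef f m) * bracket m ^ q \<le> C"
      using Suc.IH[OF Suc.prems] by blast
    have "\<forall>j. \<exists>C. \<forall>m. norm (coef (partial j f) m) * bracket m ^ q \<le> C"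
      using Suc.IH[OF smooth_torusD(6)[OF Suc.prems]] by blast
    then obtain D where D: "\<And>j m. norm (coef (partial j f) m) * bracket m ^ q \<le> D j" by metis
    have "norm (coef f m) * bracket m ^ Suc q \<le> C + (\<Sum>j\<in>UNIV. D j)" for m
    proof -
      have "norm (coef f m) * bracket m ^ q * \<bar>real_of_int (m $ j)\<bar> \<le> D j" for j
      proof -
        \<comment> \<open>The factor 2 pi produced by the derivative is at least one and is simply
          dropped.\<close>
        have "norm (coef f m) * bracket m ^ q * \<bar>real_of_int (m $ j)\<bar> \<le> (2 * pi) * (norm (coef f m) * bracket m ^ q * \<bar>real_of_int (m $ j)\<bar>)"
          using pi_gt3 mult_right_mono[of 1 "2 * pi" "norm (coef f m) * bracket m ^ q * \<bar>real_of_int (m $ j)\<bar>"]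
          by (simp add: less_imp_le)
        also have "\<dots> = norm (coef (partial j f) m) * bracket m ^ q"
          by (simp add: coef_partial[OF Suc.prems] norm_mult)
        finally show ?thesis using D[of j m] by linarith
      qed
      then have "(\<Sum>j\<in>UNIV. norm (coef f m) * bracket m ^ q * \<bar>real_of_int (m $ j)\<bar>) \<le> (\<Sum>j\<in>UNIV. D j)"
        by (intro sum_mono)
      moreover have "norm (coef f m) * bracket m ^ Suc q = norm (coef f m) * bracket m ^ q + (\<Sum>j\<in>UNIV. norm (coef f m) * bracket m ^ q * \<bar>real_of_int (m $ j)\<bar>)"
      proof -
        have "X * bracket m = X + (\<Sum>j\<in>UNIV. X * \<bar>real_of_int (m $ j)\<bar>)" for X
          by (simp add: bracket_def distrib_left sum_distrib_left)
        from this[of "norm (coef f m) * bracket m ^ q"] show ?thesis by (simp only: power_Suc mult_ac)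
      qed
      ultimately show ?thesis using C[of m] by linarith
    qed
    then show ?case by blast
  qed
qed

section \<open>Termwise integration of Fourier series\<close>

lemma fourier_series_uniform_limit:
  assumes "abs_summable c"
  shows "uniform_limit S (\<lambda>X \<theta>. \<Sum>m\<in>X. c m * torus_char m \<theta>) (fourier_series c) (finite_subsets_at_top UNIV)"
  unfolding fourier_series_def
  by (rule Weierstrass_m_test_general[where M = "\<lambda>m. norm (c m)"])
     (use assms in \<open>auto simp: norm_mult abs_summable_def\<close>)

lemma continuous_on_fourier_series [continuous_intros]: "abs_summable c \<Longrightarrow> continuous_on S (fourier_series c)"
  by (rule uniform_limit_theorem[OF _ fourier_series_uniform_limit])
     (auto intro!: always_eventually continuous_intros)

text \<open>Uniform convergence on the compact cube against a bounded \<open>g\<close> permits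
  integration term by term. In \<open>coef_fourier_series\<close> the function \<open>g\<close> is a
  character, in \<open>Oph_eq_infsum\<close> a character times the symbol.\<close>

lemma has_sum_integral_fourier_series:
  fixes g :: "real ^ 'n::finite \<Rightarrow> complex"
  assumes c: "abs_summable c" and g: "continuous_on UNIV g" "periodic g"
  shows "((\<lambda>m. c m * integral (cbox 0 1) (\<lambda>\<theta>. g \<theta> * torus_char m \<theta>)) has_sum
           integral (cbox 0 1) (\<lambda>\<theta>. g \<theta> * fourier_series c \<theta>)) UNIV"
proof -
  obtain B where B: "0 \<le> B" "\<And>\<theta>. norm (g \<theta>) \<le> B"
    using continuous_periodic_bounded[OF g] by metis
  have gc: "continuous_on S g" for S using g(1) continuous_on_subset by blast
  have u: "uniform_limit (cbox 0 1) (\<lambda>X \<theta>. \<Sum>m\<in>X. g \<theta> * (c m * torus_char m \<theta>)) (\<lambda>\<theta>. \<Sum>\<^sub>\<infinity>m. g \<theta> * (c m * torus_char m \<theta>))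
          (finite_subsets_at_top UNIV)"
  proof (rule Weierstrass_m_test_general[where M = "\<lambda>m. B * norm (c m)"])
    show "norm (g \<theta> * (c m * torus_char m \<theta>)) \<le> B * norm (c m)" for m \<theta>
      using B by (simp add: norm_mult mult_right_mono)
    show "(\<lambda>m. B * norm (c m)) summable_on UNIV"
      using c unfolding abs_summable_def by (rule summable_on_cmult_right)
  qed
  have e: "(\<lambda>\<theta>. \<Sum>\<^sub>\<infinity>m. g \<theta> * (c m * torus_char m \<theta>)) = (\<lambda>\<theta>. g \<theta> * fourier_series c \<theta>)"
    by (simp add: fourier_series_def infsum_cmult_right')
  obtain I J where IJ: "\<And>X. ((\<lambda>\<theta>. \<Sum>m\<in>X. g \<theta> * (c m * torus_char m \<theta>)) has_integral I X) (cbox 0 1)"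
      "((\<lambda>\<theta>. g \<theta> * fourier_series c \<theta>) has_integral J) (cbox 0 1)" "(I \<longlongrightarrow> J) (finite_subsets_at_top UNIV)"
  proof (rule uniform_limit_integral_cbox[OF u[unfolded e]])
    show "continuous_on (cbox 0 1) (\<lambda>\<theta>. \<Sum>m\<in>X. g \<theta> * (c m * torus_char m \<theta>))" for X
      by (intro continuous_intros gc)
  qed (auto intro: that)
  have ic: "(\<lambda>\<theta>. g \<theta> * torus_char m \<theta>) integrable_on cbox 0 1" for m
    by (rule integrable_cube) (intro continuous_intros gc)
  have "I X = (\<Sum>m\<in>X. c m * integral (cbox 0 1) (\<lambda>\<theta>. g \<theta> * torus_char m \<theta>))" if "finite X" for X
  proof (rule has_integral_unique[OF IJ(1)])
    have "((\<lambda>\<theta>. \<Sum>m\<in>X. c m * (g \<theta> * torus_char m \<theta>)) has_integral (\<Sum>m\<in>X. c m * integral (cbox 0 1) (\<lambda>\<theta>. g \<theta> * torus_char m \<theta>))) (cbox 0 1)"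
      by (intro has_integral_sum[OF that] has_integral_mult_right integrable_integral ic)
    then show "((\<lambda>\<theta>. \<Sum>m\<in>X. g \<theta> * (c m * torus_char m \<theta>)) has_integral (\<Sum>m\<in>X. c m * integral (cbox 0 1) (\<lambda>\<theta>. g \<theta> * torus_char m \<theta>))) (cbox 0 1)"
      by (simp add: mult.left_commute)
  qed
  then have "((\<lambda>X. \<Sum>m\<in>X. c m * integral (cbox 0 1) (\<lambda>\<theta>. g \<theta> * torus_char m \<theta>)) \<longlongrightarrow> J) (finite_subsets_at_top UNIV)"
    by (intro Lim_transform_eventually[OF IJ(3)] eventually_finite_subsets_at_top_weakI) auto
  then show ?thesis
    unfolding has_sum_def using integral_unique[OF IJ(2)] by simp
qed

lemma has_sum_delta: "((\<lambda>m. f m * (if m = a then 1 else 0)) has_sum f a) UNIV"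
  for f :: "'a \<Rightarrow> complex"
  by (rule has_sum_finite_neutralI[of "{a}"]) auto

lemma coef_fourier_series:
  assumes "abs_summable c"
  shows "coef (fourier_series c) m = c m"
proof -
  have "((\<lambda>l. c l * integral (cbox 0 1) (\<lambda>\<theta>. torus_char (-m) \<theta> * torus_char l \<theta>)) has_sum
           integral (cbox 0 1) (\<lambda>\<theta>. torus_char (-m) \<theta> * fourier_series c \<theta>)) UNIV"
    by (rule has_sum_integral_fourier_series[OF assms continuous_on_torus_char periodic_torus_char])
  moreover have "(\<lambda>\<theta>. torus_char (-m) \<theta> * torus_char l \<theta>) = torus_char (l - m)" for l
    by (simp add: fun_eq_iff flip: torus_char_add)
  ultimately have "((\<lambda>l. c l * (if l = m then 1 else 0)) has_sum coef (fourier_series c) m) UNIV"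
    by (simp add: integral_torus_char coef_def mult.commute)
  with has_sum_delta[of c m] show ?thesis using has_sum_unique by blast
qed


section \<open>Uniqueness of Fourier coefficients\<close>

definition torus_emb :: "real ^ 'n::finite \<Rightarrow> complex ^ 'n" where
  "torus_emb \<theta> = (\<chi> j. torus_char (axis j 1) \<theta>)"

lemma continuous_on_torus_emb: "continuous_on S torus_emb"
  unfolding torus_emb_def by (intro continuous_intros)

lemma torus_emb_eqD:
  assumes "torus_emb \<theta> = torus_emb \<theta>'"
  obtains l where "\<theta> = \<theta>' + ivec l"
proof -
  have "\<exists>n::int. \<theta> $ j = \<theta>' $ j + real_of_int n" for j
  proof -
    have "torus_char (axis j 1) \<theta> = torus_char (axis j 1) \<theta>'"
      using assms by (simp add: torus_emb_def vec_eq_iff)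
    then have "exp (2 * of_real pi * \<i> * of_real (\<theta> $ j)) = exp (2 * of_real pi * \<i> * of_real (\<theta>' $ j))"
      by (simp add: torus_char_def inner_axis' )
    then obtain n :: int where "2 * of_real pi * \<i> * of_real (\<theta> $ j) = 2 * of_real pi * \<i> * of_real (\<theta>' $ j) + of_int (2 * n) * of_real pi * \<i>"
      unfolding exp_eq by auto
    then have "(2 * of_real pi * \<i>) * of_real (\<theta> $ j) = (2 * of_real pi * \<i>) * (of_real (\<theta>' $ j + real_of_int n) :: complex)"
      by (simp add: algebra_simps)
    then have "of_real (\<theta> $ j) = (of_real (\<theta>' $ j + real_of_int n) :: complex)"
      by simp
    then show ?thesis unfolding of_real_eq_iff by blast
  qed
  then obtain n where n: "\<And>j. \<theta> $ j = \<theta>' $ j + real_of_int (n j)" by metis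
  show ?thesis
    by (rule that[of "\<chi> j. n j"]) (simp add: vec_eq_iff n)
qed

text \<open>Polynomial approximation takes place on a compact subset of complex n-space, so
  \<open>u\<close> has to descend to the image of the cube there. Preimages of a point differ by an
  integer vector, hence the choice in \<open>?w\<close> is harmless; continuity holds because a
  continuous map from a compact space onto its Hausdorff image is a quotient map.\<close>

lemma torus_emb_factor:
  fixes u :: "real ^ 'n::finite \<Rightarrow> complex"
  assumes u: "continuous_on UNIV u" "periodic u"
  obtains w where "continuous_on (torus_emb ` cbox 0 1) w" "\<And>\<theta>. w (torus_emb \<theta>) = u \<theta>"
proof
  let ?w = "\<lambda>z. u (SOME \<theta>. torus_emb \<theta> = z)"
  show w: "?w (torus_emb \<theta>) = u \<theta>" for \<theta>
  proof -
    have "torus_emb (SOME \<theta>'. torus_emb \<theta>' = torus_emb \<theta>) = torus_emb \<theta>"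
      by (rule someI[of "\<lambda>\<theta>'. torus_emb \<theta>' = torus_emb \<theta>"]) simp
    then obtain l where "(SOME \<theta>'. torus_emb \<theta>' = torus_emb \<theta>) = \<theta> + ivec l"
      by (rule torus_emb_eqD)
    then show ?thesis using u(2) by (simp add: periodic_def)
  qed
  show "continuous_on (torus_emb ` cbox 0 1) ?w"
    unfolding continuous_openin_preimage_eq
  proof (intro allI impI)
    fix T :: "complex set" assume T: "open T"
    let ?K = "cbox 0 1 :: (real ^ 'n) set"
    have "openin (top_of_set ?K) (?K \<inter> u -` T)"
      using continuous_openin_preimage_gen[OF continuous_on_subset[OF u(1)] T] by blast
    also have "?K \<inter> u -` T = ?K \<inter> torus_emb -` (torus_emb ` ?K \<inter> ?w -` T)"
      by (simp add: set_eq_iff w) blast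
    finally show "openin (top_of_set (torus_emb ` ?K)) (torus_emb ` ?K \<inter> ?w -` T)"
      by (subst (asm) Abstract_Topology_2.continuous_imp_quotient_map[OF continuous_on_torus_emb refl compact_cbox]) auto
  qed
qed

definition coef_null :: "(real ^ 'n::finite \<Rightarrow> complex) set" where
  "coef_null = {w. continuous_on UNIV w \<and> (\<forall>m. coef w m = 0)}"

lemma coef_add:
  assumes "continuous_on UNIV v" "continuous_on UNIV w"
  shows "coef (\<lambda>\<theta>. v \<theta> + w \<theta>) m = coef v m + coef w m"
  unfolding coef_def distrib_right
  by (intro integral_add integrable_cube continuous_intros assms)

lemma coef_cmult: "coef (\<lambda>\<theta>. a * w \<theta>) m = a * coef w m"
  unfolding coef_def by (simp add: mult.assoc)

lemma coef_torus_char_mult: "coef (\<lambda>\<theta>. w \<theta> * torus_char l \<theta>) m = coef w (m - l)"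
proof -
  have "torus_char l \<theta> * torus_char (- m) \<theta> = torus_char (- (m - l)) \<theta>" for \<theta>
    by (simp flip: torus_char_add)
  then show ?thesis unfolding coef_def by (simp add: mult.assoc)
qed

lemma coef_null_add: "v \<in> coef_null \<Longrightarrow> w \<in> coef_null \<Longrightarrow> (\<lambda>\<theta>. v \<theta> + w \<theta>) \<in> coef_null"
  by (auto simp: coef_null_def coef_add intro!: continuous_intros)

lemma coef_null_cmult: "w \<in> coef_null \<Longrightarrow> (\<lambda>\<theta>. a * w \<theta>) \<in> coef_null"
  by (auto simp: coef_null_def coef_cmult intro!: continuous_intros)

lemma coef_null_torus_char: "w \<in> coef_null \<Longrightarrow> (\<lambda>\<theta>. w \<theta> * torus_char l \<theta>) \<in> coef_null"
  by (auto simp: coef_null_def coef_torus_char_mult intro!: continuous_intros)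

lemma coef_null_sum:
  "(\<And>i. i \<in> I \<Longrightarrow> w i \<in> coef_null) \<Longrightarrow> (\<lambda>\<theta>. \<Sum>i\<in>I. w i \<theta>) \<in> coef_null"
proof (induction I rule: infinite_finite_induct)
  case (insert i I)
  then show ?case by (simp add: coef_null_add)
qed (auto simp: coef_null_def coef_def)

text \<open>\<open>w\<close> varies in the induction, so that a product of polynomials is treated by
  multiplying with one factor after the other. A real linear functional of \<open>torus_emb\<close>
  is a combination of the coordinates and their conjugates, hence of characters, and these only
  shift the Fourier coefficients.\<close>

lemma coef_null_polynomial:
  fixes p :: "complex ^ 'n::finite \<Rightarrow> real"
  assumes "real_polynomial_function p" "w \<in> coef_null"
  shows "(\<lambda>\<theta>. w \<theta> * of_real (p (torus_emb \<theta>))) \<in> coef_null"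
  using assms
proof (induction p arbitrary: w rule: real_polynomial_function.induct)
  case (linear L)
  have L: "L z = (\<Sum>j\<in>UNIV. Re (z $ j) * L (axis j 1) + Im (z $ j) * L (axis j \<i>))" for z
  proof -
    have "z = (\<Sum>j\<in>UNIV. Re (z $ j) *\<^sub>R axis j 1 + Im (z $ j) *\<^sub>R axis j \<i>)"
    proof (simp add: vec_eq_iff, intro allI)
      fix i
      have "(\<Sum>j\<in>UNIV. Re (z $ j) *\<^sub>R axis j 1 $ i + Im (z $ j) *\<^sub>R axis j \<i> $ i) = (\<Sum>j\<in>UNIV. if j = i then z $ j else 0)"
        by (rule sum.cong) (auto simp: axis_def complex_eq_iff)
      then show "z $ i = (\<Sum>j\<in>UNIV. Re (z $ j) *\<^sub>R axis j 1 $ i + Im (z $ j) *\<^sub>R axis j \<i> $ i)" by simp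
    qed
    then have "L z = L (\<Sum>j\<in>UNIV. Re (z $ j) *\<^sub>R axis j 1 + Im (z $ j) *\<^sub>R axis j \<i>)" by simp
    also have "\<dots> = (\<Sum>j\<in>UNIV. Re (z $ j) * L (axis j 1) + Im (z $ j) * L (axis j \<i>))"
      using bounded_linear.linear[OF linear(1)] by (simp add: linear_sum linear_add linear_scale)
    finally show ?thesis .
  qed
  \<comment> \<open>From Re z = (z + cnj z) / 2 and Im z = (z - cnj z) / (2 i): these are the
    coefficients of z_j and of its conjugate.\<close>
  let ?a = "\<lambda>j. (of_real (L (axis j 1)) - \<i> * of_real (L (axis j \<i>))) / 2"
  let ?b = "\<lambda>j. (of_real (L (axis j 1)) + \<i> * of_real (L (axis j \<i>))) / 2"
  have "w \<theta> * of_real (L (torus_emb \<theta>)) =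
      (\<Sum>j\<in>UNIV. ?a j * (w \<theta> * torus_char (axis j 1) \<theta>) + ?b j * (w \<theta> * torus_char (- axis j 1) \<theta>))" for \<theta>
  proof -
    have "of_real (Re z * x + Im z * y) = (of_real x - \<i> * of_real y) / 2 * z + (of_real x + \<i> * of_real y) / 2 * cnj z" for x y z
      by (auto simp: complex_eq_iff field_simps)
    then show ?thesis
      unfolding L[of "torus_emb \<theta>"] of_real_sum sum_distrib_left
      by (intro sum.cong refl) (simp only: torus_emb_def vec_lambda_beta torus_char_uminus ring_distribs mult_ac)
  qed
  then show ?case
    by (simp only:) (intro coef_null_sum coef_null_add coef_null_cmult coef_null_torus_char linear)
next
  case (const c)
  then show ?case using coef_null_cmult[of w "of_real c"] by (simp add: mult.commute)
next
  case (add f g)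
  then show ?case using coef_null_add[OF add(3,4)] by (simp add: algebra_simps)
next
  case (mult f g)
  then show ?case using mult(4)[OF mult(3)] by (simp add: algebra_simps)
qed

text \<open>The set of functions with vanishing Fourier coefficients is closed under multiplication by trigonometric
  polynomials, which by Stone--Weierstrass approximate \<open>cnj \<circ> u\<close>; so \<open>\<bar>u\<bar>\<^sup>2\<close> has integral \<open>0\<close>.\<close>

lemma coef_zero_imp_zero:
  fixes u :: "real ^ 'n::finite \<Rightarrow> complex"
  assumes u: "continuous_on UNIV u" "periodic u" "\<And>m. coef u m = 0"
  shows "u \<theta> = 0"
proof -
  let ?K = "cbox 0 1 :: (real ^ 'n) set"
  obtain w where w: "continuous_on (torus_emb ` ?K) w" "\<And>\<theta>. w (torus_emb \<theta>) = u \<theta>"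
    using torus_emb_factor[OF u(1,2)] by metis
  have cK: "compact (torus_emb ` ?K)"
    by (rule compact_continuous_image[OF continuous_on_torus_emb compact_cbox])
  obtain B where B: "0 \<le> B" "\<And>\<theta>. norm (u \<theta>) \<le> B"
    using continuous_periodic_bounded[OF u(1,2)] by metis
  have null: "u \<in> coef_null" using u by (simp add: coef_null_def)
  define I where "I = integral ?K (\<lambda>\<theta>. (norm (u \<theta>))\<^sup>2)"
  have c2: "continuous_on S (\<lambda>\<theta>. (norm (u \<theta>))\<^sup>2)" for S
    by (intro continuous_intros continuous_on_subset[OF u(1)]) auto
  have I: "((\<lambda>\<theta>. (norm (u \<theta>))\<^sup>2) has_integral I) ?K"
    unfolding I_def by (rule integrable_integral[OF integrable_continuous[OF c2]])
  have "I \<le> 0 + e" if e: "0 < e" for e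
  proof -
    \<comment> \<open>The squared norm of \<open>u\<close> will differ from \<open>v\<close> by at
      most \<open>B * (2 * d)\<close>, one \<open>d\<close> each for the real and the imaginary
      part; \<open>B + 1\<close> keeps the denominator positive.\<close>
    define d where "d = e / (2 * (B + 1))"
    have d: "0 < d" using e B by (simp add: d_def)
    have "continuous_on (torus_emb ` ?K) (\<lambda>z. Re (w z))" "continuous_on (torus_emb ` ?K) (\<lambda>z. Im (w z))"
      using w(1) by (auto intro!: continuous_intros)
    then obtain p q where p: "real_polynomial_function p" "\<And>z. z \<in> torus_emb ` ?K \<Longrightarrow> \<bar>Re (w z) - p z\<bar> < d"
        and q: "real_polynomial_function q" "\<And>z. z \<in> torus_emb ` ?K \<Longrightarrow> \<bar>Im (w z) - q z\<bar> < d"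
      using Stone_Weierstrass_real_polynomial_function[OF cK _ d] by metis
    define v where "v \<theta> = u \<theta> * of_real (p (torus_emb \<theta>)) + (- \<i>) * (u \<theta> * of_real (q (torus_emb \<theta>)))" for \<theta>
    have v: "v \<in> coef_null"
      unfolding v_def by (intro coef_null_add coef_null_cmult coef_null_polynomial p q null)
    then have "integral ?K v = 0" "v integrable_on ?K"
      by (auto simp: coef_null_def coef_def intro: integrable_cube dest: spec[of _ 0])
    then have hv: "(v has_integral 0) ?K" by (metis integrable_integral)
    have hu: "((\<lambda>\<theta>. complex_of_real ((norm (u \<theta>))\<^sup>2)) has_integral of_real I) ?K"
      using has_integral_linear[OF I bounded_linear_of_real] by (simp add: o_def)
    have "((\<lambda>\<theta>. of_real ((norm (u \<theta>))\<^sup>2) - v \<theta>) has_integral (of_real I - 0)) ?K"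
      by (rule has_integral_diff[OF hu hv])
    then have "norm (of_real I - 0 :: complex) \<le> e * measure lborel ?K"
    proof (rule has_integral_bound[rotated])
      fix \<theta> assume t: "\<theta> \<in> ?K"
      have pq: "\<bar>Re (u \<theta>) - p (torus_emb \<theta>)\<bar> < d" "\<bar>Im (u \<theta>) - q (torus_emb \<theta>)\<bar> < d"
        using p(2)[of "torus_emb \<theta>"] q(2)[of "torus_emb \<theta>"] t by (auto simp: w(2))
      have "of_real ((norm (u \<theta>))\<^sup>2) = u \<theta> * cnj (u \<theta>)" by (rule complex_norm_square)
      moreover have "cnj (u \<theta>) = of_real (Re (u \<theta>)) - \<i> * of_real (Im (u \<theta>))"
        by (simp add: complex_eq_iff)
      ultimately have "of_real ((norm (u \<theta>))\<^sup>2) - v \<theta> = u \<theta> * (of_real (Re (u \<theta>) - p (torus_emb \<theta>)) - \<i> * of_real (Im (u \<theta>) - q (torus_emb \<theta>)))"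
        by (simp add: v_def algebra_simps)
      then have "norm (of_real ((norm (u \<theta>))\<^sup>2) - v \<theta>) = norm (u \<theta>) * norm (of_real (Re (u \<theta>) - p (torus_emb \<theta>)) - \<i> * of_real (Im (u \<theta>) - q (torus_emb \<theta>)))"
        by (simp only: norm_mult)
      also have "\<dots> \<le> B * (2 * d)"
      proof (rule mult_mono)
        have "norm (of_real (Re (u \<theta>) - p (torus_emb \<theta>)) - \<i> * of_real (Im (u \<theta>) - q (torus_emb \<theta>)))
          \<le> norm (of_real (Re (u \<theta>) - p (torus_emb \<theta>)) :: complex) + norm (\<i> * of_real (Im (u \<theta>) - q (torus_emb \<theta>)))"
          by (rule norm_triangle_ineq4)
        also have "\<dots> \<le> 2 * d" using pq unfolding norm_mult norm_of_real by simp
        finally show "norm (of_real (Re (u \<theta>) - p (torus_emb \<theta>)) - \<i> * of_real (Im (u \<theta>) - q (torus_emb \<theta>))) \<le> 2 * d" .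
      qed (use B in auto)
      also have "\<dots> \<le> e" using B e by (simp add: d_def field_simps)
      finally show "norm (of_real ((norm (u \<theta>))\<^sup>2) - v \<theta>) \<le> e" .
    qed (use e in simp)
    then show ?thesis by simp
  qed
  then have "I \<le> 0" by (rule field_le_epsilon)
  moreover have "0 \<le> I" by (rule has_integral_nonneg[OF I]) simp
  ultimately have "I = 0" by simp
  have u0: "u \<theta> = 0" if "\<theta> \<in> ?K" for \<theta>
  proof -
    have "(norm (u \<theta>))\<^sup>2 = 0"
    proof (rule has_integral_0_cbox_imp_0[OF c2])
      show "((\<lambda>\<theta>. (norm (u \<theta>))\<^sup>2) has_integral 0) ?K" using I \<open>I = 0\<close> by simp
      have "(\<chi> i. 1/2) \<in> box 0 (1 :: real ^ 'n)" by (simp add: mem_box_cart)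
      then show "box 0 (1 :: real ^ 'n) \<noteq> {}" by blast
    qed (use that in auto)
    then show ?thesis by simp
  qed
  obtain l where "\<theta> + ivec l \<in> ?K" by (rule periodic_reduce_cube)
  from u0[OF this] show ?thesis using u(2) by (simp add: periodic_def)
qed

text \<open>Decay of the coefficients makes the series converge absolutely, and it has the same
  coefficients as \<open>f\<close>; the difference is continuous and periodic, so uniqueness forces
  it to vanish.\<close>

theorem smooth_torus_Fourier:
  assumes "f \<in> smooth_torus"
  shows "f = fourier_series (coef f)"
proof
  fix \<theta>
  note D = smooth_torusD[OF assms]
  have a: "abs_summable (coef f)" by (rule rapid_abs_summable[OF rapid_coef[OF assms]])
  have "f \<theta> + (-1) * fourier_series (coef f) \<theta> = 0"
  proof (rule coef_zero_imp_zero)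
    show "continuous_on UNIV (\<lambda>\<theta>. f \<theta> + (-1) * fourier_series (coef f) \<theta>)"
      by (intro continuous_intros D a)
    show "periodic (\<lambda>\<theta>. f \<theta> + (-1) * fourier_series (coef f) \<theta>)"
      using D(3) by (simp add: periodic_def fourier_series_periodic)
    show "coef (\<lambda>\<theta>. f \<theta> + (-1) * fourier_series (coef f) \<theta>) m = 0" for m
    proof -
      have "coef (\<lambda>\<theta>. f \<theta> + (-1) * fourier_series (coef f) \<theta>) m = coef f m + coef (\<lambda>\<theta>. (-1) * fourier_series (coef f) \<theta>) m"
        by (rule coef_add) (intro continuous_intros D a)+
      also have "\<dots> = coef f m + (-1) * coef (fourier_series (coef f)) m" by (simp only: coef_cmult)
      finally show ?thesis by (simp add: coef_fourier_series[OF a])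
    qed
  qed
  then show "f \<theta> = fourier_series (coef f) \<theta>" by simp
qed

section \<open>Convolution and multi-index calculus\<close>

text \<open>Sums a double family along the lines \<open>m + l = p\<close>. A plain convolution would
  not do: in the composed symbol the second factor \<open>B (\<kappa> + m) l\<close> depends on
  \<open>m\<close> as well.\<close>

definition conv2 :: "((int ^ 'n) \<times> (int ^ 'n) \<Rightarrow> complex) \<Rightarrow> int ^ 'n::finite \<Rightarrow> complex" where
  "conv2 X p = (\<Sum>\<^sub>\<infinity>m. X (m, p - m))"

abbreviation conv :: "(int ^ 'n \<Rightarrow> complex) \<Rightarrow> (int ^ 'n \<Rightarrow> complex) \<Rightarrow> int ^ 'n::finite \<Rightarrow> complex" where
  "conv a b \<equiv> conv2 (\<lambda>(m, l). a m * b l)"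

definition rapid2 :: "((int ^ 'n) \<times> (int ^ 'n::finite) \<Rightarrow> complex) \<Rightarrow> bool" where
  "rapid2 X \<longleftrightarrow> (\<forall>q::nat. \<exists>C. \<forall>m l. norm (X (m, l)) * bracket m ^ q * bracket l ^ q \<le> C)"

text \<open>Since the weight is submultiplicative, \<open>q\<close> powers of each variable combine
  into \<open>bracket p ^ q\<close>; the other 2n powers of \<open>bracket m\<close> pay for the sum
  over \<open>m\<close>. The constant stays explicit for the sake of bounds uniform in
  \<kappa>.\<close>

lemma conv2_bound:
  fixes X :: "(int ^ 'n) \<times> (int ^ 'n::finite) \<Rightarrow> complex"
  assumes X: "\<And>m l. norm (X (m, l)) * bracket m ^ (q + 2 * CARD('n)) * bracket l ^ q \<le> C"
  shows "norm (conv2 X p) * bracket p ^ q \<le> C * bracket_sum TYPE('n)"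
    and "abs_summable (\<lambda>m. X (m, p - m))"
proof -
  have *: "norm (X (m, p - m) * of_real (bracket p ^ q)) * bracket m ^ (2 * CARD('n)) \<le> C" for m
  proof -
    have "bracket p ^ q \<le> (bracket m * bracket (p - m)) ^ q"
      using bracket_add_mult[of m "p - m"] by (intro power_mono) (auto simp: less_imp_le)
    then have "norm (X (m, p - m)) * bracket p ^ q * bracket m ^ (2 * CARD('n)) \<le>
        norm (X (m, p - m)) * (bracket m * bracket (p - m)) ^ q * bracket m ^ (2 * CARD('n))"
      by (intro mult_right_mono mult_left_mono) (auto simp: less_imp_le)
    also have "\<dots> \<le> C"
      using X[of m "p - m"] by (simp add: power_add power_mult_distrib mult_ac)
    finally show ?thesis by (simp add: norm_mult norm_power less_imp_le)
  qed
  from abs_summable_bracket[OF *] 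
  have a: "abs_summable (\<lambda>m. X (m, p - m) * of_real (bracket p ^ q))"
    and b: "(\<Sum>\<^sub>\<infinity>m. norm (X (m, p - m) * of_real (bracket p ^ q))) \<le> C * bracket_sum TYPE('n)" by auto
  have "norm (\<Sum>\<^sub>\<infinity>m. X (m, p - m) * of_real (bracket p ^ q)) \<le> C * bracket_sum TYPE('n)"
    using norm_infsum_bound[OF a[unfolded abs_summable_def]] b by linarith
  then show "norm (conv2 X p) * bracket p ^ q \<le> C * bracket_sum TYPE('n)"
    unfolding conv2_def by (simp add: infsum_cmult_left' norm_mult norm_power less_imp_le)
  have "(\<lambda>m. of_real (inverse (bracket p ^ q)) * (X (m, p - m) * of_real (bracket p ^ q))) = (\<lambda>m. X (m, p - m))"
    by (simp add: fun_eq_iff field_simps) (metis bracket_pos less_irrefl)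
  then show "abs_summable (\<lambda>m. X (m, p - m))"
    using abs_summable_cmult[OF a, of "of_real (inverse (bracket p ^ q))"] by simp
qed

lemma rapid2D:
  fixes X :: "(int ^ 'n) \<times> (int ^ 'n::finite) \<Rightarrow> complex"
  assumes "rapid2 X"
  shows "\<exists>C. \<forall>m l. norm (X (m, l)) * bracket m ^ r * bracket l ^ q \<le> C"
proof -
  obtain C where C: "\<And>m l. norm (X (m, l)) * bracket m ^ (r + q) * bracket l ^ (r + q) \<le> C"
    using assms unfolding rapid2_def by metis
  have "norm (X (m, l)) * bracket m ^ r * bracket l ^ q \<le> norm (X (m, l)) * bracket m ^ (r + q) * bracket l ^ (r + q)" for m l
    by (intro mult_mono power_increasing) (auto simp: bracket_ge_1 less_imp_le intro!: mult_nonneg_nonneg)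
  then show ?thesis using C by (meson order_trans)
qed

lemma rapid_conv2:
  assumes "rapid2 X"
  shows "rapid (conv2 X)" and "abs_summable (\<lambda>m. X (m, p - m))"
proof -
  have "\<exists>C. \<forall>m l. norm (X (m, l)) * bracket m ^ (q + 2 * CARD('a)) * bracket l ^ q \<le> C" for q
    by (rule rapid2D[OF assms])
  then obtain C where C: "\<And>q m l. norm (X (m, l)) * bracket m ^ (q + 2 * CARD('a)) * bracket l ^ q \<le> C q"
    by metis
  show "rapid (conv2 X)" unfolding rapid_def using conv2_bound(1)[of X, OF C] by blast
  show "abs_summable (\<lambda>m. X (m, p - m))" by (rule conv2_bound(2)[of X 0, OF C])
qed

lemma abs_summable_rapid2:
  assumes "rapid2 (X :: (int ^ 'n) \<times> (int ^ 'n::finite) \<Rightarrow> complex)"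
  shows "abs_summable X"
proof -
  let ?w = "\<lambda>m :: int ^ 'n. inverse (bracket m ^ (2 * CARD('n)))"
  obtain C where C: "\<And>m l. norm (X (m, l)) * bracket m ^ (2 * CARD('n)) * bracket l ^ (2 * CARD('n)) \<le> C"
    using assms unfolding rapid2_def by metis
  have "(\<lambda>(m, l). ?w m * ?w l) summable_on UNIV \<times> UNIV"
    by (rule summable_on_SigmaI[where g = "\<lambda>m. ?w m * infsum ?w UNIV"])
       (auto intro!: has_sum_cmult_right has_sum_infsum summable_on_bracket_powr summable_on_cmult_left)
  then have s: "(\<lambda>x. C * (case x of (m, l) \<Rightarrow> ?w m * ?w l)) summable_on UNIV"
    by (intro summable_on_cmult_right) simp
  show ?thesis
  proof (rule abs_summable_comparison[OF s])
    fix x :: "(int ^ 'n) \<times> (int ^ 'n)"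
    show "norm (X x) \<le> C * (case x of (m, l) \<Rightarrow> ?w m * ?w l)"
      using C[of "fst x" "snd x"] by (cases x) (simp add: field_simps)
  qed
qed

text \<open>Reindexing by (p, m) -> (m, p - m) and Fubini for an absolutely summable family. With a
  character for \<open>g\<close> this multiplies Fourier series; with the values of a Schwartz
  function it composes operators.\<close>

lemma conv2_infsum:
  assumes X: "abs_summable X" and g: "\<And>p. norm (g p) \<le> B"
  shows "(\<Sum>\<^sub>\<infinity>p. conv2 X p * g p) = (\<Sum>\<^sub>\<infinity>m. \<Sum>\<^sub>\<infinity>l. X (m, l) * g (m + l))"
proof -
  let ?Y = "\<lambda>(m, l). X (m, l) * g (m + l)"
  have Y: "?Y summable_on UNIV"
  proof (rule abs_summable_imp_summable, rule abs_summable_comparison)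
    show "(\<lambda>x. norm (X x) * B) summable_on UNIV"
      using X unfolding abs_summable_def by (rule summable_on_cmult_left)
    show "norm (?Y x) \<le> norm (X x) * B" for x
      by (cases x) (simp add: norm_mult g mult_left_mono)
  qed
  have bij: "bij_betw (\<lambda>(p, m). (m, p - m)) UNIV (UNIV :: ((int ^ 'a) \<times> (int ^ 'a)) set)"
    by (rule bij_betw_byWitness[where f' = "\<lambda>(m, l). (m + l, m)"]) auto
  have Z: "(\<lambda>x. ?Y ((\<lambda>(p, m). (m, p - m)) x)) summable_on UNIV"
    using summable_on_reindex_bij_betw[OF bij, of ?Y] Y by simp
  have e: "(\<lambda>x. ?Y ((\<lambda>(p, m). (m, p - m)) x)) = (\<lambda>(p, m). X (m, p - m) * g p)"
    by auto
  have "(\<Sum>\<^sub>\<infinity>p. conv2 X p * g p) = (\<Sum>\<^sub>\<infinity>p. \<Sum>\<^sub>\<infinity>m. X (m, p - m) * g p)"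
    by (simp add: conv2_def infsum_cmult_left')
  also have "\<dots> = infsum (\<lambda>(p, m). X (m, p - m) * g p) (UNIV \<times> UNIV)"
    by (rule infsum_Sigma'_banach) (use Z[unfolded e] in simp)
  also have "\<dots> = infsum ?Y UNIV"
    using infsum_reindex_bij_betw[OF bij, of ?Y] unfolding e by simp
  also have "\<dots> = (\<Sum>\<^sub>\<infinity>m. \<Sum>\<^sub>\<infinity>l. X (m, l) * g (m + l))"
    using infsum_Sigma'_banach[of "\<lambda>m l. X (m, l) * g (m + l)" UNIV "\<lambda>_. UNIV"] Y by simp
  finally show ?thesis .
qed

lemma fourier_series_conv2:
  "abs_summable X \<Longrightarrow> fourier_series (conv2 X) \<theta> = (\<Sum>\<^sub>\<infinity>m. \<Sum>\<^sub>\<infinity>l. X (m, l) * (torus_char m \<theta> * torus_char l \<theta>))"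
  unfolding fourier_series_def using conv2_infsum[of X "\<lambda>p. torus_char p \<theta>" 1] by (simp add: torus_char_add)

lemma rapid2_conv: "rapid a \<Longrightarrow> rapid b \<Longrightarrow> rapid2 (\<lambda>(m, l). a m * b l)"
  unfolding rapid2_def
proof
  fix q assume a: "rapid a" and b: "rapid b"
  obtain C D where C: "\<And>m. norm (a m) * bracket m ^ q \<le> C" and D: "\<And>l. norm (b l) * bracket l ^ q \<le> D"
    using a b unfolding rapid_def by metis
  have "norm (a m * b l) * bracket m ^ q * bracket l ^ q \<le> C * D" for m l
  proof -
    have "(norm (a m) * bracket m ^ q) * (norm (b l) * bracket l ^ q) \<le> C * D"
      by (intro mult_mono C D) (auto simp: less_imp_le intro: order_trans[OF _ C[of 0]])
    then show ?thesis by (simp add: norm_mult mult_ac)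
  qed
  then show "\<exists>C. \<forall>m l. norm ((\<lambda>(m, l). a m * b l) (m, l)) * bracket m ^ q * bracket l ^ q \<le> C" by auto
qed

lemma rapid_conv: "rapid a \<Longrightarrow> rapid b \<Longrightarrow> rapid (conv a b)"
  by (rule rapid_conv2(1)[OF rapid2_conv])

lemma fourier_series_conv:
  assumes "rapid a" "rapid b"
  shows "fourier_series (conv a b) \<theta> = fourier_series a \<theta> * fourier_series b \<theta>"
proof -
  have "fourier_series (conv a b) \<theta> = (\<Sum>\<^sub>\<infinity>m. \<Sum>\<^sub>\<infinity>l. (a m * torus_char m \<theta>) * (b l * torus_char l \<theta>))"
    using fourier_series_conv2[OF abs_summable_rapid2[OF rapid2_conv[OF assms]], of \<theta>] by (simp add: mult_ac)
  then show ?thesis by (simp add: fourier_series_def infsum_cmult_left' infsum_cmult_right')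
qed

lemma conv_add_left:
  assumes "rapid a" "rapid b" "rapid c"
  shows "conv (\<lambda>m. a m + c m) b p = conv a b p + conv c b p"
  unfolding conv2_def
  using infsum_add[OF abs_summable_imp_summable[OF rapid_conv2(2)[OF rapid2_conv[OF assms(1,2)], of p]]
      abs_summable_imp_summable[OF rapid_conv2(2)[OF rapid2_conv[OF assms(3,2)], of p]]]
  by (simp add: distrib_right)

lemma conv_add_right:
  assumes "rapid a" "rapid b" "rapid c"
  shows "conv a (\<lambda>m. b m + c m) p = conv a b p + conv a c p"
  unfolding conv2_def
  using infsum_add[OF abs_summable_imp_summable[OF rapid_conv2(2)[OF rapid2_conv[OF assms(1,2)], of p]]
      abs_summable_imp_summable[OF rapid_conv2(2)[OF rapid2_conv[OF assms(1,3)], of p]]]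
  by (simp add: distrib_left)

text \<open>The Leibniz rule on the frequency side: p_j = m_j + (p - m)_j.\<close>

lemma coord_conv:
  assumes "rapid a" "rapid b"
  shows "of_int (p $ j) * conv a b p = conv (\<lambda>m. of_int (m $ j) * a m) b p + conv a (\<lambda>m. of_int (m $ j) * b m) p"
proof -
  have "conv (\<lambda>m. of_int (m $ j) * a m) b p + conv a (\<lambda>m. of_int (m $ j) * b m) p
      = (\<Sum>\<^sub>\<infinity>m. of_int (m $ j) * a m * b (p - m) + a m * (of_int ((p - m) $ j) * b (p - m)))"
    unfolding conv2_def
    using infsum_add[OF abs_summable_imp_summable[OF rapid_conv2(2)[OF rapid2_conv[OF rapid_coord_mult[OF assms(1), of j] assms(2)], of p]]
      abs_summable_imp_summable[OF rapid_conv2(2)[OF rapid2_conv[OF assms(1) rapid_coord_mult[OF assms(2), of j]], of p]]]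
    by simp
  also have "\<dots> = (\<Sum>\<^sub>\<infinity>m. of_int (p $ j) * (a m * b (p - m)))"
    by (rule infsum_cong) (simp add: algebra_simps)
  finally show ?thesis by (simp add: conv2_def infsum_cmult_right')
qed

section \<open>Multi-indices, finite differences and falling factorials\<close>

definition inc :: "'n \<Rightarrow> ('n \<Rightarrow> nat) \<Rightarrow> 'n \<Rightarrow> nat" where
  "inc j \<alpha> = \<alpha>(j := Suc (\<alpha> j))"

lemma inc_apply: "inc j \<alpha> i = (if i = j then Suc (\<alpha> j) else \<alpha> i)"
  by (simp add: inc_def)

lemma mlen_0 [simp]: "mlen (\<lambda>_. 0) = 0" by (simp add: mlen_def)

lemma mlen_inc [simp]: "mlen (inc j \<alpha>) = Suc (mlen \<alpha>)"
  by (simp add: mlen_def inc_def sum.remove[of UNIV j])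

lemma multi_index_induct [case_names zero Suc]:
  fixes \<alpha> :: "'n::finite \<Rightarrow> nat"
  assumes "P (\<lambda>_. 0)" "\<And>\<alpha> j. P \<alpha> \<Longrightarrow> P (inc j \<alpha>)"
  shows "P \<alpha>"
proof (induction "mlen \<alpha>" arbitrary: \<alpha>)
  case 0
  then have "\<alpha> = (\<lambda>_. 0)" by (auto simp: mlen_def)
  then show ?case using assms(1) by simp
next
  case (Suc n)
  have "\<exists>j. \<alpha> j \<noteq> 0"
    by (rule ccontr) (use Suc.hyps(2) in \<open>simp add: mlen_def\<close>)
  then obtain j where "\<alpha> j \<noteq> 0" by blast
  then obtain a where a: "\<alpha> j = Suc a" by (cases "\<alpha> j") auto
  let ?b = "\<alpha>(j := a)"
  have e: "\<alpha> = inc j ?b" using a by (auto simp: inc_def)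
  have "mlen (inc j ?b) = Suc (mlen ?b)" by simp
  then have "P ?b" using Suc e by auto
  then show ?case by (subst e) (rule assms(2))
qed

lemma mlen_pos_cases:
  assumes "mlen \<alpha> \<noteq> 0"
  obtains \<alpha>' j where "\<alpha> = (inc j \<alpha>')"
  using assms by (induction \<alpha> rule: multi_index_induct) auto

text \<open>As the operators commute, one more power of \<open>F j\<close> can be pulled past the
  other coordinates to the front. This turns the ordered products in \<open>hdiff\<close> and
  \<open>fdiff\<close> into one-step recursions fit for \<open>multi_index_induct\<close>.\<close>

lemma foldr_commuting_ops:
  fixes F :: "'i \<Rightarrow> 'a \<Rightarrow> 'a"
  assumes F: "\<And>i j x. F i (F j x) = F j (F i x)" and "distinct xs"
  shows "foldr (\<lambda>i. F i ^^ (inc j \<alpha>) i) xs x = (if j \<in> set xs then F j else id) (foldr (\<lambda>i. F i ^^ \<alpha> i) xs x)"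
  using assms(2)
proof (induction xs)
  case (Cons i xs)
  have c: "(F i ^^ n) (F j y) = F j ((F i ^^ n) y)" for n y
    by (induction n) (auto simp: F)
  show ?case
  proof (cases "i = j")
    case True
    then show ?thesis using Cons by (simp add: inc_apply)
  next
    case False
    then show ?thesis using Cons c by (auto simp: inc_apply)
  qed
qed simp

text \<open>Unit step on integer vectors and no division by h; the powers of h are restored in
  \<open>hdiff_eq_fdiff\<close>.\<close>

definition fdiff1 :: "'n::finite \<Rightarrow> (int ^ 'n \<Rightarrow> complex) \<Rightarrow> int ^ 'n \<Rightarrow> complex" where
  "fdiff1 j G \<kappa> = G (\<kappa> + axis j 1) - G \<kappa>"

definition fdiff :: "('n::{finite,linorder} \<Rightarrow> nat) \<Rightarrow> ((int, 'n) vec \<Rightarrow> complex) \<Rightarrow> (int, 'n) vec \<Rightarrow> complex" where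
  "fdiff \<alpha> G = foldr (\<lambda>j. fdiff1 j ^^ \<alpha> j) (sorted_list_of_set UNIV) G"

lemma foldr_id: "(\<And>j. f j = id) \<Longrightarrow> foldr f xs = id"
  by (induction xs) auto

lemma fdiff1_commute: "fdiff1 i (fdiff1 j G) = fdiff1 j (fdiff1 i G)"
  by (simp add: fun_eq_iff fdiff1_def add_ac)

lemma fdiff_0 [simp]: "fdiff (\<lambda>_. 0) G = G"
  unfolding fdiff_def by (subst foldr_id) auto

lemma fdiff_Suc: "fdiff (inc j \<alpha>) G = fdiff1 j (fdiff \<alpha> G)"
  unfolding fdiff_def by (subst foldr_commuting_ops) (auto simp: fdiff1_commute)

lemma fdiff_fdiff1: "fdiff \<alpha> (fdiff1 j G) = fdiff1 j (fdiff \<alpha> G)"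
  by (induction \<alpha> rule: multi_index_induct) (auto simp: fdiff_Suc fdiff1_commute)

text \<open>Here the innermost difference is peeled off, so that an induction can replace a family
  by its first difference instead of differencing an estimate already obtained.\<close>

lemma fdiff_Suc': "fdiff (inc j \<alpha>) G = fdiff \<alpha> (fdiff1 j G)"
  by (simp add: fdiff_Suc fdiff_fdiff1)

lemma fdiff_add: "fdiff \<alpha> (\<lambda>\<kappa>. G \<kappa> + H \<kappa>) = (\<lambda>\<kappa>. fdiff \<alpha> G \<kappa> + fdiff \<alpha> H \<kappa>)"
  by (induction \<alpha> rule: multi_index_induct) (auto simp: fdiff_Suc fdiff1_def fun_eq_iff)

lemma fdiff_cmult: "fdiff \<alpha> (\<lambda>\<kappa>. c * G \<kappa>) = (\<lambda>\<kappa>. c * fdiff \<alpha> G \<kappa>)"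
  by (induction \<alpha> rule: multi_index_induct) (auto simp: fdiff_Suc fdiff1_def fun_eq_iff algebra_simps)

lemma hdiff_0 [simp]: "hdiff h (\<lambda>_. 0) G = G"
  unfolding hdiff_def by (subst foldr_id) auto

lemma hdiff_Suc: "hdiff h (inc j \<alpha>) G = hdiff1 h j (hdiff h \<alpha> G)"
proof -
  have "hdiff1 h i (hdiff1 h j g) = hdiff1 h j (hdiff1 h i g)" for i j and g :: "'a vfun"
    by (simp add: fun_eq_iff hdiff1_def add_ac diff_divide_distrib)
  then show ?thesis unfolding hdiff_def by (subst foldr_commuting_ops) auto
qed

lemma hdiff_eq_fdiff: "hdiff h \<alpha> g (h *\<^sub>R ivec \<kappa>) = fdiff \<alpha> (\<lambda>\<kappa>. g (h *\<^sub>R ivec \<kappa>)) \<kappa> / of_real h ^ mlen \<alpha>"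
proof (induction \<alpha> arbitrary: \<kappa> rule: multi_index_induct)
  case (Suc \<alpha> j)
  have "h *\<^sub>R ivec \<kappa> + h *\<^sub>R axis j 1 = h *\<^sub>R ivec (\<kappa> + axis j 1)"
    by (simp add: scaleR_add_right)
  then show ?case
    by (simp only: hdiff_Suc hdiff1_def Suc fdiff_Suc fdiff1_def mlen_inc) (simp add: diff_divide_distrib mult.commute)
qed simp

lemma mfalling_0 [simp]: "mfalling (\<lambda>_. 0) m = 1" by (simp add: mfalling_def)

lemma mfalling_Suc: "mfalling (inc j \<beta>) m = (of_int (m $ j) - of_nat (\<beta> j)) * mfalling \<beta> m"
proof -
  have "(\<Prod>i\<in>UNIV - {j}. \<Prod>l<inc j \<beta> i. of_int (m $ i) - of_nat l) = (\<Prod>i\<in>UNIV - {j}. \<Prod>l<\<beta> i. of_int (m $ i) - of_nat l :: complex)"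
    by (rule prod.cong) (auto simp: inc_apply)
  then show ?thesis
    by (simp add: mfalling_def prod.remove[of UNIV j] inc_apply mult_ac)
qed

lemma norm_mfalling_le: "\<exists>C. \<forall>m. norm (mfalling \<beta> m) \<le> C * bracket m ^ mlen \<beta>"
proof (induction \<beta> rule: multi_index_induct)
  case zero
  show ?case by (auto intro!: exI[of _ 1])
next
  case (Suc \<beta> j)
  then obtain C where C: "\<And>m. norm (mfalling \<beta> m) \<le> C * bracket m ^ mlen \<beta>" by blast
  have "norm (mfalling ((inc j \<beta>)) m) \<le> ((1 + real (\<beta> j)) * C) * bracket m ^ mlen ((inc j \<beta>))" for m
  proof -
    have "norm (of_int (m $ j) - of_nat (\<beta> j) :: complex) \<le> \<bar>real_of_int (m $ j)\<bar> + real (\<beta> j)"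
      using norm_triangle_ineq4[of "of_int (m $ j) :: complex" "of_nat (\<beta> j)"] by simp
    also have "\<dots> \<le> bracket m + real (\<beta> j) * bracket m"
      using coord_le_bracket[of m j] bracket_ge_1[of m] mult_left_mono[of 1 "bracket m" "real (\<beta> j)"] by simp
    finally have "norm (of_int (m $ j) - of_nat (\<beta> j) :: complex) * norm (mfalling \<beta> m) \<le> (bracket m + real (\<beta> j) * bracket m) * (C * bracket m ^ mlen \<beta>)"
      by (intro mult_mono C) (auto intro: add_nonneg_nonneg simp: less_imp_le)
    then show ?thesis unfolding mfalling_Suc norm_mult by (simp add: algebra_simps)
  qed
  then show ?case by blast
qed

lemma rapid_mfalling: "rapid c \<Longrightarrow> rapid (\<lambda>m. mfalling \<beta> m * c m)"
  for \<beta> :: "'n::{finite,linorder} \<Rightarrow> nat"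
  by (rule tderiv_fourier_series(2))

lemma rapid_fdiff1: "(\<And>\<kappa>. rapid (A \<kappa>)) \<Longrightarrow> rapid (\<lambda>m. fdiff1 j (\<lambda>\<kappa>. A \<kappa> m) \<kappa>)"
  unfolding fdiff1_def by (intro rapid_diff)

lemma rapid_fdiff: "(\<And>\<kappa>. rapid (A \<kappa>)) \<Longrightarrow> rapid (\<lambda>m. fdiff \<alpha> (\<lambda>\<kappa>. A \<kappa> m) \<kappa>)"
proof (induction \<alpha> arbitrary: \<kappa> rule: multi_index_induct)
  case (Suc \<alpha> j)
  then show ?case unfolding fdiff_Suc fdiff1_def by (intro rapid_diff) auto
qed auto

lemma fourier_series_fdiff:
  assumes "\<And>\<kappa>. rapid (A \<kappa>)"
  shows "fourier_series (\<lambda>m. fdiff \<alpha> (\<lambda>\<kappa>. A \<kappa> m) \<kappa>) \<theta> = fdiff \<alpha> (\<lambda>\<kappa>. fourier_series (A \<kappa>) \<theta>) \<kappa>"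
proof (induction \<alpha> arbitrary: \<kappa> rule: multi_index_induct)
  case (Suc \<alpha> j)
  then show ?case unfolding fdiff_Suc fdiff1_def
    by (subst fourier_series_diff) (auto intro!: rapid_abs_summable rapid_fdiff assms)
qed auto

text \<open>The difference acts on the index \<kappa> and D on the frequency \<open>m\<close>, so on
  coefficients they become a difference and a multiplier that do not interact.\<close>

lemma tderiv_hdiff_symbol:
  assumes "\<And>\<kappa>. rapid (A \<kappa>)" "\<And>\<kappa>. \<sigma> (h *\<^sub>R ivec \<kappa>) = fourier_series (A \<kappa>)"
  shows "tderiv h \<beta> (\<lambda>\<theta>'. hdiff h \<alpha> (\<lambda>k'. \<sigma> k' \<theta>') (h *\<^sub>R ivec \<kappa>)) \<theta> =
    of_real (h ^ mlen \<beta>) / of_real h ^ mlen \<alpha> * fourier_series (\<lambda>m. mfalling \<beta> m * fdiff \<alpha> (\<lambda>\<kappa>. A \<kappa> m) \<kappa>) \<theta>"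
proof -
  let ?c = "\<lambda>m. inverse (of_real h ^ mlen \<alpha>) * fdiff \<alpha> (\<lambda>\<kappa>. A \<kappa> m) \<kappa>"
  have "(\<lambda>\<theta>'. hdiff h \<alpha> (\<lambda>k'. \<sigma> k' \<theta>') (h *\<^sub>R ivec \<kappa>)) = fourier_series ?c"
    by (simp add: fun_eq_iff hdiff_eq_fdiff assms(2) fourier_series_cmult fourier_series_fdiff[OF assms(1)] divide_inverse mult.commute)
  moreover have "rapid ?c" by (intro rapid_cmult rapid_fdiff assms)
  moreover have "fourier_series (\<lambda>m. mfalling \<beta> m * ?c m) \<theta> = inverse (of_real h ^ mlen \<alpha>) * fourier_series (\<lambda>m. mfalling \<beta> m * fdiff \<alpha> (\<lambda>\<kappa>. A \<kappa> m) \<kappa>) \<theta>"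
    unfolding mult.left_commute[of _ "inverse _"] fourier_series_cmult ..
  ultimately show ?thesis
    by (simp add: tderiv_fourier_series(1) divide_inverse)
qed

section \<open>Symbol classes in terms of Fourier coefficients\<close>

text \<open>
  A symbol \<open>\<sigma>\<close> is encoded by \<open>A \<kappa> m\<close>, the \<open>m\<close>-th Fourier coefficient of \<open>\<sigma>(h \<kappa>, \<cdot>)\<close> for an integer vector \<open>\<kappa>\<close>.
  For fixed \<open>h\<close> the factors \<open>h\<close> in \<open>D\<close> and \<open>\<Delta>\<close> and the passage from \<open>1 + \<bar>h \<kappa>\<bar>\<close> to \<open>bracket \<kappa>\<close> only change
  constants, so \<open>h\<close> no longer occurs.
\<close>

definition coeff_bounded :: "real \<Rightarrow> ('n::{finite,linorder} \<Rightarrow> nat) \<Rightarrow> ('n \<Rightarrow> nat) \<Rightarrow> ((int, 'n) vec \<Rightarrow> (int, 'n) vec \<Rightarrow> complex) \<Rightarrow> bool" where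
  "coeff_bounded s \<alpha> \<beta> A \<longleftrightarrow> (\<exists>C. \<forall>\<kappa> \<theta>. norm (fourier_series (\<lambda>m. mfalling \<beta> m * fdiff \<alpha> (\<lambda>\<kappa>. A \<kappa> m) \<kappa>) \<theta>) \<le> C * bracket \<kappa> powr s)"

definition coeff_class :: "real \<Rightarrow> real \<Rightarrow> real \<Rightarrow> ((int, 'n::{finite,linorder}) vec \<Rightarrow> (int, 'n) vec \<Rightarrow> complex) \<Rightarrow> bool" where
  "coeff_class \<rho> \<delta> \<mu> A \<longleftrightarrow> (\<forall>\<kappa>. rapid (A \<kappa>)) \<and>
     (\<forall>\<alpha> \<beta>. coeff_bounded (\<mu> - \<rho> * real (mlen \<alpha>) + \<delta> * real (mlen \<beta>)) \<alpha> \<beta> A)"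

section \<open>Operations on coefficient classes\<close>

lemma coeff_bounded_mono:
  assumes "coeff_bounded s \<alpha> \<beta> A" "s \<le> t"
  shows "coeff_bounded t \<alpha> \<beta> A"
proof -
  obtain C where C: "\<And>\<kappa> \<theta>. norm (fourier_series (\<lambda>m. mfalling \<beta> m * fdiff \<alpha> (\<lambda>\<kappa>. A \<kappa> m) \<kappa>) \<theta>) \<le> C * bracket \<kappa> powr s"
    using assms(1) unfolding coeff_bounded_def by blast
  \<comment> \<open>At \<kappa> = 0 the weight is one, so the bound itself forces \<open>C\<close>
    to be nonnegative.\<close>
  have "0 \<le> C * bracket (0 :: (int, 'a) vec) powr s" using order_trans[OF norm_ge_zero C[of 0 0]] by simp
  then have "0 \<le> C" by (simp add: bracket_def)
  then have "C * bracket \<kappa> powr s \<le> C * bracket \<kappa> powr t" for \<kappa> :: "(int, 'a) vec"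
    using assms(2) bracket_ge_1[of \<kappa>] by (intro mult_left_mono powr_mono) auto
  then show ?thesis unfolding coeff_bounded_def by (intro exI allI order_trans[OF C])
qed

lemma coeff_bounded_add:
  assumes "coeff_bounded s \<alpha> \<beta> A" "coeff_bounded s \<alpha> \<beta> B" "\<And>\<kappa>. rapid (A \<kappa>)" "\<And>\<kappa>. rapid (B \<kappa>)"
  shows "coeff_bounded s \<alpha> \<beta> (\<lambda>\<kappa> m. A \<kappa> m + B \<kappa> m)"
proof -
  obtain C D where C: "\<And>\<kappa> \<theta>. norm (fourier_series (\<lambda>m. mfalling \<beta> m * fdiff \<alpha> (\<lambda>\<kappa>. A \<kappa> m) \<kappa>) \<theta>) \<le> C * bracket \<kappa> powr s"
    and D: "\<And>\<kappa> \<theta>. norm (fourier_series (\<lambda>m. mfalling \<beta> m * fdiff \<alpha> (\<lambda>\<kappa>. B \<kappa> m) \<kappa>) \<theta>) \<le> D * bracket \<kappa> powr s"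
    using assms(1,2) unfolding coeff_bounded_def by blast
  have "norm (fourier_series (\<lambda>m. mfalling \<beta> m * fdiff \<alpha> (\<lambda>\<kappa>. A \<kappa> m + B \<kappa> m) \<kappa>) \<theta>) \<le> (C + D) * bracket \<kappa> powr s" for \<kappa> \<theta>
  proof -
    have "fourier_series (\<lambda>m. mfalling \<beta> m * fdiff \<alpha> (\<lambda>\<kappa>. A \<kappa> m + B \<kappa> m) \<kappa>) \<theta>
      = fourier_series (\<lambda>m. mfalling \<beta> m * fdiff \<alpha> (\<lambda>\<kappa>. A \<kappa> m) \<kappa>) \<theta> + fourier_series (\<lambda>m. mfalling \<beta> m * fdiff \<alpha> (\<lambda>\<kappa>. B \<kappa> m) \<kappa>) \<theta>"
      unfolding fdiff_add distrib_left
      by (intro fourier_series_add rapid_abs_summable rapid_mfalling rapid_fdiff assms)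
    also have "norm \<dots> \<le> C * bracket \<kappa> powr s + D * bracket \<kappa> powr s"
      by (rule order_trans[OF norm_triangle_ineq add_mono[OF C D]])
    finally show ?thesis by (simp add: distrib_right)
  qed
  then show ?thesis unfolding coeff_bounded_def by blast
qed

lemma coeff_bounded_cmult:
  assumes "coeff_bounded s \<alpha> \<beta> A"
  shows "coeff_bounded s \<alpha> \<beta> (\<lambda>\<kappa> m. c * A \<kappa> m)"
proof -
  obtain C where C: "\<And>\<kappa> \<theta>. norm (fourier_series (\<lambda>m. mfalling \<beta> m * fdiff \<alpha> (\<lambda>\<kappa>. A \<kappa> m) \<kappa>) \<theta>) \<le> C * bracket \<kappa> powr s"
    using assms(1) unfolding coeff_bounded_def by blast
  have "norm (fourier_series (\<lambda>m. mfalling \<beta> m * fdiff \<alpha> (\<lambda>\<kappa>. c * A \<kappa> m) \<kappa>) \<theta>) \<le> (norm c * C) * bracket \<kappa> powr s" for \<kappa> \<theta>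
    unfolding fdiff_cmult mult.left_commute[of _ c] fourier_series_cmult norm_mult
    using mult_left_mono[OF C[of \<kappa> \<theta>], of "norm c"] by (simp add: mult.assoc)
  then show ?thesis unfolding coeff_bounded_def by blast
qed

lemma coeff_class_rapid: "coeff_class \<rho> \<delta> \<mu> A \<Longrightarrow> rapid (A \<kappa>)"
  by (simp add: coeff_class_def)

lemma coeff_class_mono: "coeff_class \<rho> \<delta> \<mu> A \<Longrightarrow> \<mu> \<le> \<nu> \<Longrightarrow> coeff_class \<rho> \<delta> \<nu> A"
  unfolding coeff_class_def by (metis coeff_bounded_mono diff_right_mono add_right_mono)

lemma coeff_class_add: "coeff_class \<rho> \<delta> \<mu> A \<Longrightarrow> coeff_class \<rho> \<delta> \<mu> B \<Longrightarrow> coeff_class \<rho> \<delta> \<mu> (\<lambda>\<kappa> m. A \<kappa> m + B \<kappa> m)"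
  unfolding coeff_class_def by (auto intro: coeff_bounded_add rapid_add)

lemma coeff_class_cmult: "coeff_class \<rho> \<delta> \<mu> A \<Longrightarrow> coeff_class \<rho> \<delta> \<mu> (\<lambda>\<kappa> m. c * A \<kappa> m)"
  unfolding coeff_class_def by (auto intro: coeff_bounded_cmult rapid_cmult)

lemma coeff_class_0: "coeff_class \<rho> \<delta> \<mu> (\<lambda>\<kappa> m. 0)"
proof -
  have "fdiff \<alpha> (\<lambda>\<kappa>. 0) = (\<lambda>\<kappa>. 0)" for \<alpha> :: "'a \<Rightarrow> nat"
    using fdiff_cmult[of \<alpha> 0 "\<lambda>\<kappa>. 0"] by simp
  then show ?thesis by (auto simp: coeff_class_def coeff_bounded_def intro!: exI[of _ 0])
qed

lemma coeff_class_sum: "(\<And>i. i \<in> I \<Longrightarrow> coeff_class \<rho> \<delta> \<mu> (A i)) \<Longrightarrow> coeff_class \<rho> \<delta> \<mu> (\<lambda>\<kappa> m. \<Sum>i\<in>I. A i \<kappa> m)"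
  by (induction I rule: infinite_finite_induct) (auto simp: coeff_class_0 coeff_class_add)

lemma coeff_class_fdiff1:
  assumes "coeff_class \<rho> \<delta> \<mu> A"
  shows "coeff_class \<rho> \<delta> (\<mu> - \<rho>) (\<lambda>\<kappa> m. fdiff1 j (\<lambda>\<kappa>. A \<kappa> m) \<kappa>)"
  unfolding coeff_class_def
proof (intro conjI allI)
  show "rapid (\<lambda>m. fdiff1 j (\<lambda>\<kappa>. A \<kappa> m) \<kappa>)" for \<kappa>
    by (intro rapid_fdiff1 coeff_class_rapid[OF assms])
  fix \<alpha> \<beta> :: "'a \<Rightarrow> nat"
  have "coeff_bounded (\<mu> - \<rho> * real (mlen (inc j \<alpha>)) + \<delta> * real (mlen \<beta>)) (inc j \<alpha>) \<beta> A"
    using assms unfolding coeff_class_def by blast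
  then show "coeff_bounded (\<mu> - \<rho> - \<rho> * real (mlen \<alpha>) + \<delta> * real (mlen \<beta>)) \<alpha> \<beta> (\<lambda>\<kappa> m. fdiff1 j (\<lambda>\<kappa>. A \<kappa> m) \<kappa>)"
    unfolding coeff_bounded_def fdiff_Suc' by (simp add: algebra_simps)
qed

lemma coeff_class_fdiff: "coeff_class \<rho> \<delta> \<mu> A \<Longrightarrow> coeff_class \<rho> \<delta> (\<mu> - \<rho> * real (mlen \<alpha>)) (\<lambda>\<kappa> m. fdiff \<alpha> (\<lambda>\<kappa>. A \<kappa> m) \<kappa>)"
proof (induction \<alpha> rule: multi_index_induct)
  case (Suc \<alpha> j)
  from coeff_class_fdiff1[OF Suc.IH[OF Suc.prems], of j] show ?case
    by (simp add: fdiff_Suc algebra_simps)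
qed simp

text \<open>Write m_j = (m_j - \<beta>_j) + \<beta>_j: the first part lengthens the falling
  factorial by one factor, the second gives a multiple of the estimate for \<beta> itself.\<close>

lemma coeff_bounded_mfalling_Suc:
  assumes A: "\<And>\<kappa>. rapid (A \<kappa>)" and 1: "coeff_bounded s \<alpha> ((inc j \<beta>)) A" and 2: "coeff_bounded s \<alpha> \<beta> A"
  shows "coeff_bounded s \<alpha> \<beta> (\<lambda>\<kappa> m. of_int (m $ j) * A \<kappa> m)"
proof -
  let ?b = "(inc j \<beta>)"
  obtain C D where C: "\<And>\<kappa> \<theta>. norm (fourier_series (\<lambda>m. mfalling ?b m * fdiff \<alpha> (\<lambda>\<kappa>. A \<kappa> m) \<kappa>) \<theta>) \<le> C * bracket \<kappa> powr s"
    and D: "\<And>\<kappa> \<theta>. norm (fourier_series (\<lambda>m. mfalling \<beta> m * fdiff \<alpha> (\<lambda>\<kappa>. A \<kappa> m) \<kappa>) \<theta>) \<le> D * bracket \<kappa> powr s"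
    using 1 2 unfolding coeff_bounded_def by blast
  have "norm (fourier_series (\<lambda>m. mfalling \<beta> m * fdiff \<alpha> (\<lambda>\<kappa>. of_int (m $ j) * A \<kappa> m) \<kappa>) \<theta>) \<le> (C + real (\<beta> j) * D) * bracket \<kappa> powr s" for \<kappa> \<theta>
  proof -
    have e: "(\<lambda>m. mfalling \<beta> m * fdiff \<alpha> (\<lambda>\<kappa>. of_int (m $ j) * A \<kappa> m) \<kappa>) =
       (\<lambda>m. mfalling ?b m * fdiff \<alpha> (\<lambda>\<kappa>. A \<kappa> m) \<kappa> + of_nat (\<beta> j) * (mfalling \<beta> m * fdiff \<alpha> (\<lambda>\<kappa>. A \<kappa> m) \<kappa>))"
      unfolding fdiff_cmult mfalling_Suc by (simp add: algebra_simps)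
    have "fourier_series (\<lambda>m. mfalling \<beta> m * fdiff \<alpha> (\<lambda>\<kappa>. of_int (m $ j) * A \<kappa> m) \<kappa>) \<theta> =
        fourier_series (\<lambda>m. mfalling ?b m * fdiff \<alpha> (\<lambda>\<kappa>. A \<kappa> m) \<kappa>) \<theta> + of_nat (\<beta> j) * fourier_series (\<lambda>m. mfalling \<beta> m * fdiff \<alpha> (\<lambda>\<kappa>. A \<kappa> m) \<kappa>) \<theta>"
      unfolding e by (subst fourier_series_add) (auto intro!: rapid_abs_summable rapid_cmult rapid_mfalling rapid_fdiff A simp: fourier_series_cmult)
    also have "norm \<dots> \<le> C * bracket \<kappa> powr s + real (\<beta> j) * (D * bracket \<kappa> powr s)"
    proof (rule order_trans[OF norm_triangle_ineq add_mono])
      show "norm (of_nat (\<beta> j) * fourier_series (\<lambda>m. mfalling \<beta> m * fdiff \<alpha> (\<lambda>\<kappa>. A \<kappa> m) \<kappa>) \<theta>) \<le> real (\<beta> j) * (D * bracket \<kappa> powr s)"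
        unfolding norm_mult norm_of_nat by (intro mult_left_mono D) simp
    qed (rule C)
    finally show ?thesis by (simp add: algebra_simps)
  qed
  then show ?thesis unfolding coeff_bounded_def by blast
qed

lemma coeff_class_coord:
  assumes A: "coeff_class \<rho> \<delta> \<mu> A" and d: "0 \<le> \<delta>"
  shows "coeff_class \<rho> \<delta> (\<mu> + \<delta>) (\<lambda>\<kappa> m. of_int (m $ j) * A \<kappa> m)"
  unfolding coeff_class_def
proof (intro conjI allI)
  show "rapid (\<lambda>m. of_int (m $ j) * A \<kappa> m)" for \<kappa>
    by (intro rapid_coord_mult coeff_class_rapid[OF A])
  fix \<alpha> \<beta> :: "'a \<Rightarrow> nat"
  have "coeff_bounded (\<mu> - \<rho> * real (mlen \<alpha>) + \<delta> * real (mlen ((inc j \<beta>)))) \<alpha> ((inc j \<beta>)) A"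
    "coeff_bounded (\<mu> - \<rho> * real (mlen \<alpha>) + \<delta> * real (mlen \<beta>)) \<alpha> \<beta> A"
    using A unfolding coeff_class_def by blast+
  then show "coeff_bounded (\<mu> + \<delta> - \<rho> * real (mlen \<alpha>) + \<delta> * real (mlen \<beta>)) \<alpha> \<beta> (\<lambda>\<kappa> m. of_int (m $ j) * A \<kappa> m)"
    using d by (intro coeff_bounded_mfalling_Suc coeff_class_rapid[OF A]) (auto simp: algebra_simps elim: coeff_bounded_mono)
qed

lemma coeff_class_mfalling:
  assumes A: "coeff_class \<rho> \<delta> \<mu> A" and d: "0 \<le> \<delta>"
  shows "coeff_class \<rho> \<delta> (\<mu> + \<delta> * real (mlen \<alpha>)) (\<lambda>\<kappa> m. mfalling \<alpha> m * A \<kappa> m)"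
proof (induction \<alpha> rule: multi_index_induct)
  case zero
  then show ?case using A by simp
next
  case (Suc \<alpha> j)
  have "coeff_class \<rho> \<delta> (\<mu> + \<delta> * real (mlen \<alpha>) + \<delta>) (\<lambda>\<kappa> m. of_int (m $ j) * (mfalling \<alpha> m * A \<kappa> m) + (- of_nat (\<alpha> j)) * (mfalling \<alpha> m * A \<kappa> m))"
    by (intro coeff_class_add coeff_class_cmult coeff_class_coord Suc d coeff_class_mono[OF Suc]) (use d in auto)
  then show ?case by (simp add: mfalling_Suc algebra_simps)
qed

text \<open>A shift is the identity plus a difference, and for \<rho> \<ge> 0 the difference has no
  higher order. The discrete Leibniz rule, which shifts one factor, calls for it.\<close>

lemma coeff_class_shift:
  assumes "coeff_class \<rho> \<delta> \<mu> A" "0 \<le> \<rho>"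
  shows "coeff_class \<rho> \<delta> \<mu> (\<lambda>\<kappa> m. A (\<kappa> + axis j 1) m)"
proof -
  have "coeff_class \<rho> \<delta> \<mu> (\<lambda>\<kappa> m. A \<kappa> m + fdiff1 j (\<lambda>\<kappa>. A \<kappa> m) \<kappa>)"
    using assms(2) by (intro coeff_class_add assms(1) coeff_class_mono[OF coeff_class_fdiff1[OF assms(1)]]) auto
  then show ?thesis by (simp add: fdiff1_def)
qed

section \<open>Leibniz rules and products of symbols\<close>

lemma fdiff1_conv:
  assumes "\<And>\<kappa>. rapid (A \<kappa>)" "\<And>\<kappa>. rapid (B \<kappa>)"
  shows "fdiff1 j (\<lambda>\<kappa>. conv (A \<kappa>) (B \<kappa>) p) \<kappa> =
    conv (\<lambda>m. fdiff1 j (\<lambda>\<kappa>. A \<kappa> m) \<kappa>) (B (\<kappa> + axis j 1)) p + conv (A \<kappa>) (\<lambda>m. fdiff1 j (\<lambda>\<kappa>. B \<kappa> m) \<kappa>) p"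
proof -
  let ?e = "\<kappa> + axis j 1"
  have "conv (A ?e) (B ?e) p = conv (\<lambda>m. fdiff1 j (\<lambda>\<kappa>. A \<kappa> m) \<kappa> + A \<kappa> m) (B ?e) p"
    by (simp add: fdiff1_def)
  also have "\<dots> = conv (\<lambda>m. fdiff1 j (\<lambda>\<kappa>. A \<kappa> m) \<kappa>) (B ?e) p + conv (A \<kappa>) (B ?e) p"
    by (intro conv_add_left rapid_fdiff1 assms)
  also have "conv (A \<kappa>) (B ?e) p = conv (A \<kappa>) (\<lambda>m. fdiff1 j (\<lambda>\<kappa>. B \<kappa> m) \<kappa> + B \<kappa> m) p"
    by (simp add: fdiff1_def)
  also have "\<dots> = conv (A \<kappa>) (\<lambda>m. fdiff1 j (\<lambda>\<kappa>. B \<kappa> m) \<kappa>) p + conv (A \<kappa>) (B \<kappa>) p"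
    by (intro conv_add_right rapid_fdiff1 assms)
  finally show ?thesis by (simp add: fdiff1_def)
qed

text \<open>Induction on |\<alpha>| + |\<beta>| with the factors and their orders varying. One
  difference or one frequency factor is distributed over \<open>A\<close> and \<open>B\<close>,
  which lowers the order of one of them by \<rho> or raises it by \<delta>; in both summands the
  exponents add up to the same total.\<close>

lemma coeff_bounded_conv:
  fixes A B :: "(int, 'n::{finite,linorder}) vec \<Rightarrow> (int, 'n) vec \<Rightarrow> complex"
  assumes "coeff_class \<rho> \<delta> \<mu> A" "coeff_class \<rho> \<delta> \<nu> B" "0 \<le> \<rho>" "0 \<le> \<delta>"
  shows "coeff_bounded (\<mu> + \<nu> - \<rho> * real (mlen \<alpha>) + \<delta> * real (mlen \<beta>)) \<alpha> \<beta> (\<lambda>\<kappa>. conv (A \<kappa>) (B \<kappa>))"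
  using assms(1,2)
proof (induction "mlen \<alpha> + mlen \<beta>" arbitrary: \<alpha> \<beta> A B \<mu> \<nu>)
  case 0
  then have z: "\<alpha> = (\<lambda>_. 0)" "\<beta> = (\<lambda>_. 0)" by (auto simp: mlen_def)
  have "coeff_bounded (\<mu> - \<rho> * real (mlen \<alpha>) + \<delta> * real (mlen \<beta>)) \<alpha> \<beta> A" "coeff_bounded (\<nu> - \<rho> * real (mlen \<alpha>) + \<delta> * real (mlen \<beta>)) \<alpha> \<beta> B"
    using 0 unfolding coeff_class_def by blast+
  then obtain C D where C: "\<And>\<kappa> \<theta>. norm (fourier_series (A \<kappa>) \<theta>) \<le> C * bracket \<kappa> powr \<mu>" and D: "\<And>\<kappa> \<theta>. norm (fourier_series (B \<kappa>) \<theta>) \<le> D * bracket \<kappa> powr \<nu>"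
    unfolding z coeff_bounded_def by (auto simp: coeff_bounded_def)
  have "norm (fourier_series (conv (A \<kappa>) (B \<kappa>)) \<theta>) \<le> (C * D) * bracket \<kappa> powr (\<mu> + \<nu>)" for \<kappa> \<theta>
  proof -
    have "norm (fourier_series (conv (A \<kappa>) (B \<kappa>)) \<theta>) = norm (fourier_series (A \<kappa>) \<theta>) * norm (fourier_series (B \<kappa>) \<theta>)"
      using 0 by (simp add: fourier_series_conv coeff_class_rapid norm_mult)
    also have "\<dots> \<le> (C * bracket \<kappa> powr \<mu>) * (D * bracket \<kappa> powr \<nu>)"
      by (intro mult_mono C D) (auto intro: order_trans[OF norm_ge_zero C])
    finally show ?thesis by (simp add: powr_add mult_ac)
  qed
  then show ?case unfolding z coeff_bounded_def by auto
next
  case (Suc n)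
  note rA = coeff_class_rapid[OF Suc.prems(1)] and rB = coeff_class_rapid[OF Suc.prems(2)]
  show ?case
  proof (cases "mlen \<alpha> = 0")
    case False
    then obtain \<alpha>' j where a: "\<alpha> = (inc j \<alpha>')" by (rule mlen_pos_cases)
    let ?s = "\<mu> + \<nu> - \<rho> * real (mlen \<alpha>) + \<delta> * real (mlen \<beta>)"
    have n: "n = mlen \<alpha>' + mlen \<beta>" using Suc.hyps(2) a by simp
    have 1: "coeff_bounded (\<mu> - \<rho> + \<nu> - \<rho> * real (mlen \<alpha>') + \<delta> * real (mlen \<beta>)) \<alpha>' \<beta> (\<lambda>\<kappa>. conv (\<lambda>m. fdiff1 j (\<lambda>\<kappa>. A \<kappa> m) \<kappa>) (B (\<kappa> + axis j 1)))"
      by (rule Suc.hyps(1)[OF n coeff_class_fdiff1[OF Suc.prems(1)] coeff_class_shift[OF Suc.prems(2) assms(3)]])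
    have 2: "coeff_bounded (\<mu> + (\<nu> - \<rho>) - \<rho> * real (mlen \<alpha>') + \<delta> * real (mlen \<beta>)) \<alpha>' \<beta> (\<lambda>\<kappa>. conv (A \<kappa>) (\<lambda>m. fdiff1 j (\<lambda>\<kappa>. B \<kappa> m) \<kappa>))"
      by (rule Suc.hyps(1)[OF n Suc.prems(1) coeff_class_fdiff1[OF Suc.prems(2)]])
    have s: "\<mu> - \<rho> + \<nu> - \<rho> * real (mlen \<alpha>') + \<delta> * real (mlen \<beta>) = ?s" "\<mu> + (\<nu> - \<rho>) - \<rho> * real (mlen \<alpha>') + \<delta> * real (mlen \<beta>) = ?s"
      by (simp_all add: a algebra_simps)
    have "coeff_bounded ?s \<alpha>' \<beta> (\<lambda>\<kappa> p. fdiff1 j (\<lambda>\<kappa>. conv (A \<kappa>) (B \<kappa>) p) \<kappa>)"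
      unfolding fdiff1_conv[of A B, OF rA rB] by (rule coeff_bounded_add[OF 1[unfolded s] 2[unfolded s]]) (intro rapid_conv rapid_fdiff1 rA rB)+
    then show ?thesis unfolding coeff_bounded_def a fdiff_Suc' .
  next
    case True
    then have "mlen \<beta> \<noteq> 0" using Suc.hyps(2) by simp
    then obtain \<beta>' j where b: "\<beta> = (inc j \<beta>')" by (rule mlen_pos_cases)
    let ?s = "\<mu> + \<nu> - \<rho> * real (mlen \<alpha>) + \<delta> * real (mlen \<beta>)"
    let ?t = "\<mu> + \<nu> - \<rho> * real (mlen \<alpha>) + \<delta> * real (mlen \<beta>')"
    have n: "n = mlen \<alpha> + mlen \<beta>'" using Suc.hyps(2) b by simp
    have 1: "coeff_bounded (\<mu> + \<delta> + \<nu> - \<rho> * real (mlen \<alpha>) + \<delta> * real (mlen \<beta>')) \<alpha> \<beta>' (\<lambda>\<kappa>. conv (\<lambda>m. of_int (m $ j) * A \<kappa> m) (B \<kappa>))"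
      by (rule Suc.hyps(1)[OF n coeff_class_coord[OF Suc.prems(1) assms(4)] Suc.prems(2)])
    have 2: "coeff_bounded (\<mu> + (\<nu> + \<delta>) - \<rho> * real (mlen \<alpha>) + \<delta> * real (mlen \<beta>')) \<alpha> \<beta>' (\<lambda>\<kappa>. conv (A \<kappa>) (\<lambda>m. of_int (m $ j) * B \<kappa> m))"
      by (rule Suc.hyps(1)[OF n Suc.prems(1) coeff_class_coord[OF Suc.prems(2) assms(4)]])
    \<comment> \<open>The constant in the new factor of the falling factorial produces this term;
      its order is lower by \<delta> and is absorbed because \<delta> \<ge> 0.\<close>
    have 3: "coeff_bounded ?s \<alpha> \<beta>' (\<lambda>\<kappa>. conv (A \<kappa>) (B \<kappa>))"
      by (rule coeff_bounded_mono[OF Suc.hyps(1)[OF n Suc.prems]]) (use assms(4) in \<open>auto simp: b algebra_simps\<close>)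
    have s: "\<mu> + \<delta> + \<nu> - \<rho> * real (mlen \<alpha>) + \<delta> * real (mlen \<beta>') = ?s" "\<mu> + (\<nu> + \<delta>) - \<rho> * real (mlen \<alpha>) + \<delta> * real (mlen \<beta>') = ?s"
      by (simp_all add: b algebra_simps)
    have "coeff_bounded ?s \<alpha> \<beta>' (\<lambda>\<kappa> p. (conv (\<lambda>m. of_int (m $ j) * A \<kappa> m) (B \<kappa>) p + conv (A \<kappa>) (\<lambda>m. of_int (m $ j) * B \<kappa> m) p)
        + (- of_nat (\<beta>' j)) * conv (A \<kappa>) (B \<kappa>) p)"
      by (intro coeff_bounded_add coeff_bounded_cmult 1[unfolded s] 2[unfolded s] 3 rapid_add rapid_cmult rapid_conv rapid_coord_mult rA rB)
    moreover have "(conv (\<lambda>m. of_int (m $ j) * A \<kappa> m) (B \<kappa>) p + conv (A \<kappa>) (\<lambda>m. of_int (m $ j) * B \<kappa> m) p)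
        + (- of_nat (\<beta>' j)) * conv (A \<kappa>) (B \<kappa>) p = (of_int (p $ j) - of_nat (\<beta>' j)) * conv (A \<kappa>) (B \<kappa>) p" for \<kappa> p
      using coord_conv[OF rA rB, of p j \<kappa> \<kappa>] by (simp add: algebra_simps)
    ultimately have "coeff_bounded ?s \<alpha> \<beta>' (\<lambda>\<kappa> p. (of_int (p $ j) - of_nat (\<beta>' j)) * conv (A \<kappa>) (B \<kappa>) p)" by simp
    then show ?thesis unfolding coeff_bounded_def b fdiff_cmult mfalling_Suc by (simp add: mult_ac)
  qed
qed

lemma coeff_class_conv:
  assumes "coeff_class \<rho> \<delta> \<mu> A" "coeff_class \<rho> \<delta> \<nu> B" "0 \<le> \<rho>" "0 \<le> \<delta>"
  shows "coeff_class \<rho> \<delta> (\<mu> + \<nu>) (\<lambda>\<kappa>. conv (A \<kappa>) (B \<kappa>))"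
  using assms coeff_bounded_conv[OF assms] unfolding coeff_class_def by (auto intro: rapid_conv)

text \<open>A Fourier coefficient is at most the supremum of its function, and multiplication by m_j
  raises the order by \<delta>. As \<open>bracket m\<close> is one plus the sum of the |m_j|, each
  of its powers is bought for \<delta> in the order.\<close>

lemma coeff_class_coeff_bound:
  assumes d: "0 \<le> \<delta>"
  shows "coeff_class \<rho> \<delta> \<mu> A \<Longrightarrow> \<exists>C. \<forall>\<kappa> m. norm (A \<kappa> m) * bracket m ^ q \<le> C * bracket \<kappa> powr (\<mu> + \<delta> * real q)"
proof (induction q arbitrary: \<mu> A)
  case 0
  have "coeff_bounded (\<mu> - \<rho> * real (mlen (\<lambda>_::'a. 0)) + \<delta> * real (mlen (\<lambda>_::'a. 0))) (\<lambda>_::'a. 0) (\<lambda>_::'a. 0) A"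
    using 0 unfolding coeff_class_def by blast
  then obtain C where C: "\<And>\<kappa> \<theta>. norm (fourier_series (A \<kappa>) \<theta>) \<le> C * bracket \<kappa> powr \<mu>"
    by (auto simp: coeff_bounded_def)
  have "norm (A \<kappa> m) \<le> C * bracket \<kappa> powr \<mu>" for \<kappa> m
    using norm_coef_le[OF continuous_on_fourier_series C, of \<kappa> m] coeff_class_rapid[OF 0] by (simp add: coef_fourier_series rapid_abs_summable)
  then show ?case by auto
next
  case (Suc q)
  obtain C where C: "\<And>\<kappa> m. norm (A \<kappa> m) * bracket m ^ q \<le> C * bracket \<kappa> powr (\<mu> + \<delta> * real q)"
    using Suc.IH[OF Suc.prems] by blast
  have "\<forall>j. \<exists>C. \<forall>\<kappa> m. norm (of_int (m $ j) * A \<kappa> m) * bracket m ^ q \<le> C * bracket \<kappa> powr (\<mu> + \<delta> + \<delta> * real q)"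
    using Suc.IH[OF coeff_class_coord[OF Suc.prems d]] by blast
  then obtain D where D: "\<And>j \<kappa> m. norm (of_int (m $ j) * A \<kappa> m) * bracket m ^ q \<le> D j * bracket \<kappa> powr (\<mu> + \<delta> + \<delta> * real q)" by metis
  have "norm (A \<kappa> m) * bracket m ^ Suc q \<le> (C + (\<Sum>j\<in>UNIV. D j)) * bracket \<kappa> powr (\<mu> + \<delta> * real (Suc q))" for \<kappa> m
  proof -
    have C0: "0 \<le> C"
    proof -
      have "0 \<le> norm (A 0 0) * bracket (0::(int, 'a) vec) ^ q" by (simp add: less_imp_le)
      then have "0 \<le> C * bracket (0 :: (int, 'a) vec) powr (\<mu> + \<delta> * real q)" using C[of 0 0] by (rule order_trans)
      then show ?thesis by (simp add: bracket_def)
    qed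
    have "norm (A \<kappa> m) * bracket m ^ Suc q = norm (A \<kappa> m) * bracket m ^ q + (\<Sum>j\<in>UNIV. norm (of_int (m $ j) * A \<kappa> m) * bracket m ^ q)"
    proof -
      have "X * bracket m = X + (\<Sum>j\<in>UNIV. X * \<bar>real_of_int (m $ j)\<bar>)" for X
        by (simp add: bracket_def distrib_left sum_distrib_left)
      from this[of "norm (A \<kappa> m) * bracket m ^ q"] show ?thesis by (simp add: norm_mult mult_ac)
    qed
    also have "\<dots> \<le> C * bracket \<kappa> powr (\<mu> + \<delta> * real (Suc q)) + (\<Sum>j\<in>UNIV. D j * bracket \<kappa> powr (\<mu> + \<delta> * real (Suc q)))"
    proof (intro add_mono sum_mono)
      have "C * bracket \<kappa> powr (\<mu> + \<delta> * real q) \<le> C * bracket \<kappa> powr (\<mu> + \<delta> * real (Suc q))"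
        using d bracket_ge_1[of \<kappa>] C0 by (intro mult_left_mono powr_mono) (auto simp: algebra_simps)
      then show "norm (A \<kappa> m) * bracket m ^ q \<le> C * bracket \<kappa> powr (\<mu> + \<delta> * real (Suc q))" using C[of \<kappa> m] by linarith
      show "norm (of_int (m $ j) * A \<kappa> m) * bracket m ^ q \<le> D j * bracket \<kappa> powr (\<mu> + \<delta> * real (Suc q))" for j
        using D[of m j \<kappa>] by (simp add: algebra_simps)
    qed
    finally show ?thesis by (simp add: distrib_right sum_distrib_right)
  qed
  then show ?case by blast
qed

section \<open>Comparison of weights and translation of the symbol classes\<close>

lemma powr_comparable:
  assumes "0 < x" "0 < y" "1 \<le> c" "x \<le> c * y" "y \<le> c * x"
  shows "x powr s \<le> c powr \<bar>s\<bar> * y powr (s::real)"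
proof (cases "0 \<le> s")
  case True
  have "x powr s \<le> (c * y) powr s" using assms True by (intro powr_mono2) auto
  then show ?thesis using assms True by (simp add: powr_mult)
next
  case False
  have "x powr s = inverse (x powr (- s))" by (simp add: powr_minus)
  also have "\<dots> \<le> inverse ((y / c) powr (- s))"
    using assms False by (intro le_imp_inverse_le powr_mono2) (auto simp: field_simps)
  also have "\<dots> = c powr \<bar>s\<bar> * y powr s"
    using assms False by (simp add: powr_divide powr_minus field_simps)
  finally show ?thesis .
qed

text \<open>The factor n compares the l1 with the Euclidean norm, and 1/h undoes the scaling. One
  constant serves both directions, as \<open>powr_comparable\<close> requires, since the exponent
  may have either sign.\<close>

lemma bracket_comparable:
  fixes \<kappa> :: "int ^ 'n::finite"
  assumes "0 < h" "h \<le> 1"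
  shows "bracket \<kappa> \<le> (real CARD('n) / h) * (1 + norm (h *\<^sub>R ivec \<kappa>))"
    "1 + norm (h *\<^sub>R ivec \<kappa>) \<le> (real CARD('n) / h) * bracket \<kappa>" "1 \<le> real CARD('n) / h"
proof -
  have c: "1 \<le> real CARD('n)" by (simp add: Suc_leI)
  have "h \<le> real CARD('n)" using assms c by linarith
  then show 1: "1 \<le> real CARD('n) / h" using assms by (simp add: pos_le_divide_eq)
  have "bracket \<kappa> \<le> 1 + real CARD('n) * norm (ivec \<kappa>)" by (rule bracket_le_norm_ivec)
  also have "\<dots> \<le> real CARD('n) / h + real CARD('n) * norm (ivec \<kappa>)" using 1 by simp
  also have "\<dots> = (real CARD('n) / h) * (1 + norm (h *\<^sub>R ivec \<kappa>))"
    using assms by (simp add: field_simps)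
  finally show "bracket \<kappa> \<le> (real CARD('n) / h) * (1 + norm (h *\<^sub>R ivec \<kappa>))" .
  have "1 + norm (h *\<^sub>R ivec \<kappa>) \<le> 1 + norm (ivec \<kappa>)"
    using assms mult_right_mono[of h 1 "norm (ivec \<kappa>)"] by simp
  also have "\<dots> \<le> 1 * bracket \<kappa>" using norm_ivec_le by simp
  also have "\<dots> \<le> (real CARD('n) / h) * bracket \<kappa>" by (rule mult_right_mono[OF 1]) (simp add: less_imp_le)
  finally show "1 + norm (h *\<^sub>R ivec \<kappa>) \<le> (real CARD('n) / h) * bracket \<kappa>" .
qed

lemma symbol_class_iff_coeff_class:
  fixes \<sigma> :: "'n::{finite,linorder} symb"
  assumes h: "0 < h" "h \<le> 1" and A: "\<And>\<kappa>. rapid (A \<kappa>)" "\<And>\<kappa>. \<sigma> (h *\<^sub>R ivec \<kappa>) = fourier_series (A \<kappa>)"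
  shows "\<sigma> \<in> symbol_class h \<mu> \<rho> \<delta> \<longleftrightarrow> coeff_class \<rho> \<delta> \<mu> A"
proof -
  let ?K = "real CARD('n) / h"
  let ?F = "\<lambda>\<alpha> \<beta> \<kappa> \<theta>. norm (fourier_series (\<lambda>m. mfalling \<beta> m * fdiff \<alpha> (\<lambda>\<kappa>. A \<kappa> m) \<kappa>) \<theta>)"
  let ?w = "\<lambda>\<kappa>. 1 + norm (h *\<^sub>R ivec \<kappa>)"
  have w: "0 < ?w \<kappa>" for \<kappa> :: "(int, 'n) vec" by (simp add: add_pos_nonneg)
  have sm: "\<forall>k\<in>hlattice h. \<sigma> k \<in> smooth_torus"
    unfolding hlattice_eq using A by (auto simp: fourier_series_smooth)
  have "(\<exists>C>0. \<forall>k\<in>hlattice h. \<forall>\<theta>. cmod (tderiv h \<beta> (\<lambda>\<theta>'. hdiff h \<alpha> (\<lambda>k'. \<sigma> k' \<theta>') k) \<theta>) \<le> C * (1 + norm k) powr s)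
      \<longleftrightarrow> coeff_bounded s \<alpha> \<beta> A" for \<alpha> \<beta> s
  proof -
    define H where "H = h ^ mlen \<beta> / h ^ mlen \<alpha>"
    have H: "0 < H" using h by (simp add: H_def)
    have e: "cmod (tderiv h \<beta> (\<lambda>\<theta>'. hdiff h \<alpha> (\<lambda>k'. \<sigma> k' \<theta>') (h *\<^sub>R ivec \<kappa>)) \<theta>) = H * ?F \<alpha> \<beta> \<kappa> \<theta>" for \<kappa> \<theta>
      using tderiv_hdiff_symbol[of A \<sigma> h, OF A, of \<beta> \<alpha> \<kappa> \<theta>] h by (simp add: norm_mult norm_divide norm_power H_def)
    show ?thesis
    proof
      assume "\<exists>C>0. \<forall>k\<in>hlattice h. \<forall>\<theta>. cmod (tderiv h \<beta> (\<lambda>\<theta>'. hdiff h \<alpha> (\<lambda>k'. \<sigma> k' \<theta>') k) \<theta>) \<le> C * (1 + norm k) powr s"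
      then obtain C where C0: "0 < C" and
        C1: "\<forall>k\<in>hlattice h. \<forall>\<theta>. cmod (tderiv h \<beta> (\<lambda>\<theta>'. hdiff h \<alpha> (\<lambda>k'. \<sigma> k' \<theta>') k) \<theta>) \<le> C * (1 + norm k) powr s"
        by blast
      have C: "0 < C" "\<And>\<kappa> \<theta>. H * ?F \<alpha> \<beta> \<kappa> \<theta> \<le> C * ?w \<kappa> powr s"
        using C0 C1[rule_format, unfolded hlattice_eq, OF rangeI] unfolding e by auto
      have "?F \<alpha> \<beta> \<kappa> \<theta> \<le> (C * ?K powr \<bar>s\<bar> / H) * bracket \<kappa> powr s" for \<kappa> \<theta>
      proof -
        have "?w \<kappa> powr s \<le> ?K powr \<bar>s\<bar> * bracket \<kappa> powr s"
          by (intro powr_comparable w bracket_comparable h bracket_pos)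
        then have "C * ?w \<kappa> powr s \<le> C * (?K powr \<bar>s\<bar> * bracket \<kappa> powr s)" using C by (intro mult_left_mono) auto
        with C(2)[of \<kappa> \<theta>] have "H * ?F \<alpha> \<beta> \<kappa> \<theta> \<le> C * (?K powr \<bar>s\<bar> * bracket \<kappa> powr s)" by linarith
        then show ?thesis using H by (simp add: field_simps)
      qed
      then show "coeff_bounded s \<alpha> \<beta> A" unfolding coeff_bounded_def by blast
    next
      assume "coeff_bounded s \<alpha> \<beta> A"
      then obtain C where C: "\<And>\<kappa> \<theta>. ?F \<alpha> \<beta> \<kappa> \<theta> \<le> C * bracket \<kappa> powr s" unfolding coeff_bounded_def by blast
      \<comment> \<open>The summand 1 makes the constant strictly positive, as
        \<open>symbol_class\<close> demands; the absolute value saves determining the sign of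
        \<open>C\<close>.\<close>
      let ?D = "\<bar>C\<bar> * ?K powr \<bar>s\<bar> * H + 1"
      have "H * ?F \<alpha> \<beta> \<kappa> \<theta> \<le> ?D * ?w \<kappa> powr s" for \<kappa> \<theta>
      proof -
        have "bracket \<kappa> powr s \<le> ?K powr \<bar>s\<bar> * ?w \<kappa> powr s"
          by (intro powr_comparable w bracket_comparable h bracket_pos)
        then have "\<bar>C\<bar> * bracket \<kappa> powr s \<le> \<bar>C\<bar> * (?K powr \<bar>s\<bar> * ?w \<kappa> powr s)" by (intro mult_left_mono) auto
        moreover have "?F \<alpha> \<beta> \<kappa> \<theta> \<le> \<bar>C\<bar> * bracket \<kappa> powr s"
          using C[of \<kappa> \<theta>] mult_right_mono[OF abs_ge_self[of C], of "bracket \<kappa> powr s"] by simp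
        ultimately have "H * ?F \<alpha> \<beta> \<kappa> \<theta> \<le> H * (\<bar>C\<bar> * (?K powr \<bar>s\<bar> * ?w \<kappa> powr s))"
          using H by (intro mult_left_mono) auto
        also have "\<dots> \<le> ?D * ?w \<kappa> powr s" by (simp add: algebra_simps)
        finally show ?thesis .
      qed
      moreover have "0 < ?D" using H by (intro add_nonneg_pos mult_nonneg_nonneg) auto
      ultimately show "\<exists>C>0. \<forall>k\<in>hlattice h. \<forall>\<theta>. cmod (tderiv h \<beta> (\<lambda>\<theta>'. hdiff h \<alpha> (\<lambda>k'. \<sigma> k' \<theta>') k) \<theta>) \<le> C * (1 + norm k) powr s"
        unfolding hlattice_eq by (intro exI[of _ ?D]) (auto simp only: e)
    qed
  qed
  then show ?thesis using sm A(1) unfolding symbol_class_def coeff_class_def by simp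
qed

section \<open>Newton's interpolation formula on the lattice\<close>

text \<open>\<open>gchoose\<close> is used because entries of \<open>m\<close> may be negative;
  Newton's formula then reaches all integer vectors and not only those with nonnegative
  entries.\<close>

definition mbinom :: "('n \<Rightarrow> nat) \<Rightarrow> int ^ 'n::finite \<Rightarrow> complex" where
  "mbinom \<alpha> m = (\<Prod>j\<in>UNIV. of_int (m $ j) gchoose \<alpha> j)"

lemma mfalling_eq_mbinom: "mfalling \<alpha> m = of_nat (mfact \<alpha>) * mbinom \<alpha> m"
proof -
  have "(\<Prod>l<k. z - of_nat l) = fact k * (z gchoose k)" for k and z :: complex
    by (simp add: gbinomial_prod_rev lessThan_atLeast0)
  then show ?thesis
    by (simp add: mfalling_def mfact_def mbinom_def prod.distrib)
qed

lemma mfact_pos: "mfact \<alpha> \<noteq> 0"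
  by (simp add: mfact_def)

lemma mbinom_eq_mfalling: "mbinom \<alpha> m = 1 / of_nat (mfact \<alpha>) * mfalling \<alpha> m"
  by (simp add: mfalling_eq_mbinom mfact_pos)

lemma mbinom_zero: "mbinom \<alpha> 0 = (if \<alpha> = (\<lambda>_. 0) then 1 else 0)"
proof (cases "\<alpha> = (\<lambda>_. 0)")
  case False
  then obtain j where "\<alpha> j \<noteq> 0" by auto
  then have "(of_int ((0 :: int ^ 'a) $ j) :: complex) gchoose \<alpha> j = 0"
    by (cases "\<alpha> j") auto
  then show ?thesis using False by (auto simp: mbinom_def intro!: prod_zero)
qed (simp add: mbinom_def)

lemma mbinom_add_axis:
  "mbinom (inc j \<alpha>) (m + axis j 1) = mbinom (inc j \<alpha>) m + mbinom \<alpha> m"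
  "\<alpha> j = 0 \<Longrightarrow> mbinom \<alpha> (m + axis j 1) = mbinom \<alpha> m"
proof -
  have "(\<Prod>i\<in>UNIV - {j}. (of_int ((m + axis j 1) $ i) :: complex) gchoose inc j \<alpha> i) = (\<Prod>i\<in>UNIV - {j}. of_int (m $ i) gchoose \<alpha> i)"
    "(\<Prod>i\<in>UNIV - {j}. (of_int (m $ i) :: complex) gchoose inc j \<alpha> i) = (\<Prod>i\<in>UNIV - {j}. of_int (m $ i) gchoose \<alpha> i)"
    "(\<Prod>i\<in>UNIV - {j}. (of_int ((m + axis j 1) $ i) :: complex) gchoose \<alpha> i) = (\<Prod>i\<in>UNIV - {j}. of_int (m $ i) gchoose \<alpha> i)"
    by (auto intro!: prod.cong simp: inc_apply axis_def)
  note P = this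
  have "(of_int ((m + axis j 1) $ j) :: complex) gchoose Suc (\<alpha> j) = (of_int (m $ j) gchoose \<alpha> j) + (of_int (m $ j) gchoose Suc (\<alpha> j))"
    using gbinomial_Suc_Suc[of "of_int (m $ j) :: complex" "\<alpha> j"] by (simp add: axis_def)
  then show "mbinom (inc j \<alpha>) (m + axis j 1) = mbinom (inc j \<alpha>) m + mbinom \<alpha> m"
    unfolding mbinom_def prod.remove[OF finite UNIV_I, of _ j] P by (simp add: inc_apply algebra_simps)
  show "\<alpha> j = 0 \<Longrightarrow> mbinom \<alpha> (m + axis j 1) = mbinom \<alpha> m"
    unfolding mbinom_def prod.remove[OF finite UNIV_I, of _ j] P by simp
qed

definition newton_rem :: "nat \<Rightarrow> ((int, 'n::{finite,linorder}) vec \<Rightarrow> complex) \<Rightarrow> (int, 'n) vec \<Rightarrow> (int, 'n) vec \<Rightarrow> complex" where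
  "newton_rem M G \<kappa> m = G (\<kappa> + m) - (\<Sum>\<alpha> | mlen \<alpha> < M. mbinom \<alpha> m * fdiff \<alpha> G \<kappa>)"

text \<open>Pascal's rule: under a unit step along \<open>j\<close> the Newton polynomial of
  \<open>G\<close> grows by the Newton polynomial of \<open>fdiff1 j G\<close> of one order
  less.\<close>

lemma newton_rem_step:
  "newton_rem (Suc M) G \<kappa> (m + axis j 1) = newton_rem (Suc M) G \<kappa> m + newton_rem M (fdiff1 j G) \<kappa> m"
proof -
  let ?S = "{\<alpha> :: 'a \<Rightarrow> nat. mlen \<alpha> < Suc M}" and ?T = "{\<alpha> :: 'a \<Rightarrow> nat. mlen \<alpha> < M}"
  let ?d = "\<lambda>\<alpha>. (mbinom \<alpha> (m + axis j 1) - mbinom \<alpha> m) * fdiff \<alpha> G \<kappa>"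
  have inj: "inj_on (inc j) ?T"
  proof (rule inj_onI)
    fix a b :: "'a \<Rightarrow> nat" assume e: "inc j a = inc j b"
    show "a = b"
    proof
      fix i show "a i = b i" using fun_cong[OF e, of i] by (cases "i = j") (auto simp: inc_apply)
    qed
  qed
  \<comment> \<open>Multi-indices with \<open>\<alpha> j = 0\<close> do not see the step; every
    other one is \<open>inc j\<close> of a multi-index shorter by one.\<close>
  have "(\<Sum>\<alpha>\<in>?S. ?d \<alpha>) = (\<Sum>\<alpha>\<in>inc j ` ?T. ?d \<alpha>)"
  proof (rule sum.mono_neutral_right)
    show "\<forall>\<alpha>\<in>?S - inc j ` ?T. ?d \<alpha> = 0"
    proof
      fix \<alpha> assume a: "\<alpha> \<in> ?S - inc j ` ?T"
      have "\<alpha> j = 0"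
      proof (rule ccontr)
        assume "\<alpha> j \<noteq> 0"
        then have e: "\<alpha> = inc j (\<alpha>(j := \<alpha> j - 1))" by (auto simp: inc_def)
        then have "Suc (mlen (\<alpha>(j := \<alpha> j - 1))) < Suc M" using a by (metis mlen_inc DiffD1 mem_Collect_eq)
        then show False using a e by blast
      qed
      then show "?d \<alpha> = 0" by (simp add: mbinom_add_axis)
    qed
  qed (auto simp: finite_mlen_less)
  also have "\<dots> = (\<Sum>\<alpha>\<in>?T. mbinom \<alpha> m * fdiff \<alpha> (fdiff1 j G) \<kappa>)"
    by (simp add: sum.reindex[OF inj] mbinom_add_axis fdiff_Suc')
  finally have "(\<Sum>\<alpha>\<in>?S. mbinom \<alpha> (m + axis j 1) * fdiff \<alpha> G \<kappa>) - (\<Sum>\<alpha>\<in>?S. mbinom \<alpha> m * fdiff \<alpha> G \<kappa>) = (\<Sum>\<alpha>\<in>?T. mbinom \<alpha> m * fdiff \<alpha> (fdiff1 j G) \<kappa>)"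
    by (simp add: left_diff_distrib sum_subtractf)
  then have "(\<Sum>\<alpha>\<in>?S. mbinom \<alpha> (m + axis j 1) * fdiff \<alpha> G \<kappa>) =
      (\<Sum>\<alpha>\<in>?T. mbinom \<alpha> m * fdiff \<alpha> (fdiff1 j G) \<kappa>) + (\<Sum>\<alpha>\<in>?S. mbinom \<alpha> m * fdiff \<alpha> G \<kappa>)"
    by (simp only: diff_eq_eq)
  then show ?thesis by (simp add: newton_rem_def fdiff1_def add_ac)
qed

lemma newton_rem_zero: "newton_rem (Suc M) G \<kappa> 0 = 0"
  for \<kappa> :: "(int, 'n::{finite,linorder}) vec"
proof -
  let ?S = "{\<alpha> :: 'n \<Rightarrow> nat. mlen \<alpha> < Suc M}"
  have "(\<Sum>\<alpha>\<in>?S. mbinom \<alpha> 0 * fdiff \<alpha> G \<kappa>) = (\<Sum>\<alpha>\<in>?S. if \<alpha> = (\<lambda>_. 0) then G \<kappa> else 0)"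
    by (rule sum.cong) (auto simp: mbinom_zero)
  also have "\<dots> = G \<kappa>" by (simp add: finite_mlen_less)
  finally show ?thesis by (simp add: newton_rem_def)
qed

lemma bracket_axis_step:
  "0 < m $ j \<Longrightarrow> bracket (m - axis j 1) = bracket m - 1" "m $ j < 0 \<Longrightarrow> bracket (m + axis j 1) = bracket m - 1"
proof -
  have "(\<Sum>i\<in>UNIV - {j}. \<bar>real_of_int ((m - axis j 1) $ i)\<bar>) = (\<Sum>i\<in>UNIV - {j}. \<bar>real_of_int (m $ i)\<bar>)"
    "(\<Sum>i\<in>UNIV - {j}. \<bar>real_of_int ((m + axis j 1) $ i)\<bar>) = (\<Sum>i\<in>UNIV - {j}. \<bar>real_of_int (m $ i)\<bar>)"
    by (auto intro!: sum.cong simp: axis_def)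
  note P = this
  have a: "(axis j 1 :: int ^ 'a) $ j = 1" by (simp add: axis_def)
  show "0 < m $ j \<Longrightarrow> bracket (m - axis j 1) = bracket m - 1"
    unfolding bracket_def sum.remove[OF finite UNIV_I, of _ j] P by (simp add: a)
  show "m $ j < 0 \<Longrightarrow> bracket (m + axis j 1) = bracket m - 1"
    unfolding bracket_def sum.remove[OF finite UNIV_I, of _ j] P by (simp add: a)
qed

text \<open>Every integer vector is reached from 0 by unit steps each of which raises the weight by
  one, so no intermediate point weighs more than the end point.\<close>

lemma bracket_induct [case_names zero up down]:
  assumes "P 0"
    and "\<And>m j. 0 < m $ j \<Longrightarrow> P (m - axis j 1) \<Longrightarrow> P m"
    and "\<And>m j. m $ j < 0 \<Longrightarrow> P (m + axis j 1) \<Longrightarrow> P m"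
  shows "P (m :: int ^ 'n::finite)"
proof (induction "nat \<lceil>bracket m\<rceil>" arbitrary: m rule: less_induct)
  case less
  have dec: "P m'" if "bracket m' = bracket m - 1" for m'
    by (rule less) (use that bracket_ge_1[of m] bracket_ge_1[of m'] in linarith)
  show ?case
  proof (cases "m = 0")
    case False
    then obtain j where "m $ j \<noteq> 0" by (auto simp: vec_eq_iff)
    then consider "0 < m $ j" | "m $ j < 0" by linarith
    then show ?thesis
    proof cases
      case 1
      then show ?thesis by (rule assms(2)) (rule dec[OF bracket_axis_step(1)[OF 1]])
    next
      case 2
      then show ?thesis by (rule assms(3)) (rule dec[OF bracket_axis_step(2)[OF 2]])
    qed
  qed (use assms in simp)
qed

text \<open>In place of a closed remainder formula, the remainder is telescoped along a lattice path
  from 0 to \<open>m\<close>. By \<open>newton_rem_step\<close> each of the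
  \<open>bracket m - 1\<close> steps adds or subtracts a remainder of one order less for a first
  difference, so every order costs a factor \<open>R\<close>. The radius is kept apart from
  \<open>bracket m\<close> so that the hypothesis covers the intermediate points.\<close>

lemma norm_newton_rem_le:
  assumes "\<And>\<alpha> z. mlen \<alpha> = M \<Longrightarrow> bracket z \<le> R \<Longrightarrow> norm (fdiff \<alpha> G (\<kappa> + z)) \<le> S" and "bracket m \<le> R"
  shows "norm (newton_rem M G \<kappa> m) \<le> R ^ M * S"
  using assms
proof (induction M arbitrary: G m)
  case 0
  from 0(1)[of "\<lambda>_. 0" m] 0(2) show ?case by (simp add: newton_rem_def)
next
  case (Suc M)
  have R: "1 \<le> R" using Suc.prems(2) bracket_ge_1[of m] by linarith
  have IH: "norm (newton_rem M (fdiff1 j G) \<kappa> m') \<le> R ^ M * S" if "bracket m' \<le> R" for j m'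
  proof (rule Suc.IH[OF _ that])
    fix \<alpha> :: "'a \<Rightarrow> nat" and z :: "(int, 'a) vec" assume "mlen \<alpha> = M" "bracket z \<le> R"
    then show "norm (fdiff \<alpha> (fdiff1 j G) (\<kappa> + z)) \<le> S"
      using Suc.prems(1)[of "inc j \<alpha>" z] by (simp add: fdiff_Suc')
  qed
  have RS: "0 \<le> R ^ M * S" using order_trans[OF norm_ge_zero IH[OF Suc.prems(2)]] .
  have "bracket m \<le> R \<longrightarrow> norm (newton_rem (Suc M) G \<kappa> m) \<le> (bracket m - 1) * (R ^ M * S)"
  proof (induction m rule: bracket_induct)
    case zero
    show ?case by (simp add: newton_rem_zero bracket_def)
  next
    case (up m j)
    show ?case
    proof
      assume mR: "bracket m \<le> R"
      have b: "bracket (m - axis j 1) = bracket m - 1" using up(1) by (rule bracket_axis_step)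
      have "newton_rem (Suc M) G \<kappa> m = newton_rem (Suc M) G \<kappa> (m - axis j 1) + newton_rem M (fdiff1 j G) \<kappa> (m - axis j 1)"
        using newton_rem_step[of M G \<kappa> "m - axis j 1" j] by simp
      also have "norm \<dots> \<le> (bracket (m - axis j 1) - 1) * (R ^ M * S) + R ^ M * S"
        using up(2) IH mR b by (intro order_trans[OF norm_triangle_ineq] add_mono) auto
      finally show "norm (newton_rem (Suc M) G \<kappa> m) \<le> (bracket m - 1) * (R ^ M * S)" by (simp add: b algebra_simps)
    qed
  next
    case (down m j)
    show ?case
    proof
      assume mR: "bracket m \<le> R"
      have b: "bracket (m + axis j 1) = bracket m - 1" using down(1) by (rule bracket_axis_step)
      have "newton_rem (Suc M) G \<kappa> m = newton_rem (Suc M) G \<kappa> (m + axis j 1) - newton_rem M (fdiff1 j G) \<kappa> m"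
        using newton_rem_step[of M G \<kappa> m j] by simp
      also have "norm \<dots> \<le> (bracket (m + axis j 1) - 1) * (R ^ M * S) + R ^ M * S"
        using down(2) IH mR b by (intro order_trans[OF norm_triangle_ineq4] add_mono) auto
      finally show "norm (newton_rem (Suc M) G \<kappa> m) \<le> (bracket m - 1) * (R ^ M * S)" by (simp add: b algebra_simps)
    qed
  qed
  then have "norm (newton_rem (Suc M) G \<kappa> m) \<le> (bracket m - 1) * (R ^ M * S)" using Suc.prems(2) by blast
  also have "\<dots> \<le> R * (R ^ M * S)" using Suc.prems(2) by (intro mult_right_mono RS) simp
  finally show ?case by (simp add: mult.assoc)
qed

lemma powr_le_power:
  assumes "1 \<le> x" "s \<le> real t"
  shows "x powr s \<le> x ^ t"
  using powr_mono[OF assms(2,1)] assms(1) by (simp add: powr_realpow)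

text \<open>For \<open>bracket m\<close> small against \<open>bracket \<kappa>\<close> the gain comes from the differences of \<open>B\<close>, for \<open>bracket m\<close> large from
  the decay of \<open>A \<kappa> m\<close> in \<open>m\<close>; the latter wins because \<open>\<delta> < 1\<close>.\<close>

lemma newton_remainder_decay:
  assumes A: "coeff_class \<rho> \<delta> \<mu> A" and B: "coeff_class \<rho> \<delta> \<nu> B" and d: "0 \<le> \<delta>" "\<delta> < \<rho>" "\<rho> \<le> 1"
  shows "\<exists>M\<ge>N. \<exists>C. \<forall>\<kappa> m l. norm (A \<kappa> m * newton_rem M (\<lambda>\<kappa>. B \<kappa> l) \<kappa> m) * bracket m ^ q * bracket l ^ q \<le> C * bracket \<kappa> powr L"
proof -
  \<comment> \<open>Bookkeeping for small \<open>m\<close>: \<open>bracket m ^ (M + q)\<close>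
    raises the order of \<open>A\<close> to \<mu> + \<delta> (M + q), and the differences of
    \<open>B\<close> of order \<open>M\<close> contribute \<nu> - \<rho> M + \<delta> q. The sum of
    the two must not exceed \<open>L\<close>.\<close>
  obtain M0 :: nat where M0: "(\<mu> + \<nu> + 2 * \<delta> * real q - L) / (\<rho> - \<delta>) \<le> real M0"
    using real_arch_simple by blast
  define M where "M = max N M0"
  have M: "N \<le> M" "\<mu> + \<nu> + 2 * \<delta> * real q - L \<le> (\<rho> - \<delta>) * real M"
  proof -
    have "(\<mu> + \<nu> + 2 * \<delta> * real q - L) / (\<rho> - \<delta>) \<le> real M" using M0 by (simp add: M_def)
    then show "\<mu> + \<nu> + 2 * \<delta> * real q - L \<le> (\<rho> - \<delta>) * real M"
      using d by (simp add: divide_le_eq mult.commute)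
  qed (simp add: M_def)
  define s where "s = \<nu> - \<rho> * real M + \<delta> * real q"
  \<comment> \<open>The exponent \<open>s\<close> may have either sign; a natural power
    \<open>t\<close> of the weight dominates the power \<open>s\<close> even where \<kappa> + z is
    not comparable with \<kappa>.\<close>
  define t where "t = nat \<lceil>\<bar>s\<bar>\<rceil>"
  have t: "\<bar>s\<bar> \<le> real t" unfolding t_def by linarith
  \<comment> \<open>For large \<open>m\<close>, each of \<open>P\<close> further powers of
    \<open>bracket m\<close> costs \<delta> in the order and is traded for a full power of
    \<open>bracket \<kappa>\<close>; the net gain 1 - \<delta> covers all other losses.\<close>
  obtain P :: nat where P0: "(\<mu> + \<delta> * real (M + q + t) - L) / (1 - \<delta>) \<le> real P"
    using real_arch_simple by blast
  have P: "\<mu> + \<delta> * real (M + q + t) - L \<le> (1 - \<delta>) * real P"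
    using P0 d by (simp add: divide_le_eq mult.commute)
  define Q where "Q = M + q + t + P"
  have finM: "finite {\<alpha> :: 'a \<Rightarrow> nat. mlen \<alpha> = M}"
    by (rule finite_subset[OF _ finite_mlen_less[of "Suc M"]]) auto
  have "\<forall>\<alpha>. \<exists>C. \<forall>\<kappa> l. norm (fdiff \<alpha> (\<lambda>\<kappa>. B \<kappa> l) \<kappa>) * bracket l ^ q \<le> C * bracket \<kappa> powr (\<nu> - \<rho> * real (mlen \<alpha>) + \<delta> * real q)"
    using coeff_class_coeff_bound[OF d(1) coeff_class_fdiff[OF B]] by blast
  then obtain Cb where Cb: "\<And>\<alpha> \<kappa> l. norm (fdiff \<alpha> (\<lambda>\<kappa>. B \<kappa> l) \<kappa>) * bracket l ^ q \<le> Cb \<alpha> * bracket \<kappa> powr (\<nu> - \<rho> * real (mlen \<alpha>) + \<delta> * real q)"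
    by metis
  define CB where "CB = (\<Sum>\<alpha> | mlen \<alpha> = M. \<bar>Cb \<alpha>\<bar>)"
  have CB0: "0 \<le> CB" by (simp add: CB_def sum_nonneg)
  have CB: "norm (fdiff \<alpha> (\<lambda>\<kappa>. B \<kappa> l) \<kappa>) \<le> CB * bracket \<kappa> powr s / bracket l ^ q" if "mlen \<alpha> = M" for \<alpha> \<kappa> l
  proof -
    have "\<bar>Cb \<alpha>\<bar> \<le> CB"
      unfolding CB_def by (rule member_le_sum) (use that finM in auto)
    then have "Cb \<alpha> \<le> CB" by linarith
    then have "Cb \<alpha> * bracket \<kappa> powr s \<le> CB * bracket \<kappa> powr s" by (rule mult_right_mono) simp
    then show ?thesis using Cb[of \<alpha> l \<kappa>] that by (simp add: s_def pos_le_divide_eq)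
  qed
  obtain CA where CA: "\<And>\<kappa> m. norm (A \<kappa> m) * bracket m ^ (M + q) \<le> CA * bracket \<kappa> powr (\<mu> + \<delta> * real (M + q))"
    using coeff_class_coeff_bound[OF d(1) A] by blast
  obtain CQ where CQ: "\<And>\<kappa> m. norm (A \<kappa> m) * bracket m ^ Q \<le> CQ * bracket \<kappa> powr (\<mu> + \<delta> * real Q)"
    using coeff_class_coeff_bound[OF d(1) A] by blast
  have nonneg: "0 \<le> c" if "\<And>\<kappa> m. norm (A \<kappa> m) * bracket m ^ k \<le> c * bracket \<kappa> powr r" for c k r
  proof -
    have "0 \<le> norm (A 0 0) * bracket (0 :: (int, 'a) vec) ^ k" by (simp add: less_imp_le)
    also have "\<dots> \<le> c * bracket (0 :: (int, 'a) vec) powr r" by (rule that)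
    finally show ?thesis by (simp add: bracket_def)
  qed
  have CA0: "0 \<le> CA" by (rule nonneg[OF CA])
  have CQ0: "0 \<le> CQ" by (rule nonneg[OF CQ])
  define C where "C = CA * CB * 2 powr \<bar>s\<bar> + CQ * CB * 3 ^ t * 2 ^ P"
  have "norm (A \<kappa> m * newton_rem M (\<lambda>\<kappa>. B \<kappa> l) \<kappa> m) * bracket m ^ q * bracket l ^ q \<le> C * bracket \<kappa> powr L" for \<kappa> m l
  proof (cases "2 * bracket m \<le> bracket \<kappa>")
    \<comment> \<open>Here \<open>bracket z \<le> bracket m\<close> is at most half of
      \<open>bracket \<kappa>\<close>, so the weights of \<kappa> + z and \<kappa> agree up to a
      factor 2.\<close>
    case True
    have "norm (newton_rem M (\<lambda>\<kappa>. B \<kappa> l) \<kappa> m) \<le> bracket m ^ M * (CB * (2 powr \<bar>s\<bar> * bracket \<kappa> powr s) / bracket l ^ q)"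
    proof (rule norm_newton_rem_le[where R = "bracket m"])
      fix \<alpha> :: "'a \<Rightarrow> nat" and z :: "(int, 'a) vec" assume a: "mlen \<alpha> = M" and z: "bracket z \<le> bracket m"
      have "bracket (\<kappa> + z) \<le> 2 * bracket \<kappa>" using bracket_add_le[of \<kappa> z] z True bracket_pos[of \<kappa>] by linarith
      moreover have "bracket \<kappa> \<le> 2 * bracket (\<kappa> + z)" using bracket_add_le[of "\<kappa> + z" "- z"] z True by simp
      ultimately have "bracket (\<kappa> + z) powr s \<le> 2 powr \<bar>s\<bar> * bracket \<kappa> powr s"
        by (intro powr_comparable) auto
      then have "CB * bracket (\<kappa> + z) powr s / bracket l ^ q \<le> CB * (2 powr \<bar>s\<bar> * bracket \<kappa> powr s) / bracket l ^ q"
        using CB0 by (intro divide_right_mono mult_left_mono) (auto simp: less_imp_le)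
      then show "norm (fdiff \<alpha> (\<lambda>\<kappa>. B \<kappa> l) (\<kappa> + z)) \<le> CB * (2 powr \<bar>s\<bar> * bracket \<kappa> powr s) / bracket l ^ q"
        using CB[OF a, of l "\<kappa> + z"] by linarith
    qed simp
    then have "norm (newton_rem M (\<lambda>\<kappa>. B \<kappa> l) \<kappa> m) * bracket l ^ q \<le> bracket m ^ M * (CB * (2 powr \<bar>s\<bar> * bracket \<kappa> powr s))"
      by (simp add: field_simps)
    then have "(norm (A \<kappa> m) * bracket m ^ q) * (norm (newton_rem M (\<lambda>\<kappa>. B \<kappa> l) \<kappa> m) * bracket l ^ q) \<le>
        (norm (A \<kappa> m) * bracket m ^ q) * (bracket m ^ M * (CB * (2 powr \<bar>s\<bar> * bracket \<kappa> powr s)))"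
      by (intro mult_left_mono) (auto simp: less_imp_le)
    also have "\<dots> = (norm (A \<kappa> m) * bracket m ^ (M + q)) * (CB * (2 powr \<bar>s\<bar> * bracket \<kappa> powr s))"
      by (simp add: power_add mult_ac)
    also have "\<dots> \<le> (CA * bracket \<kappa> powr (\<mu> + \<delta> * real (M + q))) * (CB * (2 powr \<bar>s\<bar> * bracket \<kappa> powr s))"
      using CB0 by (intro mult_right_mono CA) auto
    also have "\<dots> = CA * CB * 2 powr \<bar>s\<bar> * bracket \<kappa> powr (\<mu> + \<delta> * real (M + q) + s)"
      by (simp add: powr_add mult_ac)
    also have "\<dots> \<le> CA * CB * 2 powr \<bar>s\<bar> * bracket \<kappa> powr L"
      using CA0 CB0 M(2) bracket_ge_1[of \<kappa>] by (intro mult_left_mono powr_mono) (auto simp: s_def algebra_simps)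
    also have "\<dots> \<le> C * bracket \<kappa> powr L"
      using CQ0 CB0 by (intro mult_right_mono) (auto simp: C_def)
    finally show ?thesis by (simp add: norm_mult mult_ac)
  next
    \<comment> \<open>Now \<open>bracket \<kappa>\<close> is below \<open>2 * bracket m\<close>, so
      every \<kappa> + z has weight at most \<open>3 * bracket m\<close>, and powers of
      \<open>bracket m\<close> can pay for powers of \<open>bracket \<kappa>\<close>.\<close>
    case False
    have "norm (newton_rem M (\<lambda>\<kappa>. B \<kappa> l) \<kappa> m) \<le> bracket m ^ M * (CB * (3 * bracket m) ^ t / bracket l ^ q)"
    proof (rule norm_newton_rem_le[where R = "bracket m"])
      fix \<alpha> :: "'a \<Rightarrow> nat" and z :: "(int, 'a) vec" assume a: "mlen \<alpha> = M" and z: "bracket z \<le> bracket m"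
      have "bracket (\<kappa> + z) \<le> 3 * bracket m" using bracket_add_le[of \<kappa> z] z False by linarith
      then have "bracket (\<kappa> + z) ^ t \<le> (3 * bracket m) ^ t" by (intro power_mono) (auto simp: less_imp_le)
      moreover have "bracket (\<kappa> + z) powr s \<le> bracket (\<kappa> + z) ^ t" using t by (intro powr_le_power bracket_ge_1) auto
      ultimately have "CB * bracket (\<kappa> + z) powr s / bracket l ^ q \<le> CB * (3 * bracket m) ^ t / bracket l ^ q"
        using CB0 by (intro divide_right_mono mult_left_mono) (auto simp: less_imp_le)
      then show "norm (fdiff \<alpha> (\<lambda>\<kappa>. B \<kappa> l) (\<kappa> + z)) \<le> CB * (3 * bracket m) ^ t / bracket l ^ q"
        using CB[OF a, of l "\<kappa> + z"] by linarith
    qed simp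
    then have "norm (newton_rem M (\<lambda>\<kappa>. B \<kappa> l) \<kappa> m) * bracket l ^ q \<le> bracket m ^ M * (CB * (3 * bracket m) ^ t)"
      by (simp add: field_simps)
    then have "(norm (A \<kappa> m) * bracket m ^ q) * (norm (newton_rem M (\<lambda>\<kappa>. B \<kappa> l) \<kappa> m) * bracket l ^ q) \<le>
        (norm (A \<kappa> m) * bracket m ^ q) * (bracket m ^ M * (CB * (3 * bracket m) ^ t))"
      by (intro mult_left_mono) (auto simp: less_imp_le)
    then have 1: "norm (A \<kappa> m * newton_rem M (\<lambda>\<kappa>. B \<kappa> l) \<kappa> m) * bracket m ^ q * bracket l ^ q \<le> CB * 3 ^ t * (norm (A \<kappa> m) * bracket m ^ (M + q + t))"
      by (simp add: norm_mult power_add power_mult_distrib mult_ac)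
    have "bracket \<kappa> ^ P \<le> (2 * bracket m) ^ P" using False by (intro power_mono) (auto simp: less_imp_le)
    then have "norm (A \<kappa> m) * bracket m ^ (M + q + t) * bracket \<kappa> ^ P \<le> norm (A \<kappa> m) * bracket m ^ (M + q + t) * (2 * bracket m) ^ P"
      by (intro mult_left_mono) (auto simp: less_imp_le)
    also have "\<dots> = 2 ^ P * (norm (A \<kappa> m) * bracket m ^ Q)"
      by (simp add: Q_def power_add power_mult_distrib mult_ac)
    also have "\<dots> \<le> 2 ^ P * (CQ * bracket \<kappa> powr (\<mu> + \<delta> * real Q))"
      by (intro mult_left_mono CQ) auto
    also have "\<dots> \<le> 2 ^ P * (CQ * bracket \<kappa> powr (L + real P))"
      using CQ0 P bracket_ge_1[of \<kappa>] by (intro mult_left_mono powr_mono) (auto simp: Q_def algebra_simps)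
    also have "\<dots> = 2 ^ P * (CQ * bracket \<kappa> powr L) * bracket \<kappa> ^ P"
      by (simp add: powr_add powr_realpow)
    finally have "norm (A \<kappa> m) * bracket m ^ (M + q + t) \<le> 2 ^ P * (CQ * bracket \<kappa> powr L)"
      by (rule mult_right_le_imp_le) simp
    then have "CB * 3 ^ t * (norm (A \<kappa> m) * bracket m ^ (M + q + t)) \<le> CB * 3 ^ t * (2 ^ P * (CQ * bracket \<kappa> powr L))"
      using CB0 by (intro mult_left_mono) auto
    also have "\<dots> = CQ * CB * 3 ^ t * 2 ^ P * bracket \<kappa> powr L" by (simp add: mult_ac)
    also have "\<dots> \<le> C * bracket \<kappa> powr L"
      using CA0 CB0 by (intro mult_right_mono) (auto simp: C_def)
    finally show ?thesis using 1 by linarith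
  qed
  then show ?thesis using M(1) by blast
qed

text \<open>A difference is estimated by its two shifts and gains nothing, so \<open>L\<close> must
  already contain any improvement expected from \<alpha>. Of the powers of \<open>bracket p\<close>,
  |\<beta>| pay for the multiplier and 2n for summing the series.\<close>

lemma coeff_bounded_of_coeff_decay:
  fixes R :: "(int, 'n::{finite,linorder}) vec \<Rightarrow> (int, 'n) vec \<Rightarrow> complex"
  assumes R: "\<And>\<kappa> p. norm (R \<kappa> p) * bracket p ^ (mlen \<beta> + 2 * CARD('n)) \<le> C * bracket \<kappa> powr L"
  shows "coeff_bounded L \<alpha> \<beta> R"
proof -
  let ?q = "mlen \<beta> + 2 * CARD('n)"
  have "\<exists>C. \<forall>\<kappa> p. norm (fdiff \<alpha> (\<lambda>\<kappa>. R \<kappa> p) \<kappa>) * bracket p ^ ?q \<le> C * bracket \<kappa> powr L"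
  proof (induction \<alpha> rule: multi_index_induct)
    case zero
    show ?case using R by auto
  next
    case (Suc \<alpha> j)
    then obtain C where C: "\<And>\<kappa> p. norm (fdiff \<alpha> (\<lambda>\<kappa>. R \<kappa> p) \<kappa>) * bracket p ^ ?q \<le> C * bracket \<kappa> powr L" by blast
    have C0: "0 \<le> C"
    proof -
      have "0 \<le> norm (fdiff \<alpha> (\<lambda>\<kappa>. R \<kappa> 0) 0) * bracket (0 :: (int, 'n) vec) ^ ?q" by (simp add: less_imp_le)
      also have "\<dots> \<le> C * bracket (0 :: (int, 'n) vec) powr L" by (rule C)
      finally show ?thesis by (simp add: bracket_def)
    qed
    have "norm (fdiff (inc j \<alpha>) (\<lambda>\<kappa>. R \<kappa> p) \<kappa>) * bracket p ^ ?q \<le> (C * 2 powr \<bar>L\<bar> + C) * bracket \<kappa> powr L" for \<kappa> p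
    proof -
      have "bracket (\<kappa> + axis j 1) \<le> 2 * bracket \<kappa>" "bracket \<kappa> \<le> 2 * bracket (\<kappa> + axis j 1)"
        using bracket_add_mult[of \<kappa> "axis j 1"] bracket_add_mult[of "\<kappa> + axis j 1" "- axis j 1"] by (simp_all add: mult.commute)
      then have "bracket (\<kappa> + axis j 1) powr L \<le> 2 powr \<bar>L\<bar> * bracket \<kappa> powr L"
        by (intro powr_comparable) auto
      then have "C * bracket (\<kappa> + axis j 1) powr L \<le> C * (2 powr \<bar>L\<bar> * bracket \<kappa> powr L)"
        using C0 by (rule mult_left_mono)
      with C[of p "\<kappa> + axis j 1"] have 1: "norm (fdiff \<alpha> (\<lambda>\<kappa>. R \<kappa> p) (\<kappa> + axis j 1)) * bracket p ^ ?q \<le> C * (2 powr \<bar>L\<bar> * bracket \<kappa> powr L)"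
        by linarith
      have "norm (fdiff (inc j \<alpha>) (\<lambda>\<kappa>. R \<kappa> p) \<kappa>) * bracket p ^ ?q \<le>
         (norm (fdiff \<alpha> (\<lambda>\<kappa>. R \<kappa> p) (\<kappa> + axis j 1)) + norm (fdiff \<alpha> (\<lambda>\<kappa>. R \<kappa> p) \<kappa>)) * bracket p ^ ?q"
        unfolding fdiff_Suc fdiff1_def by (intro mult_right_mono norm_triangle_ineq4) (simp add: less_imp_le)
      also have "\<dots> \<le> C * (2 powr \<bar>L\<bar> * bracket \<kappa> powr L) + C * bracket \<kappa> powr L"
        unfolding distrib_right by (intro add_mono 1 C)
      finally show ?thesis by (simp add: algebra_simps)
    qed
    then show ?case by blast
  qed
  then obtain D where D: "\<And>\<kappa> p. norm (fdiff \<alpha> (\<lambda>\<kappa>. R \<kappa> p) \<kappa>) * bracket p ^ ?q \<le> D * bracket \<kappa> powr L" by blast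
  obtain E where E: "\<And>m :: (int, 'n) vec. norm (mfalling \<beta> m) \<le> E * bracket m ^ mlen \<beta>" using norm_mfalling_le by blast
  have E0: "0 \<le> E" using order_trans[OF norm_ge_zero E[of 0]] by (simp add: bracket_def)
  have "norm (fourier_series (\<lambda>m. mfalling \<beta> m * fdiff \<alpha> (\<lambda>\<kappa>. R \<kappa> m) \<kappa>) \<theta>) \<le> (E * D * bracket_sum TYPE('n)) * bracket \<kappa> powr L" for \<kappa> \<theta>
  proof -
    have "norm (mfalling \<beta> m * fdiff \<alpha> (\<lambda>\<kappa>. R \<kappa> m) \<kappa>) * bracket m ^ (2 * CARD('n)) \<le> E * D * bracket \<kappa> powr L" for m
    proof -
      have "norm (mfalling \<beta> m * fdiff \<alpha> (\<lambda>\<kappa>. R \<kappa> m) \<kappa>) * bracket m ^ (2 * CARD('n))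
        \<le> (E * bracket m ^ mlen \<beta>) * (norm (fdiff \<alpha> (\<lambda>\<kappa>. R \<kappa> m) \<kappa>)) * bracket m ^ (2 * CARD('n))"
        unfolding norm_mult by (intro mult_right_mono E) (auto simp: less_imp_le)
      also have "\<dots> = E * (norm (fdiff \<alpha> (\<lambda>\<kappa>. R \<kappa> m) \<kappa>) * bracket m ^ ?q)"
        by (simp add: power_add mult_ac)
      also have "\<dots> \<le> E * (D * bracket \<kappa> powr L)" by (intro mult_left_mono D E0)
      finally show ?thesis by (simp add: mult.assoc)
    qed
    note b = this
    have "norm (fourier_series (\<lambda>m. mfalling \<beta> m * fdiff \<alpha> (\<lambda>\<kappa>. R \<kappa> m) \<kappa>) \<theta>) \<le> E * D * bracket \<kappa> powr L * bracket_sum TYPE('n)"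
      by (rule order_trans[OF norm_fourier_series_le[OF abs_summable_bracket(1)[OF b]] abs_summable_bracket(2)[OF b]])
    then show ?thesis by (simp add: mult_ac)
  qed
  then show ?thesis unfolding coeff_bounded_def by blast
qed

section \<open>The composed symbol and its expansion\<close>

context
  fixes \<rho> \<delta> \<mu> \<nu> :: real and A B :: "(int, 'n::{finite,linorder}) vec \<Rightarrow> (int, 'n) vec \<Rightarrow> complex"
  assumes A: "coeff_class \<rho> \<delta> \<mu> A" and B: "coeff_class \<rho> \<delta> \<nu> B" and d: "0 \<le> \<delta>" "\<delta> < \<rho>" "\<rho> \<le> 1"
begin

definition comp_coeff :: "(int, 'n) vec \<Rightarrow> (int, 'n) vec \<Rightarrow> complex" where
  "comp_coeff \<kappa> = conv2 (\<lambda>(m, l). A \<kappa> m * B (\<kappa> + m) l)"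

definition comp_term :: "('n \<Rightarrow> nat) \<Rightarrow> (int, 'n) vec \<Rightarrow> (int, 'n) vec \<Rightarrow> complex" where
  "comp_term \<alpha> \<kappa> = conv (\<lambda>m. mbinom \<alpha> m * A \<kappa> m) (\<lambda>l. fdiff \<alpha> (\<lambda>\<kappa>. B \<kappa> l) \<kappa>)"

text \<open>For fixed \<kappa> the growth of \<open>B (\<kappa> + m) l\<close> in \<open>m\<close>
  is polynomial, by submultiplicativity of the weight, and the decay of \<open>A \<kappa> m\<close>
  absorbs it.\<close>

lemma rapid2_comp: "rapid2 (\<lambda>(m, l). A \<kappa> m * B (\<kappa> + m) l)"
  unfolding rapid2_def
proof
  fix q
  obtain C where C: "\<And>\<kappa> l. norm (B \<kappa> l) * bracket l ^ q \<le> C * bracket \<kappa> powr (\<nu> + \<delta> * real q)"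
    using coeff_class_coeff_bound[OF d(1) B] by blast
  have C0: "0 \<le> C"
  proof -
    have "0 \<le> norm (B 0 0) * bracket (0 :: (int, 'n) vec) ^ q" by (simp add: less_imp_le)
    also have "\<dots> \<le> C * bracket (0 :: (int, 'n) vec) powr (\<nu> + \<delta> * real q)" by (rule C)
    finally show ?thesis by (simp add: bracket_def)
  qed
  obtain t :: nat where t: "\<nu> + \<delta> * real q \<le> real t" using real_arch_simple by blast
  obtain D where D: "\<And>m. norm (A \<kappa> m) * bracket m ^ (q + t) \<le> D"
    using coeff_class_rapid[OF A, of \<kappa>] unfolding rapid_def by metis
  have "norm (A \<kappa> m * B (\<kappa> + m) l) * bracket m ^ q * bracket l ^ q \<le> D * (C * bracket \<kappa> ^ t)" for m l
  proof -
    have "norm (B (\<kappa> + m) l) * bracket l ^ q \<le> C * bracket (\<kappa> + m) powr (\<nu> + \<delta> * real q)" by (rule C)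
    also have "\<dots> \<le> C * bracket (\<kappa> + m) ^ t" by (intro mult_left_mono powr_le_power bracket_ge_1 t C0)
    also have "\<dots> \<le> C * (bracket \<kappa> * bracket m) ^ t"
      by (intro mult_left_mono power_mono bracket_add_mult C0) (simp add: less_imp_le)
    finally have "(norm (A \<kappa> m) * bracket m ^ q) * (norm (B (\<kappa> + m) l) * bracket l ^ q) \<le> (norm (A \<kappa> m) * bracket m ^ q) * (C * (bracket \<kappa> * bracket m) ^ t)"
      by (intro mult_left_mono) (auto simp: less_imp_le)
    also have "\<dots> = (norm (A \<kappa> m) * bracket m ^ (q + t)) * (C * bracket \<kappa> ^ t)"
      by (simp add: power_add power_mult_distrib mult_ac)
    also have "\<dots> \<le> D * (C * bracket \<kappa> ^ t)" by (intro mult_right_mono D mult_nonneg_nonneg C0) (simp add: less_imp_le)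
    finally show ?thesis by (simp add: norm_mult mult_ac)
  qed
  then show "\<exists>D. \<forall>m l. norm ((\<lambda>(m, l). A \<kappa> m * B (\<kappa> + m) l) (m, l)) * bracket m ^ q * bracket l ^ q \<le> D" by auto
qed

lemma rapid_mbinom: "rapid c \<Longrightarrow> rapid (\<lambda>m. mbinom \<alpha> m * c m)" for \<alpha> :: "'n \<Rightarrow> nat"
  unfolding mbinom_eq_mfalling mult.assoc by (intro rapid_cmult rapid_mfalling)

lemma rapid_comp_term: "rapid (comp_term \<alpha> \<kappa>)"
  unfolding comp_term_def by (intro rapid_conv rapid_mbinom rapid_fdiff coeff_class_rapid[OF A] coeff_class_rapid[OF B])

text \<open>Per unit of |\<alpha>| the multiplier on \<open>A\<close> costs \<delta> and the
  difference of \<open>B\<close> gains \<rho>.\<close>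

lemma coeff_class_comp_term: "coeff_class \<rho> \<delta> (\<mu> + \<nu> - real (mlen \<alpha>) * (\<rho> - \<delta>)) (comp_term \<alpha>)"
proof -
  have e: "mbinom \<alpha> m * A \<kappa> m = 1 / of_nat (mfact \<alpha>) * (mfalling \<alpha> m * A \<kappa> m)" for \<kappa> m
    by (simp add: mbinom_eq_mfalling)
  have "coeff_class \<rho> \<delta> ((\<mu> + \<delta> * real (mlen \<alpha>)) + (\<nu> - \<rho> * real (mlen \<alpha>))) (\<lambda>\<kappa>. comp_term \<alpha> \<kappa>)"
    unfolding comp_term_def e
    by (rule coeff_class_conv[OF coeff_class_cmult[OF coeff_class_mfalling[OF A d(1)]] coeff_class_fdiff[OF B]]) (use d in auto)
  then show ?thesis by (simp add: algebra_simps)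
qed

lemma comp_remainder_eq:
  "comp_coeff \<kappa> p - (\<Sum>\<alpha> | mlen \<alpha> < M. comp_term \<alpha> \<kappa> p) = conv2 (\<lambda>(m, l). A \<kappa> m * newton_rem M (\<lambda>\<kappa>. B \<kappa> l) \<kappa> m) p"
proof -
  let ?S = "{\<alpha> :: 'n \<Rightarrow> nat. mlen \<alpha> < M}"
  have 1: "((\<lambda>m. A \<kappa> m * B (\<kappa> + m) (p - m)) has_sum comp_coeff \<kappa> p) UNIV"
    unfolding comp_coeff_def conv2_def
    using has_sum_infsum[OF abs_summable_imp_summable[OF rapid_conv2(2)[OF rapid2_comp]]] by simp
  have 2: "((\<lambda>m. \<Sum>\<alpha>\<in>?S. (mbinom \<alpha> m * A \<kappa> m) * fdiff \<alpha> (\<lambda>\<kappa>. B \<kappa> (p - m)) \<kappa>) has_sum (\<Sum>\<alpha>\<in>?S. comp_term \<alpha> \<kappa> p)) UNIV"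
  proof (rule has_sum_finite_sum)
    fix \<alpha> :: "'n \<Rightarrow> nat"
    have "rapid2 (\<lambda>(m, l). (mbinom \<alpha> m * A \<kappa> m) * fdiff \<alpha> (\<lambda>\<kappa>. B \<kappa> l) \<kappa>)"
      by (intro rapid2_conv rapid_mbinom rapid_fdiff coeff_class_rapid[OF A] coeff_class_rapid[OF B])
    from has_sum_infsum[OF abs_summable_imp_summable[OF rapid_conv2(2)[OF this]]]
    show "((\<lambda>m. (mbinom \<alpha> m * A \<kappa> m) * fdiff \<alpha> (\<lambda>\<kappa>. B \<kappa> (p - m)) \<kappa>) has_sum comp_term \<alpha> \<kappa> p) UNIV"
      unfolding comp_term_def conv2_def by simp
  qed
  from has_sum_add[OF 1 has_sum_uminusI[OF 2]]
  have "((\<lambda>m. A \<kappa> m * newton_rem M (\<lambda>\<kappa>. B \<kappa> (p - m)) \<kappa> m) has_sum (comp_coeff \<kappa> p - (\<Sum>\<alpha>\<in>?S. comp_term \<alpha> \<kappa> p))) UNIV"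
    unfolding newton_rem_def right_diff_distrib sum_distrib_left by (simp add: mult_ac)
  from infsumI[OF this] show ?thesis by (simp add: conv2_def)
qed

lemma rapid_comp_coeff: "rapid (comp_coeff \<kappa>)"
  unfolding comp_coeff_def by (rule rapid_conv2(1)[OF rapid2_comp])

lemma coeff_class_comp_remainder:
  "coeff_class \<rho> \<delta> (\<mu> + \<nu> - real N * (\<rho> - \<delta>)) (\<lambda>\<kappa> p. comp_coeff \<kappa> p - (\<Sum>\<alpha> | mlen \<alpha> < N. comp_term \<alpha> \<kappa> p))"
  unfolding coeff_class_def
proof (intro conjI allI)
  show rR: "rapid (\<lambda>p. comp_coeff \<kappa> p - (\<Sum>\<alpha> | mlen \<alpha> < M. comp_term \<alpha> \<kappa> p))" for \<kappa> M
    by (intro rapid_diff rapid_sum rapid_comp_coeff rapid_comp_term)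
  fix \<alpha> \<beta> :: "'n \<Rightarrow> nat"
  \<comment> \<open>The target contains the gain from \<alpha> already, so \<open>M\<close> below
    depends on \<alpha> and \<beta>: each bound of the class is proved with its own expansion
    order.\<close>
  define L where "L = \<mu> + \<nu> - real N * (\<rho> - \<delta>) - \<rho> * real (mlen \<alpha>) + \<delta> * real (mlen \<beta>)"
  define q where "q = mlen \<beta> + 2 * CARD('n)"
  \<comment> \<open>There are two surplus exponents 2n: the one inside \<open>q\<close> pays for
    returning from coefficients to the function, the other for the convolution.\<close>
  obtain M C where M: "N \<le> M" and C: "\<And>\<kappa> m l. norm (A \<kappa> m * newton_rem M (\<lambda>\<kappa>. B \<kappa> l) \<kappa> m) * bracket m ^ (q + 2 * CARD('n)) * bracket l ^ (q + 2 * CARD('n)) \<le> C * bracket \<kappa> powr L"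
    using newton_remainder_decay[OF A B d, of N "q + 2 * CARD('n)" L] by blast
  have 1: "coeff_bounded L \<alpha> \<beta> (\<lambda>\<kappa> p. comp_coeff \<kappa> p - (\<Sum>\<alpha> | mlen \<alpha> < M. comp_term \<alpha> \<kappa> p))"
    unfolding comp_remainder_eq
  proof (rule coeff_bounded_of_coeff_decay)
    fix \<kappa> p
    have "norm (A \<kappa> m * newton_rem M (\<lambda>\<kappa>. B \<kappa> l) \<kappa> m) * bracket m ^ (q + 2 * CARD('n)) * bracket l ^ q \<le> C * bracket \<kappa> powr L" for m l
    proof (rule order_trans[OF mult_left_mono C])
      show "bracket l ^ q \<le> bracket l ^ (q + 2 * CARD('n))" by (intro power_increasing bracket_ge_1) simp
    qed (simp add: less_imp_le)
    then have "norm (conv2 (\<lambda>(m, l). A \<kappa> m * newton_rem M (\<lambda>\<kappa>. B \<kappa> l) \<kappa> m) p) * bracket p ^ q \<le> (C * bracket \<kappa> powr L) * bracket_sum TYPE('n)"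
      by (intro conv2_bound(1)) simp
    then show "norm (conv2 (\<lambda>(m, l). A \<kappa> m * newton_rem M (\<lambda>\<kappa>. B \<kappa> l) \<kappa> m) p) * bracket p ^ (mlen \<beta> + 2 * CARD('n)) \<le> (C * bracket_sum TYPE('n)) * bracket \<kappa> powr L"
      by (simp add: q_def mult_ac)
  qed
  \<comment> \<open>The additional terms of the longer expansion; each of them has length at least
    \<open>N\<close> and therefore at most the target order.\<close>
  let ?D = "{\<gamma> :: 'n \<Rightarrow> nat. mlen \<gamma> < M} - {\<gamma>. mlen \<gamma> < N}"
  have "coeff_class \<rho> \<delta> (\<mu> + \<nu> - real N * (\<rho> - \<delta>)) (\<lambda>\<kappa> p. \<Sum>\<gamma>\<in>?D. comp_term \<gamma> \<kappa> p)"
  proof (rule coeff_class_sum)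
    fix \<gamma> :: "'n \<Rightarrow> nat" assume "\<gamma> \<in> ?D"
    then have "real N * (\<rho> - \<delta>) \<le> real (mlen \<gamma>) * (\<rho> - \<delta>)" using d by (intro mult_right_mono) auto
    then show "coeff_class \<rho> \<delta> (\<mu> + \<nu> - real N * (\<rho> - \<delta>)) (comp_term \<gamma>)"
      by (intro coeff_class_mono[OF coeff_class_comp_term]) simp
  qed
  then have 2: "coeff_bounded L \<alpha> \<beta> (\<lambda>\<kappa> p. \<Sum>\<gamma>\<in>?D. comp_term \<gamma> \<kappa> p)"
    unfolding L_def coeff_class_def by blast
  have e: "comp_coeff \<kappa> p - (\<Sum>\<gamma> | mlen \<gamma> < N. comp_term \<gamma> \<kappa> p) =
     (comp_coeff \<kappa> p - (\<Sum>\<gamma> | mlen \<gamma> < M. comp_term \<gamma> \<kappa> p)) + (\<Sum>\<gamma>\<in>?D. comp_term \<gamma> \<kappa> p)" for \<kappa> p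
  proof -
    have "(\<Sum>\<gamma>\<in>?D. comp_term \<gamma> \<kappa> p) = (\<Sum>\<gamma> | mlen \<gamma> < M. comp_term \<gamma> \<kappa> p) - (\<Sum>\<gamma> | mlen \<gamma> < N. comp_term \<gamma> \<kappa> p)"
      by (rule sum_diff[OF finite_mlen_less]) (use M in auto)
    then show ?thesis by simp
  qed
  have "coeff_bounded L \<alpha> \<beta> (\<lambda>\<kappa> p. (comp_coeff \<kappa> p - (\<Sum>\<gamma> | mlen \<gamma> < M. comp_term \<gamma> \<kappa> p)) + (\<Sum>\<gamma>\<in>?D. comp_term \<gamma> \<kappa> p))"
    by (rule coeff_bounded_add[OF 1 2 rR]) (intro rapid_sum rapid_comp_term)
  then show "coeff_bounded (\<mu> + \<nu> - real N * (\<rho> - \<delta>) - \<rho> * real (mlen \<alpha>) + \<delta> * real (mlen \<beta>)) \<alpha> \<beta>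
      (\<lambda>\<kappa> p. comp_coeff \<kappa> p - (\<Sum>\<gamma> | mlen \<gamma> < N. comp_term \<gamma> \<kappa> p))"
    unfolding L_def e .
qed

end


section \<open>Composition of operators\<close>

text \<open>The transform carries the exponential with the opposite sign, which is why the
  coefficient at \<open>p\<close> is the value of \<open>f\<close> at -h p.\<close>

lemma hfourier_eq_fourier_series:
  assumes "h \<noteq> 0"
  shows "hfourier h f = fourier_series (\<lambda>p. f (h *\<^sub>R ivec (- p)))"
proof
  fix \<theta>
  have inj: "inj (\<lambda>\<kappa>. h *\<^sub>R ivec \<kappa>)"
    using assms inj_ivec by (auto simp: inj_def)
  have "hfourier h f \<theta> = (\<Sum>\<^sub>\<infinity>\<kappa>. exp (- 2 * of_real pi * \<i> / of_real h * of_real ((h *\<^sub>R ivec \<kappa>) \<bullet> \<theta>)) * f (h *\<^sub>R ivec \<kappa>))"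
    unfolding hfourier_def hlattice_eq by (subst infsum_reindex[OF inj]) (simp add: o_def)
  also have "\<dots> = (\<Sum>\<^sub>\<infinity>\<kappa>. f (h *\<^sub>R ivec \<kappa>) * torus_char (- \<kappa>) \<theta>)"
    using assms by (intro infsum_cong) (simp add: torus_char_def mult_ac)
  also have "\<dots> = (\<Sum>\<^sub>\<infinity>p. f (h *\<^sub>R ivec (- p)) * torus_char p \<theta>)"
    by (rule infsum_reindex_bij_witness[of _ uminus uminus]) auto
  finally show "hfourier h f \<theta> = fourier_series (\<lambda>p. f (h *\<^sub>R ivec (- p))) \<theta>" by (simp add: fourier_series_def)
qed

text \<open>Integrating the series of the transform term by term, the p-th term picks the
  coefficient of \<sigma> at frequency -(\<kappa> + p), which becomes the new summation variable.
  Absolute summability is the condition on \<open>f\<close> so that the formula can be applied to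
  \<open>Oph h \<tau> f\<close> as well.\<close>

lemma Oph_eq_infsum:
  assumes h: "h \<noteq> 0" and a: "abs_summable a" "\<sigma> (h *\<^sub>R ivec \<kappa>) = fourier_series a"
    and f: "abs_summable (\<lambda>p. f (h *\<^sub>R ivec p))"
  shows "Oph h \<sigma> f (h *\<^sub>R ivec \<kappa>) = (\<Sum>\<^sub>\<infinity>m. a m * f (h *\<^sub>R ivec (\<kappa> + m)))"
proof -
  let ?b = "\<lambda>p. f (h *\<^sub>R ivec (- p))"
  let ?g = "\<lambda>\<theta>. torus_char \<kappa> \<theta> * fourier_series a \<theta>"
  have b: "abs_summable ?b"
    using f summable_on_reindex_bij_witness[of UNIV uminus uminus UNIV "\<lambda>p. norm (?b p)" "\<lambda>p. norm (f (h *\<^sub>R ivec p))"]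
    unfolding abs_summable_def by simp
  have cont: "continuous_on (cbox 0 1) (\<lambda>\<theta>. ?g \<theta> * fourier_series ?b \<theta>)"
    by (intro continuous_intros a b)
  have "exp (2 * of_real pi * \<i> / of_real h * of_real ((h *\<^sub>R ivec \<kappa>) \<bullet> \<theta>)) = torus_char \<kappa> \<theta>" for \<theta>
    using h by (simp add: torus_char_def mult_ac)
  then have "Oph h \<sigma> f (h *\<^sub>R ivec \<kappa>) = (LINT \<theta>:cbox 0 1|lborel. ?g \<theta> * fourier_series ?b \<theta>)"
    unfolding Oph_def hfourier_eq_fourier_series[OF h] a(2) by simp
  also have "\<dots> = integral (cbox 0 1) (\<lambda>\<theta>. ?g \<theta> * fourier_series ?b \<theta>)"
    by (rule set_borel_integral_eq_integral(2))
       (unfold set_integrable_def, rule borel_integrable_compact[OF compact_cbox cont])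
  also have "\<dots> = (\<Sum>\<^sub>\<infinity>p. ?b p * integral (cbox 0 1) (\<lambda>\<theta>. ?g \<theta> * torus_char p \<theta>))"
  proof (rule infsumI[symmetric], rule has_sum_integral_fourier_series[OF b])
    show "continuous_on UNIV ?g" by (intro continuous_intros a)
    show "periodic ?g" by (simp add: periodic_def torus_char_arg_add fourier_series_periodic)
  qed
  also have "\<dots> = (\<Sum>\<^sub>\<infinity>p. ?b p * a (- (\<kappa> + p)))"
  proof (rule infsum_cong)
    fix p
    have "integral (cbox 0 1) (\<lambda>\<theta>. ?g \<theta> * torus_char p \<theta>) = coef (fourier_series a) (- (\<kappa> + p))"
      unfolding coef_def by (simp only: minus_minus torus_char_add mult_ac)
    then show "?b p * integral (cbox 0 1) (\<lambda>\<theta>. ?g \<theta> * torus_char p \<theta>) = ?b p * a (- (\<kappa> + p))"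
      by (simp add: coef_fourier_series[OF a(1)])
  qed
  also have "\<dots> = (\<Sum>\<^sub>\<infinity>m. a m * f (h *\<^sub>R ivec (\<kappa> + m)))"
    by (rule infsum_reindex_bij_witness[of _ "\<lambda>m. - (\<kappa> + m)" "\<lambda>p. - (\<kappa> + p)"]) (auto simp: mult.commute)
  finally show ?thesis .
qed

lemma schwartz_rapid:
  assumes h: "0 < h" "h \<le> 1" and f: "f \<in> schwartz h"
  shows "rapid (\<lambda>p :: int ^ 'n::finite. f (h *\<^sub>R ivec p))"
  unfolding rapid_def
proof
  fix q :: nat
  have "bdd_above ((\<lambda>k. (1 + norm k) ^ q * cmod (f k)) ` hlattice h)"
    using f by (simp add: schwartz_def)
  then obtain C where C: "\<And>k. k \<in> hlattice h \<Longrightarrow> (1 + norm k) ^ q * cmod (f k) \<le> C"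
    by (auto simp: bdd_above_def)
  let ?K = "real CARD('n) / h"
  have "norm (f (h *\<^sub>R ivec p)) * bracket p ^ q \<le> ?K ^ q * C" for p :: "int ^ 'n"
  proof -
    have "bracket p ^ q \<le> (?K * (1 + norm (h *\<^sub>R ivec p))) ^ q"
      by (intro power_mono bracket_comparable h) (simp add: less_imp_le)
    then have "norm (f (h *\<^sub>R ivec p)) * bracket p ^ q \<le> norm (f (h *\<^sub>R ivec p)) * (?K * (1 + norm (h *\<^sub>R ivec p))) ^ q"
      by (intro mult_left_mono) auto
    also have "\<dots> = ?K ^ q * ((1 + norm (h *\<^sub>R ivec p)) ^ q * norm (f (h *\<^sub>R ivec p)))"
      by (simp only: power_mult_distrib mult_ac)
    also have "\<dots> \<le> ?K ^ q * C"
      using h by (intro mult_left_mono C) (auto simp: hlattice_eq)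
    finally show ?thesis .
  qed
  then show "\<exists>C. \<forall>m :: int ^ 'n. norm (f (h *\<^sub>R ivec m)) * bracket m ^ q \<le> C" by blast
qed

text \<open>Decay of order \<open>Q\<close> of \<open>B \<kappa> l\<close> in \<open>l\<close> costs growth of order \<open>\<delta> Q\<close> in \<open>\<kappa>\<close>; as \<open>\<delta> < 1\<close>, this is absorbed through
  \<open>bracket \<kappa> \<le> bracket (\<kappa> + l) * bracket l\<close>.\<close>

lemma abs_summable_operator:
  fixes B :: "(int, 'n::{finite,linorder}) vec \<Rightarrow> (int, 'n) vec \<Rightarrow> complex"
  assumes B: "coeff_class \<rho> \<delta> \<nu> B" and d: "0 \<le> \<delta>" "\<delta> < 1" and F: "rapid F"
  shows "abs_summable (\<lambda>\<kappa>. \<Sum>\<^sub>\<infinity>l. B \<kappa> l * F (\<kappa> + l))"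
proof -
  let ?n = "2 * CARD('n)"
  \<comment> \<open>Budget for the powers of \<open>bracket l\<close>: 2n sum over \<open>l\<close>,
    and r + 2n are converted into powers of \<open>bracket \<kappa>\<close>, of which
    \<open>r\<close> cancel the growth of \<open>B\<close> and 2n sum over \<kappa>. The summand 1
    covers the rounding in \<open>r\<close>.\<close>
  obtain Q :: nat where "(2 * real ?n + \<bar>\<nu>\<bar> + 1) / (1 - \<delta>) \<le> real Q"
    using real_arch_simple by blast
  then have Q: "2 * real ?n + \<bar>\<nu>\<bar> + 1 \<le> (1 - \<delta>) * real Q"
    using d by (simp add: divide_le_eq mult.commute)
  define r where "r = nat \<lceil>\<nu> + \<delta> * real Q\<rceil>"
  have r: "\<nu> + \<delta> * real Q \<le> real r" unfolding r_def by linarith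
  have rQ: "r + ?n + ?n \<le> Q"
  proof -
    have "0 \<le> \<delta> * real Q" using d by simp
    then have "real r \<le> \<bar>\<nu>\<bar> + \<delta> * real Q + 1" unfolding r_def by linarith
    then have "real (r + ?n + ?n) \<le> real Q" using Q by (simp add: algebra_simps)
    then show ?thesis by linarith
  qed
  obtain C where C: "\<And>\<kappa> l. norm (B \<kappa> l) * bracket l ^ Q \<le> C * bracket \<kappa> powr (\<nu> + \<delta> * real Q)"
    using coeff_class_coeff_bound[OF d(1) B] by blast
  have C0: "0 \<le> C"
  proof -
    have "0 \<le> norm (B 0 0) * bracket (0 :: (int, 'n) vec) ^ Q" by (simp add: less_imp_le)
    also have "\<dots> \<le> C * bracket (0 :: (int, 'n) vec) powr (\<nu> + \<delta> * real Q)" by (rule C)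
    finally show ?thesis by (simp add: bracket_def)
  qed
  obtain D where D: "\<And>m. norm (F m) * bracket m ^ (r + ?n) \<le> D"
    using F unfolding rapid_def by metis
  have bound: "norm (B \<kappa> l * F (\<kappa> + l) * of_real (bracket \<kappa> ^ ?n)) * bracket l ^ ?n \<le> C * D" for \<kappa> l
  proof -
    have "norm (B \<kappa> l) * bracket l ^ (r + ?n + ?n) \<le> norm (B \<kappa> l) * bracket l ^ Q"
      by (intro mult_left_mono power_increasing rQ bracket_ge_1) simp
    also have "\<dots> \<le> C * bracket \<kappa> ^ r"
      by (rule order_trans[OF C]) (intro mult_left_mono powr_le_power bracket_ge_1 r C0)
    finally have 1: "norm (B \<kappa> l) * bracket l ^ ?n * bracket l ^ (r + ?n) \<le> C * bracket \<kappa> ^ r"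
      unfolding power_add by (simp only: mult_ac)
    have "bracket \<kappa> \<le> bracket (\<kappa> + l) * bracket l" using bracket_add_mult[of "\<kappa> + l" "- l"] by simp
    then have "bracket \<kappa> ^ (r + ?n) \<le> (bracket (\<kappa> + l) * bracket l) ^ (r + ?n)"
      by (intro power_mono) (auto simp: less_imp_le)
    then have "norm (B \<kappa> l) * norm (F (\<kappa> + l)) * bracket l ^ ?n * bracket \<kappa> ^ (r + ?n) \<le>
       norm (B \<kappa> l) * norm (F (\<kappa> + l)) * bracket l ^ ?n * (bracket (\<kappa> + l) * bracket l) ^ (r + ?n)"
      by (intro mult_left_mono) (auto simp: less_imp_le)
    also have "\<dots> = (norm (B \<kappa> l) * bracket l ^ ?n * bracket l ^ (r + ?n)) * (norm (F (\<kappa> + l)) * bracket (\<kappa> + l) ^ (r + ?n))"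
      by (simp only: power_mult_distrib mult_ac)
    also have "\<dots> \<le> (C * bracket \<kappa> ^ r) * D"
      using C0 by (intro mult_mono 1 D) (auto simp: less_imp_le)
    finally have "norm (B \<kappa> l) * norm (F (\<kappa> + l)) * bracket l ^ ?n * bracket \<kappa> ^ ?n * bracket \<kappa> ^ r \<le> C * D * bracket \<kappa> ^ r"
      by (simp add: power_add mult_ac)
    then have "norm (B \<kappa> l) * norm (F (\<kappa> + l)) * bracket l ^ ?n * bracket \<kappa> ^ ?n \<le> C * D"
      by (rule mult_right_le_imp_le) simp
    then show ?thesis by (simp add: norm_mult norm_power less_imp_le mult_ac)
  qed
  have "norm (\<Sum>\<^sub>\<infinity>l. B \<kappa> l * F (\<kappa> + l)) * bracket \<kappa> ^ ?n \<le> C * D * bracket_sum TYPE('n)" for \<kappa>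
  proof -
    let ?X = "\<lambda>l. B \<kappa> l * F (\<kappa> + l) * of_real (bracket \<kappa> ^ ?n)"
    have "norm (\<Sum>\<^sub>\<infinity>l. ?X l) \<le> C * D * bracket_sum TYPE('n)"
      using norm_infsum_bound[of ?X UNIV] abs_summable_bracket[of ?X, OF bound] unfolding abs_summable_def by linarith
    then show ?thesis by (simp add: infsum_cmult_left' norm_mult norm_power less_imp_le)
  qed
  then show ?thesis by (rule abs_summable_bracket(1))
qed

theorem theorem4p1:
  fixes h \<rho> \<delta> \<mu>\<^sub>1 \<mu>\<^sub>2 :: real
    and \<sigma> \<tau> :: "'n::{finite,linorder} symb"
  assumes "0 < h" and "h \<le> 1"
    and "0 \<le> \<delta>" and "\<delta> < \<rho>" and "\<rho> \<le> 1"
    and "\<sigma> \<in> symbol_class h \<mu>\<^sub>1 \<rho> \<delta>"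
    and "\<tau> \<in> symbol_class h \<mu>\<^sub>2 \<rho> \<delta>"
  shows "\<exists>\<zeta> \<in> symbol_class h (\<mu>\<^sub>1 + \<mu>\<^sub>2) \<rho> \<delta>.
           (\<forall>f \<in> schwartz h. \<forall>k \<in> hlattice h. (Oph h \<sigma> \<circ> Oph h \<tau>) f k = Oph h \<zeta> f k) \<and>
           asymp_composition h (\<mu>\<^sub>1 + \<mu>\<^sub>2) \<rho> \<delta> \<zeta> \<sigma> \<tau>"
proof -
  note h = assms(1,2) and d = assms(3-5)
  let ?e = "\<lambda>\<kappa> :: (int, 'n) vec. h *\<^sub>R ivec \<kappa>"
  have h0: "h \<noteq> 0" and h0': "complex_of_real h \<noteq> 0" using h by auto
  have smooth: "\<sigma> (?e \<kappa>) \<in> smooth_torus" "\<tau> (?e \<kappa>) \<in> smooth_torus" for \<kappa>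
    using assms(6,7) by (auto simp: symbol_class_def hlattice_eq)
  define A where "A \<kappa> = coef (\<sigma> (?e \<kappa>))" for \<kappa>
  define B where "B \<kappa> = coef (\<tau> (?e \<kappa>))" for \<kappa>
  have rA: "rapid (A \<kappa>)" and rB: "rapid (B \<kappa>)" for \<kappa>
    unfolding A_def B_def by (intro rapid_coef smooth)+
  have FA: "\<sigma> (?e \<kappa>) = fourier_series (A \<kappa>)" and FB: "\<tau> (?e \<kappa>) = fourier_series (B \<kappa>)" for \<kappa>
    unfolding A_def B_def by (intro smooth_torus_Fourier smooth)+
  have A: "coeff_class \<rho> \<delta> \<mu>\<^sub>1 A" using symbol_class_iff_coeff_class[where \<sigma> = \<sigma> and A = A, OF h rA FA] assms(6) by simp
  have B: "coeff_class \<rho> \<delta> \<mu>\<^sub>2 B" using symbol_class_iff_coeff_class[where \<sigma> = \<tau> and A = B, OF h rB FB] assms(7) by simp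
  let ?Z = "comp_coeff A B"
  have rZ: "rapid (?Z \<kappa>)" for \<kappa> by (rule rapid_comp_coeff[OF A B d])
  \<comment> \<open>The symbol is prescribed through the lattice index recovered by
    \<open>inv\<close>; off the lattice its value is arbitrary.\<close>
  define \<zeta> where "\<zeta> k = fourier_series (?Z (inv ?e k))" for k
  have inj: "inj ?e" using h0 inj_ivec by (auto simp: inj_def)
  have FZ: "\<zeta> (?e \<kappa>) = fourier_series (?Z \<kappa>)" for \<kappa> by (simp add: \<zeta>_def inv_f_f[OF inj])
  have asymp: "asymp_composition h (\<mu>\<^sub>1 + \<mu>\<^sub>2) \<rho> \<delta> \<zeta> \<sigma> \<tau>"
    unfolding asymp_composition_def
  proof
    fix N
    let ?R = "\<lambda>\<kappa> p. ?Z \<kappa> p - (\<Sum>\<alpha> | mlen \<alpha> < N. comp_term A B \<alpha> \<kappa> p)"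
    have rT: "rapid (comp_term A B \<alpha> \<kappa>)" for \<alpha> \<kappa> by (rule rapid_comp_term[OF A B d])
    have rR: "rapid (?R \<kappa>)" for \<kappa> by (intro rapid_diff rZ rapid_sum rT)
    \<comment> \<open>The factor \<open>h ^ mlen \<alpha>\<close> of D cancels against the
      denominator of the difference, and 1/\<alpha>! turns the falling factorial into
      \<open>mbinom\<close>.\<close>
    have T: "1 / of_nat (mfact \<alpha>) * tderiv h \<alpha> (\<sigma> (?e \<kappa>)) \<theta> * hdiff h \<alpha> (\<lambda>k'. \<tau> k' \<theta>) (?e \<kappa>) = fourier_series (comp_term A B \<alpha> \<kappa>) \<theta>" for \<alpha> \<kappa> \<theta>
    proof -
      have 1: "tderiv h \<alpha> (\<sigma> (?e \<kappa>)) \<theta> = of_real (h ^ mlen \<alpha>) * fourier_series (\<lambda>m. mfalling \<alpha> m * A \<kappa> m) \<theta>"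
        unfolding FA by (rule tderiv_fourier_series(1)[OF rA])
      have 2: "hdiff h \<alpha> (\<lambda>k'. \<tau> k' \<theta>) (?e \<kappa>) = fourier_series (\<lambda>l. fdiff \<alpha> (\<lambda>\<kappa>. B \<kappa> l) \<kappa>) \<theta> / of_real h ^ mlen \<alpha>"
        unfolding hdiff_eq_fdiff FB fourier_series_fdiff[OF rB] ..
      have 3: "fourier_series (\<lambda>m. mbinom \<alpha> m * A \<kappa> m) \<theta> = 1 / of_nat (mfact \<alpha>) * fourier_series (\<lambda>m. mfalling \<alpha> m * A \<kappa> m) \<theta>"
        unfolding mbinom_eq_mfalling mult.assoc fourier_series_cmult ..
      have "rapid (\<lambda>m. mbinom \<alpha> m * A \<kappa> m)"
        unfolding mbinom_eq_mfalling mult.assoc by (intro rapid_cmult rapid_mfalling rA)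
      then have "fourier_series (comp_term A B \<alpha> \<kappa>) \<theta> = fourier_series (\<lambda>m. mbinom \<alpha> m * A \<kappa> m) \<theta> * fourier_series (\<lambda>l. fdiff \<alpha> (\<lambda>\<kappa>. B \<kappa> l) \<kappa>) \<theta>"
        unfolding comp_term_def[OF A B d] by (rule fourier_series_conv) (rule rapid_fdiff[OF rB])
      then show ?thesis unfolding 1 2 3 using h0' by simp
    qed
    have "(\<lambda>\<theta>. \<zeta> (?e \<kappa>) \<theta> - (\<Sum>\<alpha> | mlen \<alpha> < N. 1 / of_nat (mfact \<alpha>) * tderiv h \<alpha> (\<sigma> (?e \<kappa>)) \<theta> *
        hdiff h \<alpha> (\<lambda>k'. \<tau> k' \<theta>) (?e \<kappa>))) = fourier_series (?R \<kappa>)" for \<kappa>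
      unfolding T FZ
      by (simp add: fun_eq_iff fourier_series_diff fourier_series_sum rapid_abs_summable rapid_sum rZ rT)
    then show "(\<lambda>k \<theta>. \<zeta> k \<theta> - (\<Sum>\<alpha> | mlen \<alpha> < N. 1 / of_nat (mfact \<alpha>) * tderiv h \<alpha> (\<sigma> k) \<theta> *
        hdiff h \<alpha> (\<lambda>k'. \<tau> k' \<theta>) k)) \<in> symbol_class h (\<mu>\<^sub>1 + \<mu>\<^sub>2 - real N * (\<rho> - \<delta>)) \<rho> \<delta>"
      using coeff_class_comp_remainder[OF A B d, of N] by (subst symbol_class_iff_coeff_class[OF h rR]) auto
  qed
  \<comment> \<open>For N = 0 the subtracted sum is empty, so the remainder is the symbol
    itself.\<close>
  moreover have "\<zeta> \<in> symbol_class h (\<mu>\<^sub>1 + \<mu>\<^sub>2) \<rho> \<delta>"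
    using asymp[unfolded asymp_composition_def, rule_format, of 0] by simp
  moreover have "(Oph h \<sigma> \<circ> Oph h \<tau>) f k = Oph h \<zeta> f k" if f: "f \<in> schwartz h" and k: "k \<in> hlattice h" for f k
  proof -
    obtain \<kappa> where \<kappa>: "k = ?e \<kappa>" using k by (auto simp: hlattice_eq)
    define F where "F = (\<lambda>p. f (?e p))"
    have rF: "rapid F" unfolding F_def by (rule schwartz_rapid[OF h f])
    have aF: "abs_summable (\<lambda>p. f (?e p))" using rapid_abs_summable[OF rF] by (simp add: F_def)
    have G: "Oph h \<tau> f (?e \<kappa>) = (\<Sum>\<^sub>\<infinity>l. B \<kappa> l * F (\<kappa> + l))" for \<kappa>
      unfolding F_def by (rule Oph_eq_infsum[where \<sigma> = \<tau> and \<kappa> = \<kappa>, OF h0 rapid_abs_summable[OF rB] FB aF])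
    \<comment> \<open>This allows the series formula to be used a second time, with
      \<open>Oph h \<tau> f\<close> as the argument of the outer operator.\<close>
    have aG: "abs_summable (\<lambda>\<kappa>. Oph h \<tau> f (?e \<kappa>))"
      unfolding G by (rule abs_summable_operator[OF B _ _ rF]) (use d in auto)
    obtain D where D: "\<And>p. norm (F p) \<le> D"
      using rF unfolding rapid_def by (metis mult.right_neutral power_0)
    have "(Oph h \<sigma> \<circ> Oph h \<tau>) f k = (\<Sum>\<^sub>\<infinity>m. A \<kappa> m * Oph h \<tau> f (?e (\<kappa> + m)))"
      unfolding \<kappa> o_def by (rule Oph_eq_infsum[where \<sigma> = \<sigma> and \<kappa> = \<kappa>, OF h0 rapid_abs_summable[OF rA] FA aG])
    also have "\<dots> = (\<Sum>\<^sub>\<infinity>m. \<Sum>\<^sub>\<infinity>l. (A \<kappa> m * B (\<kappa> + m) l) * F (\<kappa> + (m + l)))"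
      unfolding G by (simp add: mult.assoc add.assoc infsum_cmult_right')
    \<comment> \<open>Terms with equal \<open>m + l\<close> are collected; the bounded function that
      \<open>conv2_infsum\<close> asks for is the translate of \<open>F\<close> by \<kappa>.\<close>
    also have "\<dots> = (\<Sum>\<^sub>\<infinity>p. ?Z \<kappa> p * F (\<kappa> + p))"
      unfolding comp_coeff_def[OF A B d]
      using conv2_infsum[OF abs_summable_rapid2[OF rapid2_comp[OF A B d]], of "\<lambda>p. F (\<kappa> + p)" D \<kappa>] D by simp
    also have "\<dots> = Oph h \<zeta> f k"
      unfolding \<kappa> F_def by (rule Oph_eq_infsum[where \<sigma> = \<zeta> and \<kappa> = \<kappa>, OF h0 rapid_abs_summable[OF rZ] FZ aF, symmetric])
    finally show ?thesis .
  qed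
  ultimately show ?thesis by blast
qed

end
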